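(* Let $h:\mathbb{R}\to(0,1)$ be $C^1$ with bounded derivative and let $f:\mathbb{R}\to\mathbb{R}$ be a deterministic locally integrable function. For $t\ge0$ let $Z(t):=\int_0^tf(s)\,dB^{(h)}(s)$. Then $Z$ is a well-defined $(\mathcal{S})^*$-valued process and, in $(\mathcal{S})^*$, $$\int_0^tf(s)\,dB^{(h)}(s)=\sum_{k=0}^\infty\Big(\int_0^tf(s)\frac{d}{ds}[g_{e_k}(s,h(s))]\,ds\Big)\langle\cdot,e_k\rangle.$$ Moreover $Z$ is a (centered) Gaussian process if and only if $\sum_{k\ge0}\big(\int_0^tf(s)\frac{d}{ds}[g_{e_k}(s,h(s))]ds\big)^2<\infty$ for all $t$, and in this case $Z(t)\sim\mathcal{N}\Big(0,\sum_{k\ge0}\big(\int_0^tf(s)\frac{d}{ds}[g_{e_k}(s,h(s))]ds\big)^2\Big)$. In particular $Z$ is Gaussian when $f\in C^1(\mathbb{R})$ with $\sup_t|f'(t)|<\infty$.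
   Context: White noise setting: $\Omega=\mathcal{S}'(\mathbb{R})$, white noise measure $\mu$, $\langle\cdot,e_k\rangle$ are i.i.d. standard Gaussian variables, $e_k$ the Hermite functions. $(\mathcal{S})^*$: Hida distributions (inductive limit of completions $(\mathcal{S}_{-p})$ of $(L^2)$ under $\|\sum_ka_k\langle\cdot,e_k\rangle\|^2_{-p}=\sum a_k^2(2k+2)^{-2p}$ on first chaos), with Wick product $\diamond$ and Pettis integral. $c_x=(2\pi/(\Gamma(2x+1)\sin\pi x))^{1/2}$; $\widehat{M_H(u)}(y)=\frac{\sqrt{2\pi}}{c_H}|y|^{1/2-H}\widehat u(y)$, $\widehat f(\xi)=\int e^{-ix\xi}f$; $g_f(t,H)=\int_0^tM_H(f)(x)dx$. $B^{(h)}$ is the normalized multifractional Brownian motion $\langle\cdot,M_{h(t)}(\mathbf{1}_{[0,t]})\rangle$; $W^{(h)}(t)=\sum_k\frac{d}{dt}[g_{e_k}(t,h(t))]\langle\cdot,e_k\rangle$ is its $(\mathcal{S})^*$-derivative. The Wick–Itô integral is $\int_0^tY(s)dB^{(h)}(s):=\int_{\mathbb{R}}\mathbf{1}_{[0,t]}(s)Y(s)\diamond W^{(h)}(s)ds$ (Pettis integral in $(\mathcal{S})^*$); for deterministic $f$, $f(s)\diamond W^{(h)}(s)=f(s)W^{(h)}(s)$. *)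

theory Defs
  imports "HOL-Probability.Probability"
begin

fun hermite_prob :: "nat \<Rightarrow> real \<Rightarrow> real" where
  "hermite_prob 0 x = 1"
| "hermite_prob (Suc 0) x = x"
| "hermite_prob (Suc (Suc n)) x = x * hermite_prob (Suc n) x - real (Suc n) * hermite_prob n x"

fun hermite_phys :: "nat \<Rightarrow> real \<Rightarrow> real" where
  "hermite_phys 0 x = 1"
| "hermite_phys (Suc 0) x = 2 * x"
| "hermite_phys (Suc (Suc n)) x = 2 * x * hermite_phys (Suc n) x - 2 * real (Suc n) * hermite_phys n x"

definition hermite_fun :: "nat \<Rightarrow> real \<Rightarrow> real" where
  "hermite_fun k x = hermite_phys k x * exp (- (x\<^sup>2) / 2) / sqrt (2 ^ k * fact k * sqrt pi)"

definition fourier :: "(real \<Rightarrow> real) \<Rightarrow> real \<Rightarrow> complex" where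
  "fourier u \<xi> = (LINT x|lborel. exp (- \<i> * complex_of_real (x * \<xi>)) * complex_of_real (u x))"

definition c_const :: "real \<Rightarrow> real" where
  "c_const x = sqrt (2 * pi / (Gamma (2 * x + 1) * sin (pi * x)))"

text \<open>M_H u is the inverse Fourier transform of (sqrt(2 pi)/c_H) |y|^(1/2-H) \<hat>u(y);
  for real u it is real valued, we take the real part.\<close>
definition M_op :: "real \<Rightarrow> (real \<Rightarrow> real) \<Rightarrow> real \<Rightarrow> real" where
  "M_op H u x = Re ((1 / (2 * pi)) *
     (LINT y|lborel. exp (\<i> * complex_of_real (x * y)) *
        complex_of_real (sqrt (2 * pi) / c_const H * \<bar>y\<bar> powr (1/2 - H)) * fourier u y))"

definition g_fun :: "(real \<Rightarrow> real) \<Rightarrow> real \<Rightarrow> real \<Rightarrow> real" where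
  "g_fun u t H = (LBINT x=ereal 0..ereal t. M_op H u x)"

section \<open>Hida distributions via chaos coefficients\<close>

type_synonym multi_index = "nat \<Rightarrow> nat"
type_synonym hida = "multi_index \<Rightarrow> real"

definition MI :: "multi_index set" where
  "MI = {\<alpha>. finite {k. \<alpha> k \<noteq> 0}}"

definition mfact :: "multi_index \<Rightarrow> real" where
  "mfact \<alpha> = (\<Prod>k\<in>{k. \<alpha> k \<noteq> 0}. fact (\<alpha> k))"

definition twoN :: "multi_index \<Rightarrow> real" where
  "twoN \<alpha> = (\<Prod>k\<in>{k. \<alpha> k \<noteq> 0}. (2 * real k + 2) ^ (\<alpha> k))"

text \<open>(S)^*: union over p of the completions (S_{-p}).\<close>
definition hida_dist :: "hida \<Rightarrow> bool" where
  "hida_dist c \<longleftrightarrow> (\<forall>\<alpha>. \<alpha> \<notin> MI \<longrightarrow> c \<alpha> = 0) \<and>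
     (\<exists>p::nat. (\<lambda>\<alpha>. mfact \<alpha> * (c \<alpha>)\<^sup>2 * twoN \<alpha> powr (- 2 * real p)) summable_on MI)"

text \<open>(S): Hida test functions (projective limit of the (S_p)).\<close>
definition hida_test :: "hida \<Rightarrow> bool" where
  "hida_test d \<longleftrightarrow> (\<forall>\<alpha>. \<alpha> \<notin> MI \<longrightarrow> d \<alpha> = 0) \<and>
     (\<forall>p::nat. (\<lambda>\<alpha>. mfact \<alpha> * (d \<alpha>)\<^sup>2 * twoN \<alpha> ^ (2 * p)) summable_on MI)"

definition hida_pair :: "hida \<Rightarrow> hida \<Rightarrow> real" where
  "hida_pair c d = (\<Sum>\<^sub>\<infinity>\<alpha>\<in>MI. mfact \<alpha> * c \<alpha> * d \<alpha>)"

definition wick :: "hida \<Rightarrow> hida \<Rightarrow> hida" (infixl "\<diamond>" 70) where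
  "wick a b = (\<lambda>\<gamma>. if \<gamma> \<in> MI then
      (\<Sum>\<alpha>\<in>{\<alpha>. \<forall>k. \<alpha> k \<le> \<gamma> k}. a \<alpha> * b (\<lambda>k. \<gamma> k - \<alpha> k)) else 0)"

definition hida_const :: "real \<Rightarrow> hida" where
  "hida_const r = (\<lambda>\<alpha>. if \<alpha> = (\<lambda>_. 0) then r else 0)"

definition unit_index :: "nat \<Rightarrow> multi_index" where
  "unit_index k = (\<lambda>j. if j = k then 1 else 0)"

text \<open>First chaos element sum_k a_k <.,e_k>.\<close>
definition first_chaos :: "(nat \<Rightarrow> real) \<Rightarrow> hida" where
  "first_chaos a = (\<lambda>\<alpha>. if \<exists>k. \<alpha> = unit_index k then a (SOME k. \<alpha> = unit_index k) else 0)"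

definition pettis_has_integral :: "(real \<Rightarrow> hida) \<Rightarrow> hida \<Rightarrow> real set \<Rightarrow> bool" where
  "pettis_has_integral \<Phi> \<Psi> A \<longleftrightarrow> (\<forall>s\<in>A. hida_dist (\<Phi> s)) \<and> hida_dist \<Psi> \<and>
     (\<forall>\<phi>. hida_test \<phi> \<longrightarrow> set_integrable lborel A (\<lambda>s. hida_pair (\<Phi> s) \<phi>) \<and>
        (LINT s:A|lborel. hida_pair (\<Phi> s) \<phi>) = hida_pair \<Psi> \<phi>)"

definition pettis_integral :: "(real \<Rightarrow> hida) \<Rightarrow> real set \<Rightarrow> hida" where
  "pettis_integral \<Phi> A = (THE \<Psi>. pettis_has_integral \<Phi> \<Psi> A)"

definition mf_white_noise :: "(real \<Rightarrow> real) \<Rightarrow> real \<Rightarrow> hida" where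
  "mf_white_noise h t = first_chaos (\<lambda>k. deriv (\<lambda>u. g_fun (hermite_fun k) u (h u)) t)"

definition wick_ito_integrand :: "(real \<Rightarrow> real) \<Rightarrow> (real \<Rightarrow> real) \<Rightarrow> real \<Rightarrow> real \<Rightarrow> hida" where
  "wick_ito_integrand f h t = (\<lambda>s. hida_const (indicator {0..t} s * f s) \<diamond> mf_white_noise h s)"

definition wick_ito_det :: "(real \<Rightarrow> real) \<Rightarrow> (real \<Rightarrow> real) \<Rightarrow> real \<Rightarrow> hida" where
  "wick_ito_det f h t = pettis_integral (wick_ito_integrand f h t) UNIV"

text \<open>Abstract white noise space: probability space M carrying i.i.d. standard
  Gaussians xi k = <.,e_k> which generate the sigma algebra.\<close>
definition white_noise_space :: "'w measure \<Rightarrow> (nat \<Rightarrow> 'w \<Rightarrow> real) \<Rightarrow> bool" where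
  "white_noise_space M \<xi> \<longleftrightarrow> prob_space M \<and>
     (\<forall>k. distributed M lborel (\<xi> k) std_normal_density) \<and>
     prob_space.indep_vars M (\<lambda>_. borel) \<xi> UNIV \<and>
     sets M = sigma_sets (space M) (\<Union>k. {\<xi> k -` B \<inter> space M | B. B \<in> sets borel})"

definition L2_rv :: "'w measure \<Rightarrow> ('w \<Rightarrow> real) \<Rightarrow> bool" where
  "L2_rv M X \<longleftrightarrow> X \<in> borel_measurable M \<and> integrable M (\<lambda>\<omega>. (X \<omega>)\<^sup>2)"

definition wick_hermite :: "(nat \<Rightarrow> 'w \<Rightarrow> real) \<Rightarrow> multi_index \<Rightarrow> 'w \<Rightarrow> real" where
  "wick_hermite \<xi> \<alpha> \<omega> = (\<Prod>k\<in>{k. \<alpha> k \<noteq> 0}. hermite_prob (\<alpha> k) (\<xi> k \<omega>))"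

definition chaos_of :: "'w measure \<Rightarrow> (nat \<Rightarrow> 'w \<Rightarrow> real) \<Rightarrow> ('w \<Rightarrow> real) \<Rightarrow> hida" where
  "chaos_of M \<xi> X = (\<lambda>\<alpha>. if \<alpha> \<in> MI then
      (LINT \<omega>|M. X \<omega> * wick_hermite \<xi> \<alpha> \<omega>) / mfact \<alpha> else 0)"

definition centered_normal :: "'w measure \<Rightarrow> ('w \<Rightarrow> real) \<Rightarrow> real \<Rightarrow> bool" where
  "centered_normal M Y v \<longleftrightarrow> Y \<in> borel_measurable M \<and>
     ((v = 0 \<and> (AE \<omega> in M. Y \<omega> = 0)) \<or>
      (v > 0 \<and> distributed M lborel Y (normal_density 0 (sqrt v))))"

definition centered_gaussian_process :: "'w measure \<Rightarrow> (real \<Rightarrow> 'w \<Rightarrow> real) \<Rightarrow> real set \<Rightarrow> bool" where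
  "centered_gaussian_process M X T \<longleftrightarrow>
     (\<forall>S c. finite S \<and> S \<subseteq> T \<longrightarrow>
        (\<exists>v\<ge>0. centered_normal M (\<lambda>\<omega>. \<Sum>t\<in>S. c t * X t \<omega>) v))"

definition gaussian_represented :: "'w measure \<Rightarrow> (nat \<Rightarrow> 'w \<Rightarrow> real) \<Rightarrow> (real \<Rightarrow> 'w \<Rightarrow> real) \<Rightarrow> (real \<Rightarrow> hida) \<Rightarrow> real set \<Rightarrow> bool" where
  "gaussian_represented M \<xi> X Z T \<longleftrightarrow>
     (\<forall>t\<in>T. L2_rv M (X t) \<and> chaos_of M \<xi> (X t) = Z t) \<and> centered_gaussian_process M X T"

definition is_gaussian_hida_process :: "'w measure \<Rightarrow> (nat \<Rightarrow> 'w \<Rightarrow> real) \<Rightarrow> (real \<Rightarrow> hida) \<Rightarrow> real set \<Rightarrow> bool" where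
  "is_gaussian_hida_process M \<xi> Z T \<longleftrightarrow> (\<exists>X. gaussian_represented M \<xi> X Z T)"

end

(* Fourier side.  The Hermite functions are eigenfunctions of the Fourier transform, so
   g_{e_k}(s, H) is a constant depending on H times the integral over y of
     (sin (s y - k pi/2) + sin (k pi/2)) / y * |y|^(1/2-H) * e_k(y).
   Differentiating along s -> (s, h s) under the integral, and bounding every integrand by
   w(y)^2 + e_k(y)^2 + y^4 e_k(y)^2 with a fixed square integrable weight w, gives
   |d/ds g_{e_k}(s, h s)| <= C (k+1)^2 uniformly on compact sets.  This polynomial growth is beaten by
   the decay of the coefficients of test functions, so the Pettis integral exists and is computed
   coefficientwise.

   Probability side.  If sum a_k^2 < oo, the series sum a_k xi_k converges in L^2 and is Gaussian, by
   characteristic functions; Bessel's inequality gives the converse.  That the variance of any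
   representing variable is sum a_k^2 requires completeness of the Wick-Hermite system: vanishing
   Hermite moments are turned into vanishing integrals over cylinder sets, one coordinate at a time.

   If f is C^1, integration by parts reduces summability to Bessel's inequality for
   sum_k g_{e_k}(s, h s)^2. *)

theory Submission
  imports Defs "HOL-Real_Asymp.Real_Asymp"
begin

section \<open>Differentiation under the integral and rapidly decreasing functions\<close>

text \<open>The factor |y|^(1/2-H) is singular at 0 for H > 1/2 and unbounded at infinity for H <
  1/2, so the estimates require H to stay in an interval [2\<delta>, 1 - 2\<delta>]. A curve with
  values in (0,1) is sure to do so only over compact time sets, which makes all constants local in
  time. Differentiating in H produces ln |y|, which costs another power \<delta> at both ends. The
  growth (k+1)^2 is that of the squared norm of y^2 e_k.

  For g_{e_k}(s, h s) the division by y supplies the missing decay; this is why the derivative has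
  to be moved onto f.

  Completeness enters because a representing variable is given only through its chaos coefficients,
  whereas its law is a statement about the variable itself.\<close>

lemma has_vector_derivative_iff_quotient:
  "(f has_vector_derivative D) (at x) \<longleftrightarrow> ((\<lambda>s. (f s - f x) /\<^sub>R (s - x)) \<longlongrightarrow> D) (at x)"
proof -
  have eq: "norm (f s - f x - (s - x) *\<^sub>R D) / norm (s - x) = norm ((f s - f x) /\<^sub>R (s - x) - D)"
    if "s \<noteq> x" for s
  proof -
    have "f s - f x - (s - x) *\<^sub>R D = (s - x) *\<^sub>R ((f s - f x) /\<^sub>R (s - x) - D)"
      using that by (simp add: scaleR_diff_right)
    then show ?thesis using that by (simp only: norm_scaleR) simp
  qed
  have "(f has_vector_derivative D) (at x) \<longleftrightarrow>
      ((\<lambda>s. norm (f s - f x - (s - x) *\<^sub>R D) / norm (s - x)) \<longlongrightarrow> 0) (at x)"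
    unfolding has_vector_derivative_def has_derivative_iff_norm
    by (simp add: bounded_linear_scaleR_left[of D])
  also have "\<dots> \<longleftrightarrow> ((\<lambda>s. norm ((f s - f x) /\<^sub>R (s - x) - D)) \<longlongrightarrow> 0) (at x)"
    by (intro tendsto_cong) (auto simp: eventually_at_filter intro!: always_eventually eq[unfolded real_norm_def])
  finally show ?thesis by (simp add: tendsto_norm_zero_iff LIM_zero_iff)
qed

lemmas vector_derivative_quotient = has_vector_derivative_iff_quotient[THEN iffD1]
lemmas vector_derivative_quotientI = has_vector_derivative_iff_quotient[THEN iffD2]

text \<open>The mean value inequality turns the bound on \<open>f'\<close> into a Lipschitz bound
  with constant \<open>D y\<close>, so the difference quotients are dominated by \<open>D\<close>
  and dominated convergence applies along sequences. Banach values cover both the complex Fourier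
  integrals and the real parameter integrals.\<close>

lemma has_vector_derivative_integral_dominated:
  fixes f f' :: "real \<Rightarrow> 'a \<Rightarrow> 'b::{banach, second_countable_topology}"
  assumes r: "0 < r"
    and int: "\<And>s. \<bar>s - s0\<bar> < r \<Longrightarrow> integrable M (f s)"
    and der: "\<And>s y. \<bar>s - s0\<bar> < r \<Longrightarrow> y \<in> space M \<Longrightarrow> ((\<lambda>s. f s y) has_vector_derivative f' s y) (at s)"
    and bd: "\<And>s y. \<bar>s - s0\<bar> < r \<Longrightarrow> y \<in> space M \<Longrightarrow> norm (f' s y) \<le> D y"
    and D: "integrable M D"
    and meas: "f' s0 \<in> borel_measurable M"
  shows "((\<lambda>s. LINT y|M. f s y) has_vector_derivative (LINT y|M. f' s0 y)) (at s0)"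
proof -
  have lip: "norm (f s y - f s0 y) \<le> D y * norm (s - s0)"
    if "\<bar>s - s0\<bar> < r" "y \<in> space M" for s y
  proof (rule differentiable_bound [where S = "ball s0 r" and f' = "\<lambda>s d. d *\<^sub>R f' s y"])
    fix x assume "x \<in> ball s0 r"
    then have x: "\<bar>x - s0\<bar> < r" by (simp add: dist_real_def)
    show "((\<lambda>s. f s y) has_derivative (\<lambda>d. d *\<^sub>R f' x y)) (at x within ball s0 r)"
      using der[OF x that(2)] by (simp add: has_vector_derivative_def has_derivative_at_withinI)
    show "onorm (\<lambda>d. d *\<^sub>R f' x y) \<le> D y"
      using bd[OF x that(2)]
      by (intro onorm_le) (simp add: mult.commute[of "D y"] mult_left_mono)
  qed (use that r in \<open>auto simp: dist_real_def\<close>)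
  have "((\<lambda>s. (LINT y|M. f s y - f s0 y) /\<^sub>R (s - s0)) \<longlongrightarrow> (LINT y|M. f' s0 y)) (at s0)"
    unfolding tendsto_at_iff_sequentially
  proof (intro allI impI)
    fix X :: "nat \<Rightarrow> real"
    assume X: "\<forall>i. X i \<in> UNIV - {s0}" "X \<longlonglongrightarrow> s0"
    \<comment> \<open>Only a tail of \<open>X\<close> lies within radius \<open>r\<close>, where the
      Lipschitz bound holds. The shifted sequence \<open>Y\<close> lies there entirely, and
      \<open>LIMSEQ_offset\<close> undoes the shift.\<close>
    have "eventually (\<lambda>i. \<bar>X i - s0\<bar> < r) sequentially"
      using X(2) r unfolding tendsto_iff dist_real_def by blast
    then obtain N where N: "\<And>i. i \<ge> N \<Longrightarrow> \<bar>X i - s0\<bar> < r"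
      unfolding eventually_sequentially by blast
    define Y where "Y i = X (i + N)" for i
    have Y: "\<bar>Y i - s0\<bar> < r" "Y i \<noteq> s0" for i
      using N[of "i+N"] X(1) by (auto simp: Y_def)
    have Ylim: "Y \<longlonglongrightarrow> s0" unfolding Y_def using LIMSEQ_ignore_initial_segment[OF X(2)] .
    have s0: "\<bar>s0 - s0\<bar> < r" using r by simp
    have "(\<lambda>i. LINT y|M. (f (Y i) y - f s0 y) /\<^sub>R (Y i - s0)) \<longlonglongrightarrow> (LINT y|M. f' s0 y)"
    proof (rule integral_dominated_convergence[where w = D])
      show "(\<lambda>y. (f (Y i) y - f s0 y) /\<^sub>R (Y i - s0)) \<in> borel_measurable M" for i
        using int[OF Y(1)[of i]] int[OF s0] by (auto dest!: borel_measurable_integrable)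
      show "AE y in M. (\<lambda>i. (f (Y i) y - f s0 y) /\<^sub>R (Y i - s0)) \<longlonglongrightarrow> f' s0 y"
      proof (rule AE_I2)
        fix y assume "y \<in> space M"
        from der[OF s0 this]
        have "((\<lambda>s. (f s y - f s0 y) /\<^sub>R (s - s0)) \<longlongrightarrow> f' s0 y) (at s0)"
          by (rule vector_derivative_quotient)
        then show "(\<lambda>i. (f (Y i) y - f s0 y) /\<^sub>R (Y i - s0)) \<longlonglongrightarrow> f' s0 y"
          unfolding tendsto_at_iff_sequentially using Ylim Y(2) by (auto simp: o_def)
      qed
      show "AE y in M. norm ((f (Y i) y - f s0 y) /\<^sub>R (Y i - s0)) \<le> D y" for i
        using lip[OF Y(1)[of i]] Y(2)[of i]
        by (intro AE_I2) (simp add: divide_inverse[symmetric] mult.commute[of "inverse _"] pos_divide_le_eq)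
    qed (use D meas in auto)
    then have "(\<lambda>i. (LINT y|M. f (Y i) y - f s0 y) /\<^sub>R (Y i - s0)) \<longlonglongrightarrow> (LINT y|M. f' s0 y)"
      by simp
    then show "((\<lambda>s. (LINT y|M. f s y - f s0 y) /\<^sub>R (s - s0)) \<circ> X) \<longlonglongrightarrow> (LINT y|M. f' s0 y)"
      unfolding o_def Y_def by (rule LIMSEQ_offset)
  qed
  moreover have "eventually (\<lambda>s. (LINT y|M. f s y - f s0 y) /\<^sub>R (s - s0) =
      ((LINT y|M. f s y) - (LINT y|M. f s0 y)) /\<^sub>R (s - s0)) (at s0)"
    using r int unfolding eventually_at
    by (intro exI[of _ r]) (auto simp: dist_real_def)
  ultimately show ?thesis
    by (intro vector_derivative_quotientI) (rule Lim_transform_eventually)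
qed

text \<open>Decay without smoothness: the class is closed under sums, products and multiplication by
  powers, and it supplies integrability and vanishing boundary terms for Hermite functions and for
  Gaussian densities times polynomials.\<close>

definition rapid :: "(real \<Rightarrow> real) \<Rightarrow> bool" where
  "rapid u \<longleftrightarrow> u \<in> borel_measurable borel \<and> (\<forall>m. \<exists>C. \<forall>x. \<bar>x\<bar> ^ m * \<bar>u x\<bar> \<le> C)"

lemma rapid_measurable: "rapid u \<Longrightarrow> u \<in> borel_measurable borel"
  by (simp add: rapid_def)

lemma rapid_add: "rapid u \<Longrightarrow> rapid v \<Longrightarrow> rapid (\<lambda>x. u x + v x)"
  unfolding rapid_def
proof (safe, goal_cases)
  case (2 m)
  then obtain C1 C2 where C: "\<And>x. \<bar>x\<bar> ^ m * \<bar>u x\<bar> \<le> C1" "\<And>x. \<bar>x\<bar> ^ m * \<bar>v x\<bar> \<le> C2" by meson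
  have "\<bar>x\<bar> ^ m * \<bar>u x + v x\<bar> \<le> C1 + C2" for x
  proof -
    have "\<bar>x\<bar> ^ m * \<bar>u x + v x\<bar> \<le> \<bar>x\<bar> ^ m * (\<bar>u x\<bar> + \<bar>v x\<bar>)"
      by (intro mult_left_mono) auto
    then show ?thesis using C[of x] by (simp add: distrib_left)
  qed
  then show ?case by blast
qed auto

lemma rapid_power_mult:
  assumes "rapid u" shows "rapid (\<lambda>x. x ^ k * u x)"
  using assms unfolding rapid_def
proof (safe, goal_cases)
  case (2 m)
  then obtain C where "\<And>x. \<bar>x\<bar> ^ (m + k) * \<bar>u x\<bar> \<le> C" by meson
  then show ?case by (intro exI[of _ C]) (simp add: power_add abs_mult power_abs mult.assoc)
qed auto

lemma rapid_x: "rapid u \<Longrightarrow> rapid (\<lambda>x. x * u x)"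
  using rapid_power_mult[of u 1] by simp

lemma rapid_mult: "rapid u \<Longrightarrow> rapid v \<Longrightarrow> rapid (\<lambda>x. u x * v x)"
  unfolding rapid_def
proof (safe, goal_cases)
  case (2 m)
  then obtain C1 C2 where C: "\<And>x. \<bar>x\<bar> ^ m * \<bar>u x\<bar> \<le> C1" "\<And>x. \<bar>x\<bar> ^ 0 * \<bar>v x\<bar> \<le> C2" by meson
  have "\<bar>x\<bar> ^ m * \<bar>u x * v x\<bar> \<le> C1 * C2" for x
  proof -
    have "(\<bar>x\<bar> ^ m * \<bar>u x\<bar>) * \<bar>v x\<bar> \<le> C1 * C2"
      using C(1)[of x] C(2)[of x] by (intro mult_mono) (auto intro: order_trans[OF _ C(1)[of x]])
    then show ?thesis by (simp add: abs_mult mult.assoc)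
  qed
  then show ?case by blast
qed auto

lemma rapid_cmult: "rapid u \<Longrightarrow> rapid (\<lambda>x. c * u x)"
  unfolding rapid_def
proof (safe, goal_cases)
  case (2 m)
  then obtain C where C: "\<And>x. \<bar>x\<bar> ^ m * \<bar>u x\<bar> \<le> C" by meson
  have "\<bar>x\<bar> ^ m * \<bar>c * u x\<bar> \<le> \<bar>c\<bar> * C" for x
    using mult_left_mono[OF C[of x], of "\<bar>c\<bar>"] by (simp add: abs_mult ac_simps)
  then show ?case by blast
qed auto

lemma rapid_diff: "rapid u \<Longrightarrow> rapid v \<Longrightarrow> rapid (\<lambda>x. u x - v x)"
  using rapid_add[of u "\<lambda>x. (-1) * v x"] rapid_cmult[of v "-1"] by simp

lemma power_le_fact_exp: "0 \<le> z \<Longrightarrow> z ^ m \<le> fact m * exp z" for z :: real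
proof -
  assume z: "0 \<le> z"
  have "(\<Sum>n\<in>{m}. z ^ n /\<^sub>R fact n) \<le> (\<Sum>n. z ^ n /\<^sub>R fact n)"
    by (rule sum_le_suminf[OF summable_exp_generic]) (use z in auto)
  then have "inverse (fact m) * z ^ m \<le> exp z"
    unfolding exp_def by simp
  then have "fact m * (inverse (fact m) * z ^ m) \<le> fact m * exp z"
    by (intro mult_left_mono) auto
  then show ?thesis by (simp add: mult.assoc[symmetric])
qed

text \<open>For even powers, x^2/2 is put into \<open>power_le_fact_exp\<close>. Any power is
  reduced to an even one by expanding (z - 1)^2 >= 0 with z = |x|^m.\<close>

lemma rapid_gauss: "rapid (\<lambda>x. exp (- (x\<^sup>2) / 2))"
  unfolding rapid_def
proof (intro conjI allI)
  fix m :: nat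
  have ev: "\<bar>x\<bar> ^ (2*m) * exp (- (x\<^sup>2) / 2) \<le> 2 ^ m * fact m" for x :: real
  proof -
    have "(x\<^sup>2/2) ^ m \<le> fact m * exp (x\<^sup>2/2)"
      by (rule power_le_fact_exp) simp
    then have "2 ^ m * (x\<^sup>2/2) ^ m \<le> 2 ^ m * (fact m * exp (x\<^sup>2/2))"
      by (intro mult_left_mono) auto
    moreover have "2 ^ m * (x\<^sup>2/2) ^ m = \<bar>x\<bar> ^ (2*m)"
      by (simp only: power_mult_distrib[symmetric] power_mult) simp
    ultimately have "\<bar>x\<bar> ^ (2*m) \<le> 2 ^ m * fact m * exp (x\<^sup>2/2)"
      by (simp only: mult.assoc)
    then have "\<bar>x\<bar> ^ (2*m) * exp (- (x\<^sup>2) / 2) \<le> 2 ^ m * fact m * exp (x\<^sup>2/2) * exp (- (x\<^sup>2) / 2)"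
      by (intro mult_right_mono) auto
    then show ?thesis by (simp add: mult.assoc flip: exp_add)
  qed
  have "\<bar>x\<bar> ^ m * \<bar>exp (- (x\<^sup>2) / 2)\<bar> \<le> 1 + 2 ^ m * fact m" for x :: real
  proof -
    have "\<bar>x\<bar> ^ m \<le> 1 + \<bar>x\<bar> ^ (2*m)"
      using zero_le_power2[of "\<bar>x\<bar> ^ m - 1"] zero_le_power[OF abs_ge_zero[of x], of m]
      unfolding mult.commute[of 2 m] power_mult power2_diff one_power2 mult_1_right by linarith
    then have "\<bar>x\<bar> ^ m * exp (- (x\<^sup>2) / 2) \<le> (1 + \<bar>x\<bar> ^ (2*m)) * exp (- (x\<^sup>2) / 2)"
      by (intro mult_right_mono) auto
    also have "\<dots> \<le> 1 + 2 ^ m * fact m"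
      using add_mono[OF _ ev[of x], of "exp (- (x\<^sup>2) / 2)" 1] unfolding distrib_right by simp
    finally show ?thesis by simp
  qed
  then show "\<exists>C. \<forall>x::real. \<bar>x\<bar> ^ m * \<bar>exp (- (x\<^sup>2) / 2)\<bar> \<le> C" by blast
qed auto

text \<open>The decay bounds of orders 0 and 2 add up to domination by a multiple of 1/(1 +
  x^2).\<close>

lemma rapid_integrable:
  assumes "rapid u" shows "integrable lborel u"
proof -
  obtain C0 C2 where C: "\<And>x. \<bar>x\<bar> ^ 0 * \<bar>u x\<bar> \<le> C0" "\<And>x. \<bar>x\<bar> ^ 2 * \<bar>u x\<bar> \<le> C2"
    using assms unfolding rapid_def by meson
  have "integrable lborel (\<lambda>x::real. (C0 + C2) * inverse (1 + x\<^sup>2))"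
    using integrable_inverse_1_plus_square by (simp add: set_integrable_def)
  then show ?thesis
  proof (rule Bochner_Integration.integrable_bound)
    show "AE x in lborel. norm (u x) \<le> norm ((C0 + C2) * inverse (1 + x\<^sup>2))"
    proof (rule AE_I2)
      fix x :: real
      have "(1 + x\<^sup>2) * \<bar>u x\<bar> \<le> C0 + C2" using C(1)[of x] C(2)[of x] by (simp add: distrib_right)
      then have "\<bar>u x\<bar> \<le> (C0 + C2) * inverse (1 + x\<^sup>2)"
        by (simp add: field_simps add_pos_nonneg)
      then show "norm (u x) \<le> norm ((C0 + C2) * inverse (1 + x\<^sup>2))" by simp
    qed
  qed (use assms in \<open>auto simp: rapid_def\<close>)
qed

lemma rapid_tendsto_0:
  assumes "rapid u" shows "(u \<longlongrightarrow> 0) at_top" "(u \<longlongrightarrow> 0) at_bot"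
proof -
  obtain C where C: "\<And>x. \<bar>x\<bar> ^ 1 * \<bar>u x\<bar> \<le> C"
    using assms unfolding rapid_def by meson
  have b: "norm (u x) \<le> C / \<bar>x\<bar>" if "x \<noteq> 0" for x
    using C[of x] that by (simp add: field_simps)
  have l: "((\<lambda>x. C / \<bar>x\<bar>) \<longlongrightarrow> 0) at_top" "((\<lambda>x. C / \<bar>x\<bar>) \<longlongrightarrow> 0) at_bot" by real_asymp+
  show "(u \<longlongrightarrow> 0) at_top"
    by (rule Lim_null_comparison[OF _ l(1)]) (rule eventually_mono[OF eventually_gt_at_top[of 0]], rule b, simp)
  show "(u \<longlongrightarrow> 0) at_bot"
    by (rule Lim_null_comparison[OF _ l(2)]) (rule eventually_mono[OF eventually_at_bot_linorderI[of "-1" "\<lambda>x. x < 0"]], simp, rule b, simp)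
qed

text \<open>Integration by parts on the whole line in its simplest form: for a product
  \<open>F\<close> with vanishing limits there are no boundary terms. It gives orthogonality, the
  Fourier recursion and the Gaussian means of Hermite polynomials.\<close>

lemma integral_derivative_eq_0:
  fixes F f :: "real \<Rightarrow> 'a::euclidean_space"
  assumes "\<And>x. (F has_vector_derivative f x) (at x)" "continuous_on UNIV f" "integrable lborel f"
    "(F \<longlongrightarrow> 0) at_top" "(F \<longlongrightarrow> 0) at_bot"
  shows "(LINT x|lborel. f x) = 0"
proof -
  have "(LBINT x=-\<infinity>..\<infinity>. f x) = 0 - 0"
    by (rule interval_integral_FTC_integrable[where F = F])
      (use assms in \<open>auto simp: set_integrable_def continuous_on_eq_continuous_at ereal_tendsto_simps\<close>)
  then show ?thesis by (simp add: interval_lebesgue_integral_def set_lebesgue_integral_def)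
qed

section \<open>Hermite functions\<close>

text \<open>Without the normalising factor the recurrences contain no square roots.\<close>

definition herm_un :: "nat \<Rightarrow> real \<Rightarrow> real" where
  "herm_un n x = hermite_phys n x * exp (- (x\<^sup>2) / 2)"

lemma herm_un_rec: "herm_un (Suc (Suc n)) x = 2 * (x * herm_un (Suc n) x) - 2 * real (Suc n) * herm_un n x"
  by (simp add: herm_un_def algebra_simps)

lemma herm_un_1: "herm_un (Suc 0) x = 2 * (x * herm_un 0 x)"
  by (simp add: herm_un_def)

lemma rapid_herm_un: "rapid (herm_un n)"
proof (induction n rule: less_induct)
  case (less n)
  consider "n = 0" | "n = Suc 0" | m where "n = Suc (Suc m)"
    by (cases n; cases "n - 1") auto
  then show ?case
  proof cases
    case 1
    then show ?thesis using rapid_gauss by (simp add: herm_un_def)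
  next
    case 2
    have "rapid (\<lambda>x. 2 * (x * herm_un 0 x))"
      using less[of 0] 2 by (intro rapid_cmult rapid_x) simp
    then show ?thesis by (simp add: 2 herm_un_1[abs_def])
  next
    case 3
    have "rapid (\<lambda>x. 2 * (x * herm_un (Suc m) x) - 2 * real (Suc m) * herm_un m x)"
      using less[of m] less[of "Suc m"] 3 by (intro rapid_diff rapid_cmult rapid_x) auto
    then show ?thesis unfolding 3 herm_un_rec[abs_def] .
  qed
qed

text \<open>In operator form: x - d/dx raises the index by one. Orthogonality and the Fourier
  eigenvalues both rest on this relation.\<close>

lemma herm_un_has_derivative:
  "(herm_un n has_real_derivative x * herm_un n x - herm_un (Suc n) x) (at x)"
proof (induction n rule: induct_nat_012)
  case 0
  show ?case unfolding herm_un_def[abs_def] by (auto intro!: derivative_eq_intros)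
next
  case 1
  show ?case unfolding herm_un_def[abs_def]
    by (auto intro!: derivative_eq_intros simp: algebra_simps)
next
  case (ge2 n)
  note ge2[derivative_intros]
  have "((\<lambda>x. 2 * (x * herm_un (Suc n) x) - 2 * real (Suc n) * herm_un n x) has_real_derivative
      2 * (herm_un (Suc n) x + x * (x * herm_un (Suc n) x - herm_un (Suc (Suc n)) x))
      - 2 * real (Suc n) * (x * herm_un n x - herm_un (Suc n) x)) (at x)"
    by (auto intro!: derivative_eq_intros simp: algebra_simps)
  then show ?case
    unfolding herm_un_rec[abs_def, of n, symmetric]
    by (rule DERIV_cong) (simp add: herm_un_rec algebra_simps)
qed

lemma continuous_herm_un: "continuous_on S (herm_un n)"
  by (meson herm_un_has_derivative DERIV_isCont continuous_at_imp_continuous_on)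

lemma measurable_herm_un[measurable]: "herm_un n \<in> borel_measurable borel"
  using rapid_measurable[OF rapid_herm_un] .

lemma herm_un_lower: "2 * real (Suc n) * herm_un n x = 2 * (x * herm_un (Suc n) x) - herm_un (Suc (Suc n)) x"
  by (simp add: herm_un_rec)

section \<open>Orthogonality of the Hermite functions\<close>

definition herm_ip :: "nat \<Rightarrow> nat \<Rightarrow> real" where
  "herm_ip n l = (LINT x|lborel. herm_un n x * herm_un l x)"

lemma integral_derivative_herm_un_product:
  "(LINT x|lborel. (x * herm_un n x - herm_un (Suc n) x) * herm_un l x
     + herm_un n x * (x * herm_un l x - herm_un (Suc l) x)) = 0"
proof (rule integral_derivative_eq_0)
  show "((\<lambda>x. herm_un n x * herm_un l x) has_vector_derivative
     (x * herm_un n x - herm_un (Suc n) x) * herm_un l x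
     + herm_un n x * (x * herm_un l x - herm_un (Suc l) x)) (at x)" for x
    unfolding has_real_derivative_iff_has_vector_derivative[symmetric]
    by (auto intro!: derivative_eq_intros herm_un_has_derivative)
  show "integrable lborel (\<lambda>x. (x * herm_un n x - herm_un (Suc n) x) * herm_un l x
     + herm_un n x * (x * herm_un l x - herm_un (Suc l) x))"
    by (intro rapid_integrable rapid_add rapid_mult rapid_diff rapid_x rapid_herm_un)
  show "continuous_on UNIV (\<lambda>x. (x * herm_un n x - herm_un (Suc n) x) * herm_un l x
     + herm_un n x * (x * herm_un l x - herm_un (Suc l) x))"
    by (intro continuous_intros continuous_herm_un)
qed (intro rapid_tendsto_0 rapid_mult rapid_herm_un)+

text \<open>The adjoint of the raising operator x - d/dx is x + d/dx, which lowers the index l + 1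
  and produces the factor 2(l + 1). Both indices drop together, so the values at (n, 0) determine
  all inner products.\<close>

lemma herm_ip_rec: "herm_ip (Suc n) (Suc l) = 2 * real (Suc l) * herm_ip n l"
proof -
  have "(x * herm_un n x - herm_un (Suc n) x) * herm_un (Suc l) x
     + herm_un n x * (x * herm_un (Suc l) x - herm_un (Suc (Suc l)) x)
     = 2 * real (Suc l) * (herm_un n x * herm_un l x) - herm_un (Suc n) x * herm_un (Suc l) x" for x
    using herm_un_lower[of l x] by algebra
  then have "0 = (LINT x|lborel. 2 * real (Suc l) * (herm_un n x * herm_un l x) - herm_un (Suc n) x * herm_un (Suc l) x)"
    using integral_derivative_herm_un_product[of n "Suc l"] by simp
  also have "\<dots> = 2 * real (Suc l) * herm_ip n l - herm_ip (Suc n) (Suc l)"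
    unfolding herm_ip_def
    by (subst Bochner_Integration.integral_diff)
      (intro rapid_integrable rapid_cmult rapid_mult rapid_herm_un | simp del: of_nat_Suc)+
  finally show ?thesis by simp
qed

lemma herm_ip_commute: "herm_ip n l = herm_ip l n"
  by (simp add: herm_ip_def mult.commute)

lemma herm_ip_Suc_0: "herm_ip (Suc n) 0 = 0"
proof -
  have "(x * herm_un n x - herm_un (Suc n) x) * herm_un 0 x
     + herm_un n x * (x * herm_un 0 x - herm_un (Suc 0) x)
     = - (herm_un (Suc n) x * herm_un 0 x)" for x
    by (simp add: herm_un_1 algebra_simps)
  then have "(LINT x|lborel. - (herm_un (Suc n) x * herm_un 0 x)) = 0"
    using integral_derivative_herm_un_product[of n 0] by simp
  then show ?thesis by (simp add: herm_ip_def)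
qed

lemma herm_ip_0_0: "herm_ip 0 0 = sqrt pi"
proof -
  have "herm_un 0 x * herm_un 0 x = sqrt pi * normal_density 0 (sqrt (1/2)) x" for x
    by (simp add: normal_density_def herm_un_def flip: exp_add)
  then have "herm_ip 0 0 = sqrt pi * (LINT x|lborel. normal_density 0 (sqrt (1/2)) x)"
    unfolding herm_ip_def by simp
  then show ?thesis by (simp add: integral_normal_density)
qed

lemma herm_ip_eq: "herm_ip n l = (if n = l then 2 ^ n * fact n * sqrt pi else 0)"
proof (induction n arbitrary: l)
  case 0
  show ?case using herm_ip_0_0 herm_ip_Suc_0 herm_ip_commute by (cases l) auto
next
  case (Suc n)
  then show ?case
    by (cases l) (auto simp: herm_ip_Suc_0 herm_ip_rec)
qed

lemma hermite_fun_eq: "hermite_fun k x = herm_un k x / sqrt (2 ^ k * fact k * sqrt pi)"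
  by (simp add: hermite_fun_def herm_un_def)

lemma rapid_hermite_fun: "rapid (hermite_fun k)"
  using rapid_cmult[OF rapid_herm_un[of k], of "1 / sqrt (2 ^ k * fact k * sqrt pi)"]
  by (simp add: hermite_fun_eq[abs_def])

lemma measurable_hermite_fun[measurable]: "hermite_fun k \<in> borel_measurable borel"
  using rapid_measurable[OF rapid_hermite_fun] .

lemma hermite_fun_orthonormal:
  "(LINT x|lborel. hermite_fun k x * hermite_fun l x) = (if k = l then 1 else 0)"
proof -
  have "(LINT x|lborel. hermite_fun k x * hermite_fun l x)
     = herm_ip k l / (sqrt (2 ^ k * fact k * sqrt pi) * sqrt (2 ^ l * fact l * sqrt pi))"
    by (simp add: hermite_fun_eq herm_ip_def)
  then show ?thesis by (simp add: herm_ip_eq)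
qed

text \<open>The normalised three-term recurrence writes x e_k as a combination of e_{k+1} and
  e_{k-1} with coefficients sqrt((k+1)/2) and sqrt(k/2); the bound is its square via (a + b)^2 <=
  2a^2 + 2b^2. At k = 0 the factor k removes the truncated index k - 1.\<close>

lemma hermite_fun_x_square:
  "(x * hermite_fun k x)\<^sup>2 \<le> real (k + 1) * (hermite_fun (k + 1) x)\<^sup>2 + real k * (hermite_fun (k - 1) x)\<^sup>2"
proof -
  define N where "N k = 2 ^ k * fact k * sqrt pi" for k :: nat
  have Npos: "N k > 0" for k by (simp add: N_def)
  have sq: "(hermite_fun k x)\<^sup>2 = (herm_un k x)\<^sup>2 / N k" for k
    using Npos[of k] by (simp add: hermite_fun_eq power_divide N_def[symmetric])
  have NS: "N (Suc k) = 2 * real (Suc k) * N k" for k by (simp add: N_def)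
  have rec: "x * herm_un k x = herm_un (Suc k) x / 2 + real k * herm_un (k - 1) x"
    by (cases k) (simp_all add: herm_un_1 herm_un_rec field_simps)
  have am: "(a + b)\<^sup>2 \<le> 2 * a\<^sup>2 + 2 * b\<^sup>2" for a b :: real
    using sum_squares_bound[of a b] by (simp add: power2_sum)
  have "(x * herm_un k x)\<^sup>2 \<le> (herm_un (Suc k) x)\<^sup>2 / 2 + 2 * (real k)\<^sup>2 * (herm_un (k - 1) x)\<^sup>2"
    unfolding rec using am[of "herm_un (Suc k) x / 2" "real k * herm_un (k - 1) x"]
    by (simp add: power_divide power_mult_distrib)
  then have "(x * herm_un k x)\<^sup>2 / N k \<le> ((herm_un (Suc k) x)\<^sup>2 / 2 + 2 * (real k)\<^sup>2 * (herm_un (k - 1) x)\<^sup>2) / N k"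
    using Npos[of k] by (intro divide_right_mono) auto
  also have "\<dots> = real (k + 1) * ((herm_un (k + 1) x)\<^sup>2 / N (k + 1)) + real k * ((herm_un (k - 1) x)\<^sup>2 / N (k - 1))"
  proof (cases k)
    case 0
    then show ?thesis using Npos[of 0] NS[of 0] by (simp add: field_simps)
  next
    case (Suc m)
    have "real k * ((herm_un (k - 1) x)\<^sup>2 / N (k - 1)) = 2 * (real k)\<^sup>2 * (herm_un (k - 1) x)\<^sup>2 / N k"
      using Npos[of m] unfolding Suc NS[of m] by (simp add: power2_eq_square divide_simps del: of_nat_Suc)
    moreover have "real (k + 1) * ((herm_un (k + 1) x)\<^sup>2 / N (k + 1)) = (herm_un (Suc k) x)\<^sup>2 / 2 / N k"
      using Npos[of k] NS[of k] by (simp add: divide_simps del: of_nat_Suc)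
    ultimately show ?thesis by (simp add: add_divide_distrib)
  qed
  finally show ?thesis by (simp add: power_mult_distrib sq)
qed

section \<open>Growth of the moments of Hermite functions in the index\<close>

definition herm_mom :: "nat \<Rightarrow> nat \<Rightarrow> real" where
  "herm_mom m k = (LINT x|lborel. (x ^ m * hermite_fun k x)\<^sup>2)"

lemma integrable_herm_mom: "integrable lborel (\<lambda>x. (x ^ m * hermite_fun k x)\<^sup>2)"
  unfolding power2_eq_square
  by (intro rapid_integrable rapid_mult rapid_power_mult rapid_hermite_fun)

lemma herm_mom_0: "herm_mom 0 k = 1"
  using hermite_fun_orthonormal[of k k] by (simp add: herm_mom_def power2_eq_square)

lemma herm_mom_Suc: "herm_mom (Suc m) k \<le> real (k + 1) * herm_mom m (k + 1) + real k * herm_mom m (k - 1)"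
proof -
  have "herm_mom (Suc m) k \<le> (LINT x|lborel. real (k + 1) * (x ^ m * hermite_fun (k + 1) x)\<^sup>2
      + real k * (x ^ m * hermite_fun (k - 1) x)\<^sup>2)"
    unfolding herm_mom_def
  proof (rule integral_mono)
    fix x :: real
    have "(x ^ m)\<^sup>2 * (x * hermite_fun k x)\<^sup>2 \<le>
       (x ^ m)\<^sup>2 * (real (k + 1) * (hermite_fun (k + 1) x)\<^sup>2 + real k * (hermite_fun (k - 1) x)\<^sup>2)"
      by (intro mult_left_mono hermite_fun_x_square) auto
    then show "(x ^ Suc m * hermite_fun k x)\<^sup>2 \<le> real (k + 1) * (x ^ m * hermite_fun (k + 1) x)\<^sup>2
      + real k * (x ^ m * hermite_fun (k - 1) x)\<^sup>2"
      by (simp add: power_mult_distrib algebra_simps)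
  qed (intro integrable_herm_mom Bochner_Integration.integrable_add integrable_mult_right)+
  also have "\<dots> = real (k + 1) * herm_mom m (k + 1) + real k * herm_mom m (k - 1)"
    unfolding herm_mom_def
    by (subst Bochner_Integration.integral_add) (intro integrable_herm_mom integrable_mult_right | simp)+
  finally show ?thesis .
qed

text \<open>Each application of \<open>herm_mom_Suc\<close> costs one power of k, so two of them
  give the square. The quadratic growth in all later coefficient bounds originates here.\<close>

lemma herm_mom_2: "herm_mom 2 k \<le> 4 * (real k + 1)\<^sup>2"
proof -
  have m1: "herm_mom 1 k \<le> 2 * real k + 1" for k
    using herm_mom_Suc[of 0 k] by (simp add: herm_mom_0)
  have "herm_mom 2 k \<le> real (k + 1) * herm_mom 1 (k + 1) + real k * herm_mom 1 (k - 1)"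
    using herm_mom_Suc[of 1 k] by (simp add: numeral_2_eq_2)
  also have "\<dots> \<le> real (k + 1) * (2 * real (k + 1) + 1) + real k * (2 * real (k - 1) + 1)"
    by (intro add_mono mult_left_mono m1) auto
  also have "\<dots> \<le> 4 * (real k + 1)\<^sup>2"
    by (cases k) (auto simp: power2_eq_square algebra_simps)
  finally show ?thesis .
qed

section \<open>Hermite functions as eigenfunctions of the Fourier transform\<close>

lemma fourier_herm_un_0: "fourier (herm_un 0) \<xi> = complex_of_real (sqrt (2 * pi) * herm_un 0 \<xi>)"
proof -
  \<comment> \<open>The characteristic function carries e^{+itx}; the argument -\<xi> adapts it to
    the sign convention of \<open>fourier\<close>.\<close>
  have "complex_of_real (exp (- (\<xi>\<^sup>2) / 2)) = char std_normal_distribution (-\<xi>)"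
    by (simp add: char_std_normal_distribution)
  also have "\<dots> = (LINT x|lborel. std_normal_density x *\<^sub>R iexp (- \<xi> * x))"
    unfolding char_def by (subst integral_density) (auto simp: normal_density_nonneg)
  also have "\<dots> = (LINT x|lborel. (1 / sqrt (2 * pi)) * (exp (- \<i> * complex_of_real (x * \<xi>)) * complex_of_real (herm_un 0 x)))"
    by (intro Bochner_Integration.integral_cong)
      (auto simp: std_normal_density_def herm_un_def scaleR_conv_of_real mult_ac)
  also have "\<dots> = (1 / sqrt (2 * pi)) * fourier (herm_un 0) \<xi>"
    by (simp add: fourier_def)
  finally have "complex_of_real (herm_un 0 \<xi>) = complex_of_real (1 / sqrt (2 * pi)) * fourier (herm_un 0) \<xi>"
    by (simp add: herm_un_def)
  then have "complex_of_real (sqrt (2 * pi) * herm_un 0 \<xi>)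
      = complex_of_real (sqrt (2 * pi) * (1 / sqrt (2 * pi))) * fourier (herm_un 0) \<xi>"
    by (simp only: of_real_mult mult.assoc)
  moreover have "sqrt (2 * pi) * (1 / sqrt (2 * pi)) = 1" by simp
  ultimately show ?thesis by (simp only: of_real_1 mult_1_left)
qed

abbreviation iexpn :: "real \<Rightarrow> real \<Rightarrow> complex" where
  "iexpn \<xi> x \<equiv> exp (- \<i> * complex_of_real (x * \<xi>))"

lemma integrable_iexpn_mult:
  assumes "rapid u" shows "integrable lborel (\<lambda>x. iexpn \<xi> x * complex_of_real (u x))"
proof (rule Bochner_Integration.integrable_bound[OF rapid_integrable[OF assms]])
  show "(\<lambda>x. iexpn \<xi> x * complex_of_real (u x)) \<in> borel_measurable lborel"
    using rapid_measurable[OF assms] by measurable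
qed (auto simp: norm_mult)

lemma iexpn_has_derivative:
  "((\<lambda>s. iexpn s x) has_vector_derivative - \<i> * x * iexpn s x) (at s within S)"
  "((\<lambda>x. iexpn s x) has_vector_derivative - \<i> * s * iexpn s x) (at x within S)"
  using exp_scaleR_has_vector_derivative_right[of "- \<i> * complex_of_real x" s S]
    exp_scaleR_has_vector_derivative_right[of "- \<i> * complex_of_real s" x S]
  by (simp_all add: scaleR_conv_of_real mult_ac)

lemma fourier_has_derivative:
  assumes "rapid u"
  shows "((\<lambda>\<xi>. fourier u \<xi>) has_vector_derivative - \<i> * fourier (\<lambda>x. x * u x) \<xi>) (at \<xi>)"
proof -
  have "((\<lambda>s. LINT x|lborel. iexpn s x * complex_of_real (u x)) has_vector_derivative
      (LINT x|lborel. - \<i> * (iexpn \<xi> x * complex_of_real (x * u x)))) (at \<xi>)"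
  proof (rule has_vector_derivative_integral_dominated[where r = 1 and D = "\<lambda>x. \<bar>x * u x\<bar>"
        and f' = "\<lambda>s x. - \<i> * (iexpn s x * complex_of_real (x * u x))"])
    show "((\<lambda>s. iexpn s x * complex_of_real (u x)) has_vector_derivative
       - \<i> * (iexpn s x * complex_of_real (x * u x))) (at s)" for s x
      using has_vector_derivative_mult_left[OF iexpn_has_derivative(1)[of x s UNIV], of "u x"]
      by (simp add: mult_ac)
    show "(\<lambda>x. - \<i> * (iexpn \<xi> x * complex_of_real (x * u x))) \<in> borel_measurable lborel"
      using rapid_measurable[OF assms] by measurable
    show "integrable lborel (\<lambda>x. \<bar>x * u x\<bar>)"
      using rapid_integrable[OF rapid_x[OF assms]] by (rule integrable_abs)
  qed (use integrable_iexpn_mult[OF assms] in \<open>auto simp: norm_mult abs_mult\<close>)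
  then show ?thesis by (simp add: fourier_def)
qed

text \<open>The total derivative of e^{-i x \<xi>} times \<open>herm_un k x\<close> integrates to
  zero, and the raising relation makes \<open>herm_un (Suc k)\<close> appear in it.\<close>

lemma fourier_herm_un_Suc:
  "fourier (herm_un (Suc k)) \<xi> = fourier (\<lambda>x. x * herm_un k x) \<xi> - \<i> * \<xi> * fourier (herm_un k) \<xi>"
proof -
  let ?E = "\<lambda>x. complex_of_real (herm_un k x)" and ?E1 = "\<lambda>x. complex_of_real (herm_un (Suc k) x)"
  note int = integrable_iexpn_mult[OF rapid_herm_un] integrable_iexpn_mult[OF rapid_x[OF rapid_herm_un]]
  let ?f = "\<lambda>x. iexpn \<xi> x * complex_of_real (x * herm_un k x) - iexpn \<xi> x * ?E1 x
      - \<i> * \<xi> * (iexpn \<xi> x * ?E x)"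
  have "(LINT x|lborel. ?f x) = 0"
  proof (rule integral_derivative_eq_0[where F = "\<lambda>x. iexpn \<xi> x * ?E x"])
    show "((\<lambda>x. iexpn \<xi> x * ?E x) has_vector_derivative ?f x) (at x)" for x
    proof -
      have 1: "(?E has_vector_derivative complex_of_real (x * herm_un k x - herm_un (Suc k) x)) (at x)"
        by (rule has_vector_derivative_of_real[OF herm_un_has_derivative])
      have 2: "(iexpn \<xi> has_vector_derivative - \<i> * \<xi> * iexpn \<xi> x) (at x)"
        by (rule iexpn_has_derivative(2))
      show ?thesis
        using has_vector_derivative_mult[OF 2 1] by (simp add: algebra_simps)
    qed
    show "continuous_on UNIV ?f"
      by (intro continuous_intros continuous_herm_un)
    show "integrable lborel ?f" by (intro Bochner_Integration.integrable_diff integrable_mult_right int)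
    have "\<And>F. (herm_un k \<longlongrightarrow> 0) F \<Longrightarrow> ((\<lambda>x. iexpn \<xi> x * ?E x) \<longlongrightarrow> 0) F"
      by (rule tendsto_norm_zero_cancel) (simp add: norm_mult tendsto_rabs_zero)
    then show "((\<lambda>x. iexpn \<xi> x * ?E x) \<longlongrightarrow> 0) at_top" "((\<lambda>x. iexpn \<xi> x * ?E x) \<longlongrightarrow> 0) at_bot"
      using rapid_tendsto_0[OF rapid_herm_un[of k]] by blast+
  qed
  moreover have "(LINT x|lborel. ?f x) = fourier (\<lambda>x. x * herm_un k x) \<xi> - fourier (herm_un (Suc k)) \<xi>
     - \<i> * \<xi> * fourier (herm_un k) \<xi>"
    unfolding fourier_def
    by (subst Bochner_Integration.integral_diff Bochner_Integration.integral_mult_right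
        | intro Bochner_Integration.integrable_diff integrable_mult_right int | simp only: )+
  ultimately show ?thesis by (simp add: algebra_simps)
qed

text \<open>The transform carries the raising operator in x into -i times the raising operator in
  \<xi>, so each step of the index contributes a factor -i.\<close>

lemma fourier_herm_un: "fourier (herm_un k) \<xi> = sqrt (2 * pi) * (- \<i>) ^ k * herm_un k \<xi>"
proof (induction k arbitrary: \<xi>)
  case 0
  show ?case by (simp add: fourier_herm_un_0)
next
  case (Suc k)
  define c where "c = sqrt (2 * pi) * (- \<i>) ^ k"
  have F: "fourier (herm_un k) = (\<lambda>\<xi>. c * complex_of_real (herm_un k \<xi>))"
    using Suc by (simp add: fun_eq_iff c_def)
  have "((\<lambda>\<xi>. c * complex_of_real (herm_un k \<xi>)) has_vector_derivative
      c * complex_of_real (\<xi> * herm_un k \<xi> - herm_un (Suc k) \<xi>)) (at \<xi>)"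
    by (intro has_vector_derivative_mult_right has_vector_derivative_of_real
        herm_un_has_derivative)
  \<comment> \<open>The derivative of the transform is computed twice, under the integral sign and
    from the induction hypothesis; comparing the two yields the transform of x times
    \<open>herm_un k\<close>.\<close>
  with fourier_has_derivative[OF rapid_herm_un, of k \<xi>]
  have "- \<i> * fourier (\<lambda>x. x * herm_un k x) \<xi> = c * complex_of_real (\<xi> * herm_un k \<xi> - herm_un (Suc k) \<xi>)"
    unfolding F by (rule vector_derivative_unique_at)
  then have "\<i> * (- \<i> * fourier (\<lambda>x. x * herm_un k x) \<xi>) = \<i> * (c * complex_of_real (\<xi> * herm_un k \<xi> - herm_un (Suc k) \<xi>))"
    by simp
  then have "fourier (\<lambda>x. x * herm_un k x) \<xi> = \<i> * c * complex_of_real (\<xi> * herm_un k \<xi> - herm_un (Suc k) \<xi>)"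
    by (simp add: mult.assoc[symmetric])
  then have "fourier (herm_un (Suc k)) \<xi> = - \<i> * c * herm_un (Suc k) \<xi>"
    unfolding fourier_herm_un_Suc F by (simp add: algebra_simps)
  then show ?case by (simp add: c_def)
qed

lemma fourier_hermite_fun: "fourier (hermite_fun k) \<xi> = sqrt (2 * pi) * (- \<i>) ^ k * hermite_fun k \<xi>"
proof -
  have "fourier (hermite_fun k) \<xi> = fourier (herm_un k) \<xi> / sqrt (2 ^ k * fact k * sqrt pi)"
    by (simp add: fourier_def hermite_fun_eq)
  then show ?thesis by (simp add: fourier_herm_un hermite_fun_eq)
qed

section \<open>Dominating functions and Bessel's inequality\<close>

lemma integrable_lborel_abs_arg:
  fixes u :: "real \<Rightarrow> real"
  assumes [measurable]: "u \<in> borel_measurable borel"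
    and int: "integrable lborel (\<lambda>y. indicator {0..} y * u y)"
  shows "integrable lborel (\<lambda>y. u \<bar>y\<bar>)"
proof -
  have "integrable lborel (\<lambda>y. indicator {0..} (0 + (-1) * y) * u (0 + (-1) * y))"
    by (rule lborel_integrable_real_affine[OF int]) simp
  then have "integrable lborel (\<lambda>y. \<bar>indicator {0..} y * u y\<bar> + \<bar>indicator {0..} (- y) * u (- y)\<bar>)"
    using int by (intro Bochner_Integration.integrable_add integrable_abs) auto
  then show ?thesis
    by (rule Bochner_Integration.integrable_bound) (auto simp: indicator_def abs_if)
qed

text \<open>The square of the weight w. The exponents 2\<delta> - 1 at the origin and -1 - 2\<delta>
  at infinity lie just on the integrable side of -1.\<close>

definition sing_wt :: "real \<Rightarrow> real \<Rightarrow> real" where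
  "sing_wt \<delta> y = (if \<bar>y\<bar> \<le> 1 then \<bar>y\<bar> powr (2 * \<delta> - 1) else \<bar>y\<bar> powr (- 1 - 2 * \<delta>))"

lemma measurable_sing_wt[measurable]: "sing_wt \<delta> \<in> borel_measurable borel"
  unfolding sing_wt_def[abs_def] by measurable

lemma sing_wt_nonneg: "0 \<le> sing_wt \<delta> y"
  by (simp add: sing_wt_def)

text \<open>The known power integrals are gauge integrals. Nonnegativity makes them absolute, Borel
  measurability brings them from \<open>lebesgue\<close> to \<open>lborel\<close>, and evenness
  extends them to the whole line.\<close>

lemma integrable_sing_wt:
  assumes "0 < \<delta>" shows "integrable lborel (sing_wt \<delta>)"
proof -
  define u where "u y = (if y \<le> 1 then y powr (2 * \<delta> - 1) else y powr (- 1 - 2 * \<delta>))" for y :: real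
  have [measurable]: "u \<in> borel_measurable borel" unfolding u_def[abs_def] by measurable
  have A: "integrable lborel (\<lambda>y. indicator {0..1} y * y powr (2 * \<delta> - 1))"
  proof -
    have "(\<lambda>y. y powr (2 * \<delta> - 1)) integrable_on {0..1}"
      using assms by (intro integrable_on_powr_from_0) auto
    then have "(\<lambda>y. y powr (2 * \<delta> - 1)) absolutely_integrable_on {0..1}"
      by (subst absolutely_integrable_on_iff_nonneg) auto
    then have "integrable lebesgue (\<lambda>y. indicator {0..1} y * y powr (2 * \<delta> - 1))"
      by (simp add: set_integrable_def)
    then show ?thesis by (subst (asm) integrable_completion) auto
  qed
  have B: "integrable lborel (\<lambda>y. indicator {1..} y * y powr (- 1 - 2 * \<delta>))"
  proof -
    have "(\<lambda>y. y powr (- 1 - 2 * \<delta>)) integrable_on {1..}"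
      using has_integral_powr_to_inf[of "- 1 - 2 * \<delta>" 1] assms by auto
    then have "(\<lambda>y. y powr (- 1 - 2 * \<delta>)) absolutely_integrable_on {1..}"
      by (subst absolutely_integrable_on_iff_nonneg) auto
    then have "integrable lebesgue (\<lambda>y. indicator {1..} y * y powr (- 1 - 2 * \<delta>))"
      by (simp add: set_integrable_def)
    then show ?thesis by (subst (asm) integrable_completion) auto
  qed
  have "integrable lborel (\<lambda>y. indicator {0..} y * u y)"
    by (rule Bochner_Integration.integrable_bound[OF Bochner_Integration.integrable_add[OF A B]])
      (auto simp: u_def indicator_def)
  then have "integrable lborel (\<lambda>y. u \<bar>y\<bar>)"
    by (intro integrable_lborel_abs_arg) auto
  then show ?thesis by (simp add: u_def sing_wt_def[abs_def])
qed

definition herm_dom :: "real \<Rightarrow> nat \<Rightarrow> real \<Rightarrow> real" where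
  "herm_dom \<delta> k y = sing_wt \<delta> y + (hermite_fun k y)\<^sup>2 + (y\<^sup>2 * hermite_fun k y)\<^sup>2"

lemma herm_dom_nonneg: "0 \<le> herm_dom \<delta> k y"
  by (simp add: herm_dom_def sing_wt_nonneg)

lemma integrable_herm_dom: "0 < \<delta> \<Longrightarrow> integrable lborel (herm_dom \<delta> k)"
  using integrable_herm_mom[of 0 k] integrable_herm_mom[of 2 k] integrable_sing_wt[of \<delta>]
  unfolding herm_dom_def[abs_def] by (intro Bochner_Integration.integrable_add) auto

text \<open>The constant 5 is 1 + 4, from the norm of e_k and from
  \<open>herm_mom_2\<close>.\<close>

lemma integral_herm_dom_le:
  assumes "0 < \<delta>"
  shows "(LINT y|lborel. herm_dom \<delta> k y) \<le> ((LINT y|lborel. sing_wt \<delta> y) + 5) * (real k + 1)\<^sup>2"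
proof -
  have "(LINT y|lborel. herm_dom \<delta> k y) = (LINT y|lborel. sing_wt \<delta> y) + herm_mom 0 k + herm_mom 2 k"
    using integrable_herm_mom[of 0 k] integrable_herm_mom[of 2 k] integrable_sing_wt[OF assms]
    unfolding herm_dom_def[abs_def] herm_mom_def by simp
  also have "\<dots> \<le> (LINT y|lborel. sing_wt \<delta> y) * (real k + 1)\<^sup>2 + (real k + 1)\<^sup>2 + 4 * (real k + 1)\<^sup>2"
  proof (intro add_mono herm_mom_2)
    have 1: "1 \<le> (real k + 1)\<^sup>2" by (simp add: one_le_power)
    show "(LINT y|lborel. sing_wt \<delta> y) \<le> (LINT y|lborel. sing_wt \<delta> y) * (real k + 1)\<^sup>2"
      using mult_left_mono[OF 1, of "LINT y|lborel. sing_wt \<delta> y"]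
      by (simp add: integral_nonneg_AE sing_wt_nonneg)
    show "herm_mom 0 k \<le> (real k + 1)\<^sup>2" using 1 by (simp add: herm_mom_0)
  qed
  finally show ?thesis by (simp add: algebra_simps)
qed

lemma abs_mult_le_squares: "\<bar>a\<bar> * \<bar>b\<bar> \<le> a\<^sup>2 + (b::real)\<^sup>2"
proof -
  have "2 * (\<bar>a\<bar> * \<bar>b\<bar>) \<le> a\<^sup>2 + b\<^sup>2"
    using sum_squares_bound[of "\<bar>a\<bar>" "\<bar>b\<bar>"] by simp
  moreover have "0 \<le> \<bar>a\<bar> * \<bar>b\<bar>" by simp
  ultimately show ?thesis by linarith
qed

text \<open>Both cases use ab <= a^2 + b^2. For |y| <= 1 take a = |y|^(\<delta>-1/2) and b = e_k,
  which fixes the lower end of the range of r. For |y| > 1 take a = 1/|y| and b = y^2 e_k, which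
  fixes the upper end; there \<delta> <= 1/2 gives a^2 <= \<open>sing_wt \<delta> y\<close>.\<close>

lemma powr_hermite_le_dom:
  assumes "0 < \<delta>" "\<delta> \<le> 1/2" "\<delta> - 1/2 \<le> r" "r \<le> 1"
  shows "\<bar>y\<bar> powr r * \<bar>hermite_fun k y\<bar> \<le> herm_dom \<delta> k y"
proof (cases "\<bar>y\<bar> \<le> 1")
  case True
  have "\<bar>y\<bar> powr r \<le> \<bar>y\<bar> powr (\<delta> - 1/2)"
    using True assms by (cases "y = 0") (auto intro: powr_mono')
  then have "\<bar>y\<bar> powr r * \<bar>hermite_fun k y\<bar> \<le> \<bar>\<bar>y\<bar> powr (\<delta> - 1/2)\<bar> * \<bar>hermite_fun k y\<bar>"
    by (intro mult_right_mono) auto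
  also have "\<dots> \<le> (\<bar>y\<bar> powr (\<delta> - 1/2))\<^sup>2 + (hermite_fun k y)\<^sup>2"
    by (rule abs_mult_le_squares)
  also have "(\<bar>y\<bar> powr (\<delta> - 1/2))\<^sup>2 = sing_wt \<delta> y"
    using True by (simp add: sing_wt_def power2_eq_square flip: powr_add)
  finally show ?thesis unfolding herm_dom_def by (smt (verit) zero_le_power2)
next
  case False
  have "\<bar>y\<bar> powr r \<le> \<bar>y\<bar> powr 1"
    using False assms by (intro powr_mono) auto
  also have "\<dots> = \<bar>inverse \<bar>y\<bar>\<bar> * (\<bar>y\<bar> * \<bar>y\<bar>)"
  proof -
    have *: "a powr 1 = \<bar>inverse a\<bar> * (a * a)" if "0 < a" for a :: real
      using that by simp
    show ?thesis using False by (intro *) linarith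
  qed
  also have "\<dots> = \<bar>inverse \<bar>y\<bar>\<bar> * \<bar>y\<^sup>2\<bar>"
    by (simp add: power2_eq_square)
  finally have "\<bar>y\<bar> powr r * \<bar>hermite_fun k y\<bar> \<le> \<bar>inverse \<bar>y\<bar>\<bar> * \<bar>y\<^sup>2 * hermite_fun k y\<bar>"
    by (simp only: abs_mult mult.assoc[symmetric] mult_right_mono abs_ge_zero)
  also have "\<dots> \<le> (inverse \<bar>y\<bar>)\<^sup>2 + (y\<^sup>2 * hermite_fun k y)\<^sup>2"
    by (rule abs_mult_le_squares)
  also have "(inverse \<bar>y\<bar>)\<^sup>2 = \<bar>y\<bar> powr (-2)"
    using False by (simp add: powr_minus powr_numeral power_inverse)
  also have "\<dots> \<le> sing_wt \<delta> y"
    unfolding sing_wt_def using False assms by (simp add: powr_mono)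
  finally show ?thesis unfolding herm_dom_def by (smt (verit) zero_le_power2)
qed

text \<open>The logarithm is at most |y|^(-\<delta>)/\<delta> for small |y| and
  |y|^\<delta>/\<delta> for large |y|. The admissible range of r therefore shrinks by \<delta> at
  each end.\<close>

lemma powr_ln_hermite_le_dom:
  assumes "0 < \<delta>" "\<delta> \<le> 1/2" "2 * \<delta> - 1/2 \<le> r" "r \<le> 1 - \<delta>"
  shows "\<bar>ln \<bar>y\<bar>\<bar> * (\<bar>y\<bar> powr r * \<bar>hermite_fun k y\<bar>) \<le> herm_dom \<delta> k y / \<delta>"
proof (cases "y = 0")
  case True then show ?thesis using assms herm_dom_nonneg by simp
next
  case False
  define \<sigma> where "\<sigma> = (if \<bar>y\<bar> \<le> 1 then - \<delta> else \<delta>)"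
  have "\<bar>ln \<bar>y\<bar>\<bar> \<le> \<bar>y\<bar> powr \<sigma> / \<delta>"
  proof (cases "\<bar>y\<bar> \<le> 1")
    case True
    have "ln (inverse \<bar>y\<bar>) \<le> inverse \<bar>y\<bar> powr \<delta> / \<delta>"
      using True False assms by (intro ln_powr_bound) (auto simp: one_le_inverse)
    moreover have "inverse \<bar>y\<bar> powr \<delta> = \<bar>y\<bar> powr (- \<delta>)"
      using False by (simp add: powr_minus powr_def ln_inverse flip: exp_minus)
    ultimately show ?thesis using True False by (simp add: \<sigma>_def ln_inverse)
  next
    case F: False
    then show ?thesis using assms ln_powr_bound[of "\<bar>y\<bar>" \<delta>] by (simp add: \<sigma>_def)
  qed
  then have "\<bar>ln \<bar>y\<bar>\<bar> * (\<bar>y\<bar> powr r * \<bar>hermite_fun k y\<bar>) \<le> \<bar>y\<bar> powr \<sigma> / \<delta> * (\<bar>y\<bar> powr r * \<bar>hermite_fun k y\<bar>)"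
    by (intro mult_right_mono) auto
  also have "\<dots> = \<bar>y\<bar> powr (\<sigma> + r) * \<bar>hermite_fun k y\<bar> / \<delta>"
    by (simp add: powr_add)
  also have "\<dots> \<le> herm_dom \<delta> k y / \<delta>"
    using assms by (intro divide_right_mono powr_hermite_le_dom) (auto simp: \<sigma>_def)
  finally show ?thesis .
qed

section \<open>Bessel's inequality and continuity of parameter integrals\<close>

lemma integrable_mult_of_squares:
  fixes u v :: "'a \<Rightarrow> real"
  assumes "u \<in> borel_measurable M" "v \<in> borel_measurable M"
    "integrable M (\<lambda>x. (u x)\<^sup>2)" "integrable M (\<lambda>x. (v x)\<^sup>2)"
  shows "integrable M (\<lambda>x. u x * v x)"
proof (rule Bochner_Integration.integrable_bound[OF Bochner_Integration.integrable_add[OF assms(3,4)]])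
  show "AE x in M. norm (u x * v x) \<le> norm ((u x)\<^sup>2 + (v x)\<^sup>2)"
    using abs_mult_le_squares by (auto simp: abs_mult)
qed (use assms in measurable)

text \<open>Expands the nonnegative integral of the squared residual. The measure is arbitrary
  because two orthonormal systems are needed: the Hermite functions on the line and the coordinates
  \<open>\<xi> k\<close> on the probability space.\<close>

lemma bessel_inequality:
  fixes e :: "nat \<Rightarrow> 'a \<Rightarrow> real"
  assumes e_meas: "\<And>k. e k \<in> borel_measurable M" and e_sq: "\<And>k. integrable M (\<lambda>x. (e k x)\<^sup>2)"
    and ortho: "\<And>j k. (LINT x|M. e j x * e k x) = (if j = k then 1 else 0)"
    and u: "u \<in> borel_measurable M" "integrable M (\<lambda>x. (u x)\<^sup>2)"
  shows "(\<Sum>k<n. (LINT x|M. u x * e k x)\<^sup>2) \<le> (LINT x|M. (u x)\<^sup>2)"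
proof -
  define c where "c k = (LINT x|M. u x * e k x)" for k
  have ue: "integrable M (\<lambda>x. u x * e k x)" for k
    by (rule integrable_mult_of_squares[OF u(1) e_meas u(2) e_sq])
  have ee: "integrable M (\<lambda>x. e j x * e k x)" for j k
    by (rule integrable_mult_of_squares[OF e_meas e_meas e_sq e_sq])
  have eq: "(u x - (\<Sum>k<n. c k * e k x))\<^sup>2
      = (u x)\<^sup>2 - 2 * (\<Sum>k<n. c k * (u x * e k x)) + (\<Sum>j<n. \<Sum>k<n. c j * c k * (e j x * e k x))" for x
  proof -
    have "(\<Sum>k<n. c k * e k x)\<^sup>2 = (\<Sum>j<n. \<Sum>k<n. c j * c k * (e j x * e k x))"
      by (simp add: power2_eq_square sum_product mult_ac)
    moreover have "2 * u x * (\<Sum>k<n. c k * e k x) = 2 * (\<Sum>k<n. c k * (u x * e k x))"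
      by (simp add: sum_distrib_left mult_ac)
    ultimately show ?thesis by (simp add: power2_diff)
  qed
  have "0 \<le> (LINT x|M. (u x - (\<Sum>k<n. c k * e k x))\<^sup>2)"
    by (intro integral_nonneg_AE) auto
  also have "\<dots> = (LINT x|M. (u x)\<^sup>2) - 2 * (\<Sum>k<n. c k * c k) + (\<Sum>j<n. \<Sum>k<n. c j * c k * (if j = k then 1 else 0))"
    unfolding eq using u(2) ue ee by (simp add: c_def[symmetric] ortho)
  also have "(\<Sum>j<n. \<Sum>k<n. c j * c k * (if j = k then 1 else 0)) = (\<Sum>j<n. c j * c j)"
    by (intro sum.cong refl) (simp add: if_distrib cong: if_cong)
  finally show ?thesis by (simp add: c_def power2_eq_square)
qed

lemma tendsto_integral_dominated:
  fixes f :: "real \<Rightarrow> 'a \<Rightarrow> real"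
  assumes r: "0 < r"
    and meas: "\<And>s. \<bar>s - s0\<bar> < r \<Longrightarrow> f s \<in> borel_measurable M"
    and bd: "\<And>s y. \<bar>s - s0\<bar> < r \<Longrightarrow> y \<in> space M \<Longrightarrow> \<bar>f s y\<bar> \<le> D y"
    and D: "integrable M D"
    and cont: "\<And>y. y \<in> space M \<Longrightarrow> isCont (\<lambda>s. f s y) s0"
  shows "isCont (\<lambda>s. LINT y|M. f s y) s0"
  unfolding isCont_def tendsto_at_iff_sequentially
proof (intro allI impI)
  fix X :: "nat \<Rightarrow> real"
  assume X: "\<forall>i. X i \<in> UNIV - {s0}" "X \<longlonglongrightarrow> s0"
  have "eventually (\<lambda>i. \<bar>X i - s0\<bar> < r) sequentially"
    using X(2) r unfolding tendsto_iff dist_real_def by blast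
  then obtain N where N: "\<And>i. i \<ge> N \<Longrightarrow> \<bar>X i - s0\<bar> < r"
    unfolding eventually_sequentially by blast
  have "(\<lambda>i. LINT y|M. f (X (i + N)) y) \<longlonglongrightarrow> (LINT y|M. f s0 y)"
  proof (rule integral_dominated_convergence[where w = D])
    show "AE y in M. (\<lambda>i. f (X (i + N)) y) \<longlonglongrightarrow> f s0 y"
      using cont LIMSEQ_ignore_initial_segment[OF X(2), of N]
      by (intro AE_I2) (rule isCont_tendsto_compose)
  qed (use N D meas bd r in auto)
  then show "((\<lambda>s. LINT y|M. f s y) \<circ> X) \<longlonglongrightarrow> (LINT y|M. f s0 y)"
    unfolding o_def by (rule LIMSEQ_offset)
qed

section \<open>The fractional integral on the Fourier side\<close>

text \<open>The Fourier eigenvalue (-i)^k is the unit complex number of angle -k pi/2; as a phase it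
  merges with e^{ixy}.\<close>

definition herm_phase :: "nat \<Rightarrow> real" where "herm_phase k = real k * pi / 2"

definition frac_scale :: "real \<Rightarrow> real" where "frac_scale H = sqrt (2 * pi) / c_const H"

text \<open>\<open>frac_int k s H\<close> is, up to the factor \<open>frac_scale H / sqrt (2 * pi)\<close>, the value
  \<open>g_fun (hermite_fun k) s H\<close> on the Fourier side, and \<open>frac_int_deriv k s H d\<close> its derivative
  along a curve whose second component moves with speed \<open>d\<close>. At \<open>y = 0\<close> all integrands vanish,
  since \<open>0 powr r = 0\<close>.\<close>

definition frac_ker :: "nat \<Rightarrow> real \<Rightarrow> real \<Rightarrow> real \<Rightarrow> real" where
  "frac_ker k s H y = (sin (s * y - herm_phase k) + sin (herm_phase k)) / y * (\<bar>y\<bar> powr (1/2 - H) * hermite_fun k y)"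

definition frac_int :: "nat \<Rightarrow> real \<Rightarrow> real \<Rightarrow> real" where
  "frac_int k s H = (LINT y|lborel. frac_ker k s H y)"

definition frac_ker_deriv :: "nat \<Rightarrow> real \<Rightarrow> real \<Rightarrow> real \<Rightarrow> real \<Rightarrow> real" where
  "frac_ker_deriv k s H d y = cos (s * y - herm_phase k) * (\<bar>y\<bar> powr (1/2 - H) * hermite_fun k y)
     - d * ln \<bar>y\<bar> * frac_ker k s H y"

definition frac_int_deriv :: "nat \<Rightarrow> real \<Rightarrow> real \<Rightarrow> real \<Rightarrow> real" where
  "frac_int_deriv k s H d = (LINT y|lborel. frac_ker_deriv k s H d y)"

lemma measurable_frac_ker[measurable]:
  "frac_ker k s H \<in> borel_measurable borel" "frac_ker_deriv k s H d \<in> borel_measurable borel"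
  unfolding frac_ker_def[abs_def] frac_ker_deriv_def[abs_def] by measurable

text \<open>The sine is 1-Lipschitz, here by the sum-to-product formula. The bound removes the
  singularity 1/y uniformly in the phase, and at y = 0 division by zero gives 0.\<close>

lemma sin_quotient_le: "\<bar>(sin (s * y - \<theta>) + sin \<theta>) / y\<bar> \<le> \<bar>s\<bar>" for s y \<theta> :: real
proof (cases "y = 0")
  case False
  have "sin (s * y - \<theta>) + sin \<theta> = sin (s * y - \<theta>) - sin (- \<theta>)" by simp
  also have "\<dots> = 2 * sin (s * y / 2) * cos ((s * y - 2 * \<theta>) / 2)"
    by (subst sin_diff_sin) simp
  finally have "\<bar>sin (s * y - \<theta>) + sin \<theta>\<bar> = 2 * \<bar>sin (s * y / 2)\<bar> * \<bar>cos ((s * y - 2 * \<theta>) / 2)\<bar>"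
    by (simp add: abs_mult)
  also have "\<dots> \<le> 2 * \<bar>s * y / 2\<bar> * 1"
    by (intro mult_mono abs_sin_x_le_abs_x) auto
  finally show ?thesis using False by (simp add: abs_mult divide_le_eq)
qed simp

text \<open>The margin 2\<delta> for H is dictated by the logarithm: it puts the exponent 1/2 - H
  into the range of \<open>powr_ln_hermite_le_dom\<close>, hence also into that of
  \<open>powr_hermite_le_dom\<close>.\<close>

lemma frac_ker_le:
  assumes "0 < \<delta>" "2 * \<delta> \<le> H" "H \<le> 1 - 2 * \<delta>" "\<bar>s\<bar> \<le> T"
  shows "\<bar>frac_ker k s H y\<bar> \<le> T * herm_dom \<delta> k y"
    "\<bar>ln \<bar>y\<bar>\<bar> * \<bar>frac_ker k s H y\<bar> \<le> T * (herm_dom \<delta> k y / \<delta>)"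
    "\<bar>\<bar>y\<bar> powr (1/2 - H) * hermite_fun k y\<bar> \<le> herm_dom \<delta> k y"
proof -
  have q: "\<bar>(sin (s * y - herm_phase k) + sin (herm_phase k)) / y\<bar> \<le> T"
    using sin_quotient_le[of s y "herm_phase k"] assms(4) by linarith
  have T: "0 \<le> T" using assms(4) by linarith
  have a: "\<bar>\<bar>y\<bar> powr (1/2 - H) * hermite_fun k y\<bar> = \<bar>y\<bar> powr (1/2 - H) * \<bar>hermite_fun k y\<bar>"
    by (simp add: abs_mult)
  show *: "\<bar>\<bar>y\<bar> powr (1/2 - H) * hermite_fun k y\<bar> \<le> herm_dom \<delta> k y"
    unfolding a using assms by (intro powr_hermite_le_dom) auto
  have ln: "\<bar>ln \<bar>y\<bar>\<bar> * \<bar>\<bar>y\<bar> powr (1/2 - H) * hermite_fun k y\<bar> \<le> herm_dom \<delta> k y / \<delta>"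
    unfolding a using assms by (intro powr_ln_hermite_le_dom) auto
  show "\<bar>frac_ker k s H y\<bar> \<le> T * herm_dom \<delta> k y"
    unfolding frac_ker_def abs_mult[of "_ / y"] by (rule mult_mono[OF q *]) (use T in auto)
  have "\<bar>(sin (s * y - herm_phase k) + sin (herm_phase k)) / y\<bar> * (\<bar>ln \<bar>y\<bar>\<bar> * \<bar>\<bar>y\<bar> powr (1/2 - H) * hermite_fun k y\<bar>)
     \<le> T * (herm_dom \<delta> k y / \<delta>)"
    by (rule mult_mono[OF q ln]) (use T in auto)
  then show "\<bar>ln \<bar>y\<bar>\<bar> * \<bar>frac_ker k s H y\<bar> \<le> T * (herm_dom \<delta> k y / \<delta>)"
    unfolding frac_ker_def abs_mult[of "_ / y"] by (simp only: mult_ac)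
qed

text \<open>The 1 stems from the cosine term, L T / \<delta> from the logarithmic term.\<close>

lemma frac_ker_deriv_le:
  assumes "0 < \<delta>" "2 * \<delta> \<le> H" "H \<le> 1 - 2 * \<delta>" "\<bar>s\<bar> \<le> T" "\<bar>d\<bar> \<le> L"
  shows "\<bar>frac_ker_deriv k s H d y\<bar> \<le> (1 + L * T / \<delta>) * herm_dom \<delta> k y"
proof -
  have "\<bar>frac_ker_deriv k s H d y\<bar> \<le> \<bar>cos (s * y - herm_phase k)\<bar> * \<bar>\<bar>y\<bar> powr (1/2 - H) * hermite_fun k y\<bar>
      + \<bar>d\<bar> * (\<bar>ln \<bar>y\<bar>\<bar> * \<bar>frac_ker k s H y\<bar>)"
    unfolding frac_ker_deriv_def abs_mult[symmetric] mult.assoc[symmetric] by (rule abs_triangle_ineq4)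
  also have "\<dots> \<le> 1 * herm_dom \<delta> k y + L * (T * (herm_dom \<delta> k y / \<delta>))"
    using assms by (intro add_mono mult_mono frac_ker_le) auto
  finally show ?thesis by (simp add: algebra_simps)
qed

lemma integrable_frac_ker:
  assumes "0 < H" "H < 1"
  shows "integrable lborel (frac_ker k s H)" "integrable lborel (\<lambda>y. \<bar>y\<bar> powr (1/2 - H) * hermite_fun k y)"
    "integrable lborel (frac_ker_deriv k s H d)"
proof -
  define \<delta> where "\<delta> = min H (1 - H) / 2"
  have d: "0 < \<delta>" "2 * \<delta> \<le> H" "H \<le> 1 - 2 * \<delta>" using assms by (auto simp: \<delta>_def)
  note le = frac_ker_le[OF d order_refl] and led = frac_ker_deriv_le[OF d order_refl order_refl]
  have nn: "0 \<le> \<bar>d\<bar> * \<bar>s\<bar> / \<delta>" using d by simp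
  note int = integrable_herm_dom[OF d(1), of k]
  show "integrable lborel (frac_ker k s H)"
    by (rule Bochner_Integration.integrable_bound[OF integrable_mult_right[OF int, of "\<bar>s\<bar>"]])
      (use le(1) herm_dom_nonneg in \<open>auto simp: abs_mult\<close>)
  show "integrable lborel (\<lambda>y. \<bar>y\<bar> powr (1/2 - H) * hermite_fun k y)"
    by (rule Bochner_Integration.integrable_bound[OF int])
      (use le(3) herm_dom_nonneg in auto)
  show "integrable lborel (frac_ker_deriv k s H d)"
    by (rule Bochner_Integration.integrable_bound[OF integrable_mult_right[OF int, of "1 + \<bar>d\<bar> * \<bar>s\<bar> / \<delta>"]])
      (use led herm_dom_nonneg nn in \<open>auto simp: abs_mult\<close>)
qed

text \<open>The curve may approach 0 or 1 as time grows, so the margin comes from extreme values on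
  the compact interval [-T, T] and depends on T.\<close>

lemma curve_bounds:
  fixes \<eta> \<eta>' :: "real \<Rightarrow> real"
  assumes range: "\<And>s. 0 < \<eta> s \<and> \<eta> s < 1" and cont: "continuous_on UNIV \<eta>" "continuous_on UNIV \<eta>'"
  obtains \<delta> L where "0 < \<delta>" "\<And>s. \<bar>s\<bar> \<le> T \<Longrightarrow> 2 * \<delta> \<le> \<eta> s \<and> \<eta> s \<le> 1 - 2 * \<delta> \<and> \<bar>\<eta>' s\<bar> \<le> L"
proof (cases "0 \<le> T")
  case True
  have c: "compact {-T..T}" "{-T..T} \<noteq> {}" using True by auto
  have ct: "continuous_on {-T..T} \<eta>" "continuous_on {-T..T} (\<lambda>s. \<bar>\<eta>' s\<bar>)"
    using cont by (auto intro!: continuous_intros intro: continuous_on_subset)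
  obtain a where a: "\<And>s. s \<in> {-T..T} \<Longrightarrow> \<eta> a \<le> \<eta> s"
    using continuous_attains_inf[OF c ct(1)] by blast
  obtain b where b: "\<And>s. s \<in> {-T..T} \<Longrightarrow> \<eta> s \<le> \<eta> b"
    using continuous_attains_sup[OF c ct(1)] by blast
  obtain e where e: "\<And>s. s \<in> {-T..T} \<Longrightarrow> \<bar>\<eta>' s\<bar> \<le> \<bar>\<eta>' e\<bar>"
    using continuous_attains_sup[OF c ct(2)] by blast
  show thesis
  proof (rule that[of "min (\<eta> a) (1 - \<eta> b) / 2" "\<bar>\<eta>' e\<bar>"])
    show "0 < min (\<eta> a) (1 - \<eta> b) / 2" using range[of a] range[of b] by auto
    fix s assume "\<bar>s\<bar> \<le> T"
    then have "s \<in> {-T..T}" by auto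
    from a[OF this] b[OF this] e[OF this]
    show "2 * (min (\<eta> a) (1 - \<eta> b) / 2) \<le> \<eta> s \<and> \<eta> s \<le> 1 - 2 * (min (\<eta> a) (1 - \<eta> b) / 2) \<and> \<bar>\<eta>' s\<bar> \<le> \<bar>\<eta>' e\<bar>"
      by auto
  qed
next
  case False
  then show thesis using that[of 1 0] by auto
qed

lemma frac_ker_has_derivative:
  assumes "(\<eta> has_real_derivative d) (at s)"
  shows "((\<lambda>s. frac_ker k s (\<eta> s) y) has_real_derivative frac_ker_deriv k s (\<eta> s) d y) (at s)"
proof (cases "y = 0")
  case True then show ?thesis by (simp add: frac_ker_def[abs_def] frac_ker_deriv_def)
next
  case False
  then show ?thesis
    unfolding frac_ker_def[abs_def] frac_ker_deriv_def powr_def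
    by (auto intro!: derivative_eq_intros assms simp: field_simps)
qed

lemma frac_int_has_derivative:
  assumes range: "\<And>s. 0 < \<eta> s \<and> \<eta> s < 1"
    and der: "\<And>s. (\<eta> has_real_derivative \<eta>' s) (at s)" and cont: "continuous_on UNIV \<eta>'"
  shows "((\<lambda>s. frac_int k s (\<eta> s)) has_real_derivative frac_int_deriv k s0 (\<eta> s0) (\<eta>' s0)) (at s0)"
proof -
  have "continuous_on UNIV \<eta>" using der by (meson DERIV_isCont continuous_at_imp_continuous_on)
  \<comment> \<open>Derivatives at \<open>s0\<close> are taken within radius 1, so bounds up to time
    |s0| + 1 provide one dominating function for all nearby parameters.\<close>
  from curve_bounds[OF range this cont, where T = "\<bar>s0\<bar> + 1"] obtain \<delta> L where d: "0 < \<delta>"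
    "\<And>s. \<bar>s\<bar> \<le> \<bar>s0\<bar> + 1 \<Longrightarrow> 2 * \<delta> \<le> \<eta> s \<and> \<eta> s \<le> 1 - 2 * \<delta> \<and> \<bar>\<eta>' s\<bar> \<le> L" by blast
  show ?thesis unfolding frac_int_def frac_int_deriv_def has_real_derivative_iff_has_vector_derivative
  proof (rule has_vector_derivative_integral_dominated[where r = 1
        and f' = "\<lambda>s y. frac_ker_deriv k s (\<eta> s) (\<eta>' s) y"
        and D = "\<lambda>y. (1 + L * (\<bar>s0\<bar> + 1) / \<delta>) * herm_dom \<delta> k y"])
    fix s y assume "\<bar>s - s0\<bar> < 1"
    then have s: "\<bar>s\<bar> \<le> \<bar>s0\<bar> + 1" by linarith
    show "norm (frac_ker_deriv k s (\<eta> s) (\<eta>' s) y) \<le> (1 + L * (\<bar>s0\<bar> + 1) / \<delta>) * herm_dom \<delta> k y"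
      using d(2)[OF s] unfolding real_norm_def by (intro frac_ker_deriv_le d(1) s) auto
    show "((\<lambda>s. frac_ker k s (\<eta> s) y) has_vector_derivative frac_ker_deriv k s (\<eta> s) (\<eta>' s) y) (at s)"
      using frac_ker_has_derivative[OF der]
      by (simp add: has_real_derivative_iff_has_vector_derivative)
  qed (use range integrable_frac_ker integrable_herm_dom d(1) in auto)
qed

lemma frac_int_deriv_continuous:
  assumes range: "\<And>s. 0 < \<eta> s \<and> \<eta> s < 1"
    and cont: "continuous_on UNIV \<eta>" "continuous_on UNIV \<eta>'"
  shows "isCont (\<lambda>s. frac_int_deriv k s (\<eta> s) (\<eta>' s)) s0"
proof -
  from curve_bounds[OF range cont, where T = "\<bar>s0\<bar> + 1"] obtain \<delta> L where d: "0 < \<delta>"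
    "\<And>s. \<bar>s\<bar> \<le> \<bar>s0\<bar> + 1 \<Longrightarrow> 2 * \<delta> \<le> \<eta> s \<and> \<eta> s \<le> 1 - 2 * \<delta> \<and> \<bar>\<eta>' s\<bar> \<le> L" by blast
  have ic: "isCont \<eta> s0" "isCont \<eta>' s0" using cont by (auto simp: continuous_on_eq_continuous_at)
  show ?thesis unfolding frac_int_deriv_def
  proof (rule tendsto_integral_dominated[where r = 1 and D = "\<lambda>y. (1 + L * (\<bar>s0\<bar> + 1) / \<delta>) * herm_dom \<delta> k y"])
    fix s y assume "\<bar>s - s0\<bar> < 1"
    then have s: "\<bar>s\<bar> \<le> \<bar>s0\<bar> + 1" by linarith
    show "\<bar>frac_ker_deriv k s (\<eta> s) (\<eta>' s) y\<bar> \<le> (1 + L * (\<bar>s0\<bar> + 1) / \<delta>) * herm_dom \<delta> k y"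
      using d(2)[OF s] by (intro frac_ker_deriv_le d(1) s) auto
  next
    fix y show "isCont (\<lambda>s. frac_ker_deriv k s (\<eta> s) (\<eta>' s) y) s0"
    proof (cases "y = 0")
      case False
      then show ?thesis unfolding frac_ker_deriv_def frac_ker_def powr_def
        by (simp, intro continuous_intros ic) 
    qed (simp add: frac_ker_def frac_ker_deriv_def)
  qed (use integrable_herm_dom d(1) in auto)
qed

lemma frac_int_deriv_le:
  assumes "0 < \<delta>" "2 * \<delta> \<le> H" "H \<le> 1 - 2 * \<delta>" "\<bar>s\<bar> \<le> T" "\<bar>d\<bar> \<le> L"
  shows "\<bar>frac_int_deriv k s H d\<bar> \<le> (1 + L * T / \<delta>) * ((LINT y|lborel. sing_wt \<delta> y) + 5) * (real k + 1)\<^sup>2"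
proof -
  have nn: "0 \<le> T" "0 \<le> L" using assms by linarith+
  have "\<bar>frac_int_deriv k s H d\<bar> \<le> (LINT y|lborel. (1 + L * T / \<delta>) * herm_dom \<delta> k y)"
    unfolding frac_int_deriv_def
    by (intro integral_abs_bound[THEN order_trans] integral_mono integrable_abs integrable_frac_ker integrable_mult_right
        integrable_herm_dom frac_ker_deriv_le assms) (use assms in auto)
  also have "\<dots> = (1 + L * T / \<delta>) * (LINT y|lborel. herm_dom \<delta> k y)" by simp
  also have "\<dots> \<le> (1 + L * T / \<delta>) * (((LINT y|lborel. sing_wt \<delta> y) + 5) * (real k + 1)\<^sup>2)"
    using assms nn by (intro mult_left_mono integral_herm_dom_le) auto
  finally show ?thesis by (simp add: mult.assoc)
qed

lemma frac_int_le:
  assumes "0 < \<delta>" "2 * \<delta> \<le> H" "H \<le> 1 - 2 * \<delta>" "\<bar>s\<bar> \<le> T"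
  shows "\<bar>frac_int k s H\<bar> \<le> T * ((LINT y|lborel. sing_wt \<delta> y) + 5) * (real k + 1)\<^sup>2"
proof -
  have nn: "0 \<le> T" using assms by linarith+
  have "\<bar>frac_int k s H\<bar> \<le> (LINT y|lborel. T * herm_dom \<delta> k y)"
    unfolding frac_int_def
    by (intro integral_abs_bound[THEN order_trans] integral_mono integrable_abs integrable_frac_ker integrable_mult_right
        integrable_herm_dom frac_ker_le assms) (use assms in auto)
  also have "\<dots> = T * (LINT y|lborel. herm_dom \<delta> k y)" by simp
  also have "\<dots> \<le> T * (((LINT y|lborel. sing_wt \<delta> y) + 5) * (real k + 1)\<^sup>2)"
    using assms nn by (intro mult_left_mono integral_herm_dom_le) auto
  finally show ?thesis by (simp add: mult.assoc)
qed

text \<open>The kernel depends on k also through its phase, so Bessel's inequality does not apply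
  directly. The addition formula splits it into cosine and sine of the phase times two k-free
  profiles, built from sin and from 1 - cos; Bessel is applied to each.\<close>

lemma sum_frac_int_square_le:
  assumes "0 < \<delta>" "2 * \<delta> \<le> H" "H \<le> 1 - 2 * \<delta>" "\<bar>s\<bar> \<le> T"
  shows "(\<Sum>k<n. (frac_int k s H)\<^sup>2) \<le> 4 * (T\<^sup>2 + 4) * (LINT y|lborel. sing_wt \<delta> y)"
proof -
  define u where "u w y = w (s * y) / y * \<bar>y\<bar> powr (1/2 - H)" for w :: "real \<Rightarrow> real" and y :: real
  \<comment> \<open>The bound |w x| <= |x| serves |y| <= 1 and contributes T^2; the bound |w x| <= 2
    serves |y| > 1 and contributes 4.\<close>
  have key: "integrable lborel (\<lambda>y. (u w y)\<^sup>2)" "(\<Sum>k<n. (LINT y|lborel. u w y * hermite_fun k y)\<^sup>2) \<le> (T\<^sup>2 + 4) * (LINT y|lborel. sing_wt \<delta> y)"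
    if w: "\<And>x. \<bar>w x\<bar> \<le> \<bar>x\<bar>" "\<And>x. \<bar>w x\<bar> \<le> 2" and [measurable]: "w \<in> borel_measurable borel" for w
  proof -
    have [measurable]: "u w \<in> borel_measurable borel" unfolding u_def[abs_def] by measurable
    have le: "(u w y)\<^sup>2 \<le> (T\<^sup>2 + 4) * sing_wt \<delta> y" for y
    proof (cases "y = 0")
      case False
      have sq: "(\<bar>y\<bar> powr (1/2 - H))\<^sup>2 = \<bar>y\<bar> powr (1 - 2 * H)"
        by (simp add: power2_eq_square flip: powr_add)
      have usq: "(u w y)\<^sup>2 = (w (s * y) / y)\<^sup>2 * \<bar>y\<bar> powr (1 - 2 * H)"
        by (simp only: u_def power_mult_distrib sq)
      show ?thesis
      proof (cases "\<bar>y\<bar> \<le> 1")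
        case True
        have "\<bar>w (s * y) / y\<bar> \<le> T"
          using w(1)[of "s * y"] False assms(4) by (simp add: abs_mult divide_le_eq) (smt (verit) mult_right_mono)
        then have "(w (s * y) / y)\<^sup>2 \<le> T\<^sup>2" by (simp add: abs_le_square_iff[symmetric] power2_le_iff_abs_le)
        moreover have "\<bar>y\<bar> powr (1 - 2 * H) \<le> \<bar>y\<bar> powr (2 * \<delta> - 1)"
          using False True assms by (intro powr_mono') auto
        ultimately have "(w (s * y) / y)\<^sup>2 * \<bar>y\<bar> powr (1 - 2 * H) \<le> (T\<^sup>2 + 4) * \<bar>y\<bar> powr (2 * \<delta> - 1)"
          by (intro mult_mono) auto
        then show ?thesis using True by (simp only: usq sing_wt_def if_True)
      next
        case F: False
        have "(w (s * y))\<^sup>2 \<le> 2\<^sup>2"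
          using w(2)[of "s * y"] abs_le_square_iff[of "w (s * y)" 2] by simp
        then have "(w (s * y))\<^sup>2 \<le> T\<^sup>2 + 4" by (simp add: add_increasing)
        moreover have "\<bar>y\<bar> powr (-1 - 2 * H) \<le> \<bar>y\<bar> powr (- 1 - 2 * \<delta>)"
          using F assms by (intro powr_mono) auto
        ultimately have "(w (s * y))\<^sup>2 * \<bar>y\<bar> powr (- 1 - 2 * H) \<le> (T\<^sup>2 + 4) * \<bar>y\<bar> powr (- 1 - 2 * \<delta>)"
          by (intro mult_mono) auto
        moreover have "\<bar>y\<bar> powr (1 - 2 * H) / y\<^sup>2 = \<bar>y\<bar> powr (- 1 - 2 * H)"
        proof -
          have "y\<^sup>2 = \<bar>y\<bar> powr 2" using False by (simp add: powr_numeral)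
          then show ?thesis unfolding powr_diff[symmetric] by (simp only: powr_diff[symmetric]) simp
        qed
        moreover have "(w (s * y) / y)\<^sup>2 * p = (w (s * y))\<^sup>2 * (p / y\<^sup>2)" for p
          by (simp add: power_divide)
        ultimately show ?thesis using F by (simp only: usq sing_wt_def if_False)
      qed
    qed (simp add: u_def sing_wt_def)
    show i: "integrable lborel (\<lambda>y. (u w y)\<^sup>2)"
      by (rule Bochner_Integration.integrable_bound[OF integrable_mult_right[OF integrable_sing_wt[OF assms(1)], of "T\<^sup>2 + 4"]])
        (use le sing_wt_nonneg in auto)
    have "(\<Sum>k<n. (LINT y|lborel. u w y * hermite_fun k y)\<^sup>2) \<le> (LINT y|lborel. (u w y)\<^sup>2)"
      by (rule bessel_inequality) (use i integrable_herm_mom[of 0] hermite_fun_orthonormal in auto)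
    also have "\<dots> \<le> (LINT y|lborel. (T\<^sup>2 + 4) * sing_wt \<delta> y)"
      by (intro integral_mono i integrable_mult_right integrable_sing_wt assms le)
    finally show "(\<Sum>k<n. (LINT y|lborel. u w y * hermite_fun k y)\<^sup>2) \<le> (T\<^sup>2 + 4) * (LINT y|lborel. sing_wt \<delta> y)"
      by simp
  qed
  let ?c = "\<lambda>x::real. 1 - cos x"
  have c: "\<bar>?c x\<bar> \<le> \<bar>x\<bar>" "\<bar>?c x\<bar> \<le> 2" for x
  proof -
    have "\<bar>?c x\<bar> = 2 * (\<bar>sin (x/2)\<bar> * \<bar>sin (x/2)\<bar>)"
      using cos_double_sin[of "x/2"] by (simp add: power2_eq_square)
    also have "\<dots> \<le> 2 * (\<bar>x / 2\<bar> * 1)"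
      by (intro mult_left_mono mult_mono abs_sin_x_le_abs_x) auto
    finally show "\<bar>?c x\<bar> \<le> \<bar>x\<bar>" by simp
    show "\<bar>?c x\<bar> \<le> 2" using cos_ge_minus_one[of x] cos_le_one[of x] by linarith
  qed
  have sn: "\<bar>sin x\<bar> \<le> \<bar>x\<bar>" "\<bar>sin x\<bar> \<le> 2" for x :: real
    using abs_sin_x_le_abs_x[of x] abs_sin_le_one[of x] by linarith+
  have ck: "integrable lborel (\<lambda>y. u sin y * hermite_fun k y)" "integrable lborel (\<lambda>y. u ?c y * hermite_fun k y)" for k
  proof -
    have [measurable]: "u sin \<in> borel_measurable borel" "u ?c \<in> borel_measurable borel"
      unfolding u_def[abs_def] by measurable
    have "integrable lborel (\<lambda>y. (u sin y)\<^sup>2)" "integrable lborel (\<lambda>y. (u ?c y)\<^sup>2)"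
      using key(1)[of sin, OF sn] key(1)[of ?c, OF c] by auto
    then show "integrable lborel (\<lambda>y. u sin y * hermite_fun k y)" "integrable lborel (\<lambda>y. u ?c y * hermite_fun k y)"
      using integrable_herm_mom[of 0 k] by (auto intro!: integrable_mult_of_squares)
  qed
  have alg: "(a * ct - b * st + st) / y * (p * e) = ct * (a / y * p * e) + st * ((1 - b) / y * p * e)"
    for a b ct st y p e :: real
    by (simp add: divide_inverse algebra_simps)
  have "frac_ker k s H = (\<lambda>y. cos (herm_phase k) * (u sin y * hermite_fun k y)
      + sin (herm_phase k) * (u ?c y * hermite_fun k y))" for k
    unfolding frac_ker_def[abs_def] u_def sin_diff alg ..
  then have fi: "frac_int k s H = cos (herm_phase k) * (LINT y|lborel. u sin y * hermite_fun k y)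
     + sin (herm_phase k) * (LINT y|lborel. u ?c y * hermite_fun k y)" for k
    using ck[of k] by (simp add: frac_int_def)
  \<comment> \<open>Cosine and sine of the phase are at most 1 in absolute value, so the dependence
    on k outside the two Bessel coefficients disappears.\<close>
  have "(frac_int k s H)\<^sup>2 \<le> 2 * (LINT y|lborel. u sin y * hermite_fun k y)\<^sup>2
     + 2 * (LINT y|lborel. u ?c y * hermite_fun k y)\<^sup>2" for k
  proof -
    have "(p * a + q * b)\<^sup>2 \<le> 2 * a\<^sup>2 + 2 * b\<^sup>2" if "\<bar>p\<bar> \<le> 1" "\<bar>q\<bar> \<le> 1" for a b p q :: real
    proof -
      have "(p * a + q * b)\<^sup>2 \<le> 2 * (p * a)\<^sup>2 + 2 * (q * b)\<^sup>2"
        using sum_squares_bound[of "p * a" "q * b"] by (simp add: power2_sum)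
      also have "\<dots> \<le> 2 * (1 * a\<^sup>2) + 2 * (1 * b\<^sup>2)"
        unfolding power_mult_distrib using that by (intro add_mono mult_left_mono mult_right_mono) (auto simp: abs_square_le_1)
      finally show ?thesis by simp
    qed
    then show ?thesis unfolding fi by simp
  qed
  then have "(\<Sum>k<n. (frac_int k s H)\<^sup>2) \<le> (\<Sum>k<n. 2 * (LINT y|lborel. u sin y * hermite_fun k y)\<^sup>2
     + 2 * (LINT y|lborel. u ?c y * hermite_fun k y)\<^sup>2)"
    by (intro sum_mono)
  also have "\<dots> = 2 * (\<Sum>k<n. (LINT y|lborel. u sin y * hermite_fun k y)\<^sup>2)
     + 2 * (\<Sum>k<n. (LINT y|lborel. u ?c y * hermite_fun k y)\<^sup>2)"
    by (simp add: sum.distrib sum_distrib_left)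
  also have "\<dots> \<le> 2 * ((T\<^sup>2 + 4) * (LINT y|lborel. sing_wt \<delta> y)) + 2 * ((T\<^sup>2 + 4) * (LINT y|lborel. sing_wt \<delta> y))"
    using key(2)[of sin, OF sn] key(2)[of ?c, OF c] by (intro add_mono mult_left_mono) auto
  finally show ?thesis by (simp add: algebra_simps)
qed

section \<open>The normalising constant as a continuously differentiable function of H\<close>

lemma frac_scale_pos_arg:
  assumes "0 < H" "H < 1"
  shows "0 < Gamma (2 * H + 1) * sin (pi * H)" "2 * H + 1 \<notin> \<int>\<^sub>\<le>\<^sub>0"
proof -
  have "0 < pi * H" "pi * H < pi" using assms by auto
  then have "0 < sin (pi * H)" by (rule sin_gt_zero)
  moreover have "0 < Gamma (2 * H + 1)" using assms by (intro Gamma_real_pos) auto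
  ultimately show "0 < Gamma (2 * H + 1) * sin (pi * H)" by simp
  show "2 * H + 1 \<notin> \<int>\<^sub>\<le>\<^sub>0" using assms by (auto elim!: nonpos_Ints_cases)
qed

lemma frac_scale_eq:
  assumes "0 < H" "H < 1" shows "frac_scale H = sqrt (Gamma (2 * H + 1) * sin (pi * H))"
  using frac_scale_pos_arg(1)[OF assms] by (simp add: frac_scale_def c_const_def real_sqrt_divide)

definition frac_scale' :: "real \<Rightarrow> real" where
  "frac_scale' H = (2 * (Gamma (2 * H + 1) * Digamma (2 * H + 1)) * sin (pi * H) + Gamma (2 * H + 1) * (pi * cos (pi * H)))
     / (2 * sqrt (Gamma (2 * H + 1) * sin (pi * H)))"

lemma frac_scale_has_derivative:
  assumes "0 < H" "H < 1" shows "(frac_scale has_real_derivative frac_scale' H) (at H)"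
proof -
  have "((\<lambda>H. Gamma (2 * H + 1) * sin (pi * H)) has_real_derivative
      2 * (Gamma (2 * H + 1) * Digamma (2 * H + 1)) * sin (pi * H) + Gamma (2 * H + 1) * (pi * cos (pi * H))) (at H)"
    by (rule derivative_eq_intros frac_scale_pos_arg[OF assms] refl | simp)+
  from DERIV_chain2[OF DERIV_real_sqrt[OF frac_scale_pos_arg(1)[OF assms]] this]
  have "((\<lambda>H. sqrt (Gamma (2 * H + 1) * sin (pi * H))) has_real_derivative frac_scale' H) (at H)"
    unfolding frac_scale'_def by (simp add: field_simps)
  \<comment> \<open>The closed form \<open>frac_scale_eq\<close> is available on (0,1), so the
    derivative is transferred within that open interval.\<close>
  then show ?thesis
    by (rule has_field_derivative_transform_within_open[where S = "{0<..<1}"])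
      (use assms frac_scale_eq in auto)
qed

lemma continuous_frac_scale: "continuous_on {0<..<1} frac_scale"
  by (intro continuous_at_imp_continuous_on ballI)
    (meson DERIV_isCont frac_scale_has_derivative greaterThanLessThan_iff)

lemma continuous_frac_scale': "continuous_on {0<..<1} frac_scale'"
proof -
  have n: "isCont (\<lambda>x::real. 2 * x + 1) H" for H by (intro continuous_intros)
  have "isCont frac_scale' H" if "H \<in> {0<..<1}" for H
    unfolding frac_scale'_def[abs_def]
    using frac_scale_pos_arg[of H] that
    by (intro continuous_intros isCont_Gamma isCont_Polygamma) auto
  then show ?thesis by (rule continuous_at_imp_continuous_on[OF ballI])
qed

section \<open>The operator M_H on Hermite functions\<close>

lemma exp_iexpn_phase: "exp (\<i> * complex_of_real a) * (- \<i>) ^ k = cis (a - herm_phase k)"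
proof -
  have *: "- \<i> = cis (- (pi / 2))" by (simp add: complex_eq_iff)
  have "(- \<i>) ^ k = cis (- herm_phase k)"
    unfolding * Complex.DeMoivre by (simp add: herm_phase_def)
  then show ?thesis by (simp add: cis_conv_exp[symmetric] cis_mult)
qed

text \<open>Once the transform is replaced by its eigenvalue times e_k, the integrand is a real
  function times \<open>cis\<close> of xy - k pi/2, and the real part leaves the cosine. Speed 0 in
  \<open>frac_int_deriv\<close> removes the logarithmic term, since H is fixed.\<close>

lemma M_op_hermite_fun:
  assumes "0 < H" "H < 1"
  shows "M_op H (hermite_fun k) x = frac_scale H / sqrt (2 * pi) * frac_int_deriv k x H 0"
proof -
  let ?v = "\<lambda>y. \<bar>y\<bar> powr (1/2 - H) * hermite_fun k y"
  let ?c = "\<lambda>y. complex_of_real (?v y) * cis (x * y - herm_phase k)"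
  have int: "integrable lborel ?c"
  proof (rule Bochner_Integration.integrable_bound[OF integrable_frac_ker(2)[OF assms, of k]])
    show "?c \<in> borel_measurable lborel"
      unfolding cis_conv_exp by measurable
  qed (auto simp: norm_mult)
  have eq: "exp (\<i> * complex_of_real (x * y)) * complex_of_real (sqrt (2 * pi) / c_const H * \<bar>y\<bar> powr (1/2 - H)) * fourier (hermite_fun k) y
     = complex_of_real (frac_scale H * sqrt (2 * pi)) * ?c y" for y
    unfolding exp_iexpn_phase[symmetric] fourier_hermite_fun frac_scale_def[symmetric]
    by (simp add: mult_ac)
  have "M_op H (hermite_fun k) x = Re (1 / (2 * complex_of_real pi) * (complex_of_real (frac_scale H * sqrt (2 * pi)) * (LINT y|lborel. ?c y)))"
    unfolding M_op_def eq by simp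
  also have "\<dots> = frac_scale H * sqrt (2 * pi) / (2 * pi) * Re (LINT y|lborel. ?c y)"
  proof -
    have "1 / (2 * complex_of_real pi) * (complex_of_real (frac_scale H * sqrt (2 * pi)) * z)
      = complex_of_real (frac_scale H * sqrt (2 * pi) / (2 * pi)) * z" for z
      by simp
    moreover have "Re (complex_of_real r * z) = r * Re z" for r z by simp
    ultimately show ?thesis by (simp only:)
  qed
  also have "Re (LINT y|lborel. ?c y) = (LINT y|lborel. Re (?c y))"
    using int by (rule integral_Re[symmetric])
  also have "(LINT y|lborel. Re (?c y)) = frac_int_deriv k x H 0"
    by (simp add: frac_int_deriv_def frac_ker_deriv_def mult_ac)
  also have "frac_scale H * sqrt (2 * pi) / (2 * pi) = frac_scale H / sqrt (2 * pi)"
  proof -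
    have "a / (a * a) = 1 / a" for a :: real by simp
    from this[of "sqrt (2 * pi)"] show ?thesis by (simp add: divide_simps)
  qed
  finally show ?thesis .
qed

text \<open>Fundamental theorem of calculus along the constant curve H. The summand sin(k pi/2) in
  the kernel is the integration constant that makes \<open>frac_int\<close> vanish at time
  0.\<close>

lemma g_fun_hermite_fun:
  assumes "0 < H" "H < 1"
  shows "g_fun (hermite_fun k) t H = frac_scale H / sqrt (2 * pi) * frac_int k t H"
proof -
  have F: "((\<lambda>s. frac_int k s H) has_vector_derivative frac_int_deriv k x H 0) (at x within S)" for x S
    using frac_int_has_derivative[of "\<lambda>_. H" "\<lambda>_. 0" k x] assms
    by (simp add: has_real_derivative_iff_has_vector_derivative has_vector_derivative_at_within)
  have c: "continuous_on S (\<lambda>s. frac_int_deriv k s H 0)" for S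
    using frac_int_deriv_continuous[where \<eta> = "\<lambda>_. H" and \<eta>' = "\<lambda>_. 0"] assms
    by (intro continuous_at_imp_continuous_on) auto
  have "frac_int k 0 H = 0" by (simp add: frac_int_def frac_ker_def)
  then have "(LBINT x=ereal 0..ereal t. frac_int_deriv k x H 0) = frac_int k t H"
    by (subst interval_integral_FTC_finite[OF c F]) simp
  then show ?thesis
    unfolding g_fun_def M_op_hermite_fun[OF assms] by simp
qed

section \<open>Noise coefficients along the curve of Hurst parameters\<close>

definition mf_coeff :: "(real \<Rightarrow> real) \<Rightarrow> nat \<Rightarrow> real \<Rightarrow> real" where
  "mf_coeff h k s = deriv (\<lambda>u. g_fun (hermite_fun k) u (h u)) s"

context
  fixes h h' :: "real \<Rightarrow> real"
  assumes range: "\<And>t. 0 < h t \<and> h t < 1"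
    and der: "\<And>s. (h has_real_derivative h' s) (at s)" and cont': "continuous_on UNIV h'"
begin

lemma cont_curve: "continuous_on UNIV h"
  using der by (meson DERIV_isCont continuous_at_imp_continuous_on)

lemma g_fun_curve_has_derivative_aux:
  "((\<lambda>u. g_fun (hermite_fun k) u (h u)) has_real_derivative
     (frac_scale' (h s) * h' s * frac_int k s (h s) + frac_scale (h s) * frac_int_deriv k s (h s) (h' s)) / sqrt (2 * pi)) (at s)"
proof -
  have "(\<lambda>u. g_fun (hermite_fun k) u (h u)) = (\<lambda>u. frac_scale (h u) * frac_int k u (h u) / sqrt (2 * pi))"
    using range by (simp add: g_fun_hermite_fun fun_eq_iff)
  moreover have "((\<lambda>u. frac_scale (h u)) has_real_derivative frac_scale' (h s) * h' s) (at s)"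
    using range[of s] by (intro DERIV_chain2[OF frac_scale_has_derivative der]) auto
  moreover note DERIV_cdivide[OF DERIV_mult[OF this frac_int_has_derivative[OF range der cont', of k s]], of "sqrt (2 * pi)"]
  ultimately show ?thesis by (simp add: mult_ac add.commute)
qed

lemma mf_coeff_eq: "mf_coeff h k s =
   (frac_scale' (h s) * h' s * frac_int k s (h s) + frac_scale (h s) * frac_int_deriv k s (h s) (h' s)) / sqrt (2 * pi)"
  unfolding mf_coeff_def by (rule DERIV_imp_deriv[OF g_fun_curve_has_derivative_aux])

lemma g_fun_curve_has_derivative:
  "((\<lambda>u. g_fun (hermite_fun k) u (h u)) has_real_derivative mf_coeff h k s) (at s)"
  using g_fun_curve_has_derivative_aux by (simp add: mf_coeff_eq)

lemma continuous_mf_coeff: "continuous_on UNIV (mf_coeff h k)"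
proof -
  have 1: "continuous_on UNIV (\<lambda>s. frac_scale' (h s))"
    by (rule continuous_on_compose2[OF continuous_frac_scale' cont_curve]) (use range in auto)
  have 2: "continuous_on UNIV (\<lambda>s. frac_scale (h s))"
    by (rule continuous_on_compose2[OF continuous_frac_scale cont_curve]) (use range in auto)
  have 3: "continuous_on UNIV (\<lambda>s. frac_int k s (h s))"
    using frac_int_has_derivative[OF range der cont'] by (meson DERIV_isCont continuous_at_imp_continuous_on)
  have 4: "continuous_on UNIV (\<lambda>s. frac_int_deriv k s (h s) (h' s))"
    using frac_int_deriv_continuous[OF range cont_curve cont'] by (intro continuous_at_imp_continuous_on) auto
  show ?thesis unfolding mf_coeff_eq[abs_def]
    by (intro continuous_intros 1 2 3 4 cont') auto
qed

lemma frac_scale_bounds: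
  obtains A B where "\<And>s. \<bar>s\<bar> \<le> T \<Longrightarrow> \<bar>frac_scale (h s)\<bar> \<le> A \<and> \<bar>frac_scale' (h s)\<bar> \<le> B"
proof -
  have 1: "continuous_on UNIV (\<lambda>s. frac_scale' (h s))"
    by (rule continuous_on_compose2[OF continuous_frac_scale' cont_curve]) (use range in auto)
  have 2: "continuous_on UNIV (\<lambda>s. frac_scale (h s))"
    by (rule continuous_on_compose2[OF continuous_frac_scale cont_curve]) (use range in auto)
  have "bounded ((\<lambda>s. frac_scale' (h s)) ` {-T..T})" "bounded ((\<lambda>s. frac_scale (h s)) ` {-T..T})"
    using 1 2 by (auto intro!: compact_imp_bounded compact_continuous_image intro: continuous_on_subset)
  then obtain A B where "\<forall>x\<in>(\<lambda>s. frac_scale (h s)) ` {-T..T}. norm x \<le> A"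
    "\<forall>x\<in>(\<lambda>s. frac_scale' (h s)) ` {-T..T}. norm x \<le> B"
    unfolding bounded_iff by blast
  then show thesis by (intro that[of A B]) (auto simp: abs_le_iff)
qed

lemma mf_coeff_bound:
  obtains C where "0 \<le> C" "\<And>k s. \<bar>s\<bar> \<le> T \<Longrightarrow> \<bar>mf_coeff h k s\<bar> \<le> C * (real k + 1)\<^sup>2"
proof (cases "0 \<le> T")
  case True
  obtain A B where AB: "\<And>s. \<bar>s\<bar> \<le> T \<Longrightarrow> \<bar>frac_scale (h s)\<bar> \<le> A \<and> \<bar>frac_scale' (h s)\<bar> \<le> B"
    using frac_scale_bounds[of T] by blast
  obtain \<delta> L where d: "0 < \<delta>"
    "\<And>s. \<bar>s\<bar> \<le> T \<Longrightarrow> 2 * \<delta> \<le> h s \<and> h s \<le> 1 - 2 * \<delta> \<and> \<bar>h' s\<bar> \<le> L"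
    using curve_bounds[OF range cont_curve cont'] by blast
  have nn: "0 \<le> A" "0 \<le> B" "0 \<le> L" using AB[of 0] d(2)[of 0] True by auto
  define K where "K = (LINT y|lborel. sing_wt \<delta> y) + 5"
  have K: "0 \<le> K" unfolding K_def by (intro add_nonneg_nonneg integral_nonneg_AE) (auto simp: sing_wt_nonneg)
  \<comment> \<open>One summand for each of the two terms of the product rule in
    \<open>mf_coeff_eq\<close>.\<close>
  define C where "C = B * L * (T * K) + A * ((1 + L * T / \<delta>) * K)"
  have C: "0 \<le> C" unfolding C_def using nn K d(1) True by auto
  have "\<bar>mf_coeff h k s\<bar> \<le> C * (real k + 1)\<^sup>2" if s: "\<bar>s\<bar> \<le> T" for k s
  proof -
    note ds = d(2)[OF s]
    have "\<bar>frac_scale' (h s) * h' s * frac_int k s (h s) + frac_scale (h s) * frac_int_deriv k s (h s) (h' s)\<bar>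
      \<le> \<bar>frac_scale' (h s)\<bar> * \<bar>h' s\<bar> * \<bar>frac_int k s (h s)\<bar> + \<bar>frac_scale (h s)\<bar> * \<bar>frac_int_deriv k s (h s) (h' s)\<bar>"
      by (simp only: abs_mult[symmetric] abs_triangle_ineq)
    also have "\<dots> \<le> B * L * (T * K * (real k + 1)\<^sup>2) + A * ((1 + L * T / \<delta>) * K * (real k + 1)\<^sup>2)"
      using AB[OF s] ds nn d(1) True K unfolding K_def
      by (intro add_mono mult_mono frac_int_le frac_int_deriv_le s) auto
    also have "\<dots> = C * (real k + 1)\<^sup>2" by (simp add: C_def algebra_simps)
    finally have *: "\<bar>frac_scale' (h s) * h' s * frac_int k s (h s) + frac_scale (h s) * frac_int_deriv k s (h s) (h' s)\<bar> \<le> C * (real k + 1)\<^sup>2" .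
    \<comment> \<open>Dividing by a number of size at least 1 does not increase the absolute value,
      so the bound on the numerator is kept.\<close>
    have "1 \<le> sqrt (2 * pi)" using pi_ge_two by simp
    then have "\<bar>mf_coeff h k s\<bar> \<le> \<bar>frac_scale' (h s) * h' s * frac_int k s (h s) + frac_scale (h s) * frac_int_deriv k s (h s) (h' s)\<bar>"
      unfolding mf_coeff_eq abs_divide by (simp add: divide_le_eq mult_right_le_one_le mult_le_cancel_left1)
    with * show ?thesis by linarith
  qed
  with C show thesis by (rule that)
next
  case False
  then show thesis by (intro that[of 0]) auto
qed

text \<open>The full series is the variance of B^(h)(s), the squared norm of M_{h(s)} applied to the
  indicator of [0,s]. The bound keeps it under control uniformly on compact time sets.\<close>

lemma sum_g_fun_curve_square_bound:
  obtains B where "0 \<le> B" "\<And>n s. \<bar>s\<bar> \<le> T \<Longrightarrow> (\<Sum>k<n. (g_fun (hermite_fun k) s (h s))\<^sup>2) \<le> B"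
proof (cases "0 \<le> T")
  case True
  obtain A B where AB: "\<And>s. \<bar>s\<bar> \<le> T \<Longrightarrow> \<bar>frac_scale (h s)\<bar> \<le> A \<and> \<bar>frac_scale' (h s)\<bar> \<le> B"
    using frac_scale_bounds[of T] by blast
  obtain \<delta> L where d: "0 < \<delta>"
    "\<And>s. \<bar>s\<bar> \<le> T \<Longrightarrow> 2 * \<delta> \<le> h s \<and> h s \<le> 1 - 2 * \<delta> \<and> \<bar>h' s\<bar> \<le> L"
    using curve_bounds[OF range cont_curve cont'] by blast
  define K where "K = 4 * (T\<^sup>2 + 4) * (LINT y|lborel. sing_wt \<delta> y)"
  have K: "0 \<le> K" unfolding K_def by (intro mult_nonneg_nonneg integral_nonneg_AE) (auto simp: sing_wt_nonneg)
  have "(\<Sum>k<n. (g_fun (hermite_fun k) s (h s))\<^sup>2) \<le> A\<^sup>2 / (2 * pi) * K" if s: "\<bar>s\<bar> \<le> T" for n s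
  proof -
    have "(\<Sum>k<n. (g_fun (hermite_fun k) s (h s))\<^sup>2) = (frac_scale (h s))\<^sup>2 / (2 * pi) * (\<Sum>k<n. (frac_int k s (h s))\<^sup>2)"
      using range by (simp add: g_fun_hermite_fun power_mult_distrib power_divide sum_distrib_left)
    also have "\<dots> \<le> A\<^sup>2 / (2 * pi) * K"
      using AB[OF s] d(2)[OF s] K unfolding K_def
      by (intro mult_mono divide_right_mono sum_frac_int_square_le s d(1) sum_nonneg)
        (auto simp: abs_le_square_iff[symmetric])
    finally show ?thesis .
  qed
  moreover have "0 \<le> A\<^sup>2 / (2 * pi) * K" using K by simp
  ultimately show thesis using that by blast
next
  case False
  then show thesis by (intro that[of 0]) auto
qed

end

section \<open>Hida distributions of the first chaos\<close>

lemma unit_index_inject: "unit_index j = unit_index k \<longleftrightarrow> j = k"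
  by (auto simp: unit_index_def fun_eq_iff split: if_splits)

lemma inj_unit_index: "inj unit_index"
  by (simp add: inj_def unit_index_inject)

lemma unit_index_support: "{j. unit_index k j \<noteq> 0} = {k}"
  by (auto simp: unit_index_def)

lemma unit_index_in_MI: "unit_index k \<in> MI"
  by (simp add: MI_def unit_index_support[unfolded neq0_conv] unit_index_support)

lemma mfact_unit_index: "mfact (unit_index k) = 1"
  unfolding mfact_def unit_index_support by (simp add: unit_index_def)

lemma twoN_unit_index: "twoN (unit_index k) = 2 * real k + 2"
  unfolding twoN_def unit_index_support by (simp add: unit_index_def)

lemma mfact_pos: "0 < mfact \<alpha>"
  unfolding mfact_def by (intro prod_pos) auto

lemma first_chaos_unit_index: "first_chaos a (unit_index k) = a k"
  unfolding first_chaos_def by (auto simp: unit_index_inject)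

lemma first_chaos_eq_0: "\<alpha> \<notin> range unit_index \<Longrightarrow> first_chaos a \<alpha> = 0"
  unfolding first_chaos_def by auto

lemma first_chaos_eqI:
  assumes "\<And>k. c (unit_index k) = a k" "\<And>\<alpha>. \<alpha> \<notin> range unit_index \<Longrightarrow> c \<alpha> = 0"
  shows "c = first_chaos a"
proof
  fix \<alpha> show "c \<alpha> = first_chaos a \<alpha>"
    using assms first_chaos_eq_0[of \<alpha> a] by (cases "\<alpha> \<in> range unit_index") (auto simp: first_chaos_unit_index)
qed

lemma not_MI_not_unit: "\<alpha> \<notin> MI \<Longrightarrow> \<alpha> \<notin> range unit_index"
  using unit_index_in_MI by auto

text \<open>Only the zero multi-index contributes to the Wick sum. Finiteness of the set of
  multi-indices below \<gamma> has to be checked, because a sum over an infinite set is 0 by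
  convention.\<close>

lemma wick_const_first_chaos: "hida_const r \<diamond> first_chaos b = first_chaos (\<lambda>k. r * b k)"
proof -
  have *: "(hida_const r \<diamond> c) \<gamma> = (if \<gamma> \<in> MI then r * c \<gamma> else 0)" for c \<gamma>
  proof (cases "\<gamma> \<in> MI")
    case True
    let ?A = "{\<alpha>. \<forall>k. \<alpha> k \<le> \<gamma> k}"
    define S where "S = {k. \<gamma> k \<noteq> 0}"
    have finS: "finite S" using True by (simp add: MI_def S_def)
    have "?A \<subseteq> {\<alpha>. \<forall>k. (k \<in> S \<longrightarrow> \<alpha> k \<in> {..Max (\<gamma> ` S)}) \<and> (k \<notin> S \<longrightarrow> \<alpha> k = 0)}"
    proof safe
      fix \<alpha> k assume "\<forall>k. \<alpha> k \<le> \<gamma> k"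
      then have le: "\<alpha> k \<le> \<gamma> k" by blast
      show "\<alpha> k \<le> Max (\<gamma> ` S)" if "k \<in> S"
        by (rule order_trans[OF le]) (use finS that in auto)
      show "\<alpha> k = 0" if "k \<notin> S" using le that by (simp add: S_def)
    qed
    then have fin: "finite ?A"
      by (rule finite_subset) (intro finite_set_of_finite_funs finS finite_atMost)
    have "(hida_const r \<diamond> c) \<gamma> = (\<Sum>\<alpha>\<in>?A. if \<alpha> = (\<lambda>_. 0) then r * c \<gamma> else 0)"
      using True unfolding wick_def by (auto simp: hida_const_def intro!: sum.cong)
    also have "\<dots> = r * c \<gamma>"
      using fin by (simp add: sum.delta)
    finally show ?thesis using True by simp
  qed (simp add: wick_def)
  show ?thesis
    by (rule first_chaos_eqI) (auto simp: * first_chaos_unit_index unit_index_in_MI first_chaos_eq_0)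
qed

lemma summable_on_MI_first:
  assumes "\<And>\<alpha>. \<alpha> \<notin> range unit_index \<Longrightarrow> F \<alpha> = 0"
  shows "F summable_on MI \<longleftrightarrow> (\<lambda>k. F (unit_index k)) summable_on (UNIV :: nat set)"
proof -
  have "F summable_on MI \<longleftrightarrow> F summable_on range unit_index"
    using assms unit_index_in_MI by (intro summable_on_cong_neutral) auto
  then show ?thesis using summable_on_reindex[OF inj_unit_index, of F] by (simp add: o_def)
qed

lemma infsum_MI_first:
  assumes "\<And>\<alpha>. \<alpha> \<notin> range unit_index \<Longrightarrow> F \<alpha> = 0"
  shows "infsum F MI = infsum (\<lambda>k. F (unit_index k)) (UNIV :: nat set)"
proof -
  have "infsum F MI = infsum F (range unit_index)"
    using assms unit_index_in_MI by (intro infsum_cong_neutral) auto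
  then show ?thesis using infsum_reindex[OF inj_unit_index, of F] by (simp add: o_def)
qed

lemma summable_inverse_Suc_squares: "summable (\<lambda>k. 1 / (real k + 1)\<^sup>2)"
proof -
  have "summable (\<lambda>k. inverse ((real (Suc k))\<^sup>2))"
    using inverse_power_summable[of 2, where 'a = real] summable_ignore_initial_segment[of "\<lambda>k. inverse ((real k)\<^sup>2)" 1]
    by simp
  then show ?thesis by (simp add: inverse_eq_divide add.commute)
qed

text \<open>The squares grow like (k+1)^4; with p = 3 the weight decays like (k+1)^-6, which leaves
  the summable (k+1)^-2.\<close>

lemma hida_dist_first_chaos:
  assumes a: "\<And>k. \<bar>a k\<bar> \<le> C * (real k + 1)\<^sup>2"
  shows "hida_dist (first_chaos a)"
  unfolding hida_dist_def
proof (intro conjI allI impI exI[of _ 3])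
  fix \<alpha> :: multi_index assume "\<alpha> \<notin> MI"
  then show "first_chaos a \<alpha> = 0" by (intro first_chaos_eq_0 not_MI_not_unit)
next
  let ?F = "\<lambda>\<alpha>. mfact \<alpha> * (first_chaos a \<alpha>)\<^sup>2 * twoN \<alpha> powr (- 2 * real 3)"
  have le: "?F (unit_index k) \<le> C\<^sup>2 * (1 / (real k + 1)\<^sup>2)" for k
  proof -
    have p: "(2 * real k + 2) powr - 6 = 1 / (2 * real k + 2) ^ 6"
      by (simp add: powr_minus powr_numeral inverse_eq_divide)
    have "(a k)\<^sup>2 \<le> (C * (real k + 1)\<^sup>2)\<^sup>2"
      using power_mono[OF a[of k] abs_ge_zero, of 2] by simp
    moreover have "1 / (2 * real k + 2) ^ 6 \<le> 1 / (real k + 1) ^ 6"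
      by (intro divide_left_mono power_mono) auto
    ultimately have "(a k)\<^sup>2 * (1 / (2 * real k + 2) ^ 6) \<le> (C * (real k + 1)\<^sup>2)\<^sup>2 * (1 / (real k + 1) ^ 6)"
      by (rule mult_mono) auto
    also have "\<dots> = C\<^sup>2 * (1 / (real k + 1)\<^sup>2)"
      by (simp add: power_mult_distrib divide_simps flip: power_mult power_add)
    finally show ?thesis by (simp add: mfact_unit_index twoN_unit_index first_chaos_unit_index p)
  qed
  have "summable (\<lambda>k. ?F (unit_index k))"
    by (rule summable_comparison_test_ev[OF _ summable_mult[OF summable_inverse_Suc_squares, of "C\<^sup>2"]])
      (use le in \<open>auto intro!: always_eventually simp: abs_mult mfact_unit_index\<close>)
  then have "(\<lambda>k. ?F (unit_index k)) summable_on UNIV"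
    by (subst summable_on_UNIV_nonneg_real_iff) (auto intro!: mult_nonneg_nonneg less_imp_le[OF mfact_pos])
  then show "?F summable_on MI"
    by (subst summable_on_MI_first) (auto simp: first_chaos_eq_0)
qed

text \<open>A single term of the series with p = 4 is bounded by the whole sum, and its root gives
  decay of order 4: two orders to beat the quadratic growth of the noise coefficients and two more
  for summability.\<close>

lemma hida_test_decay:
  assumes "hida_test d"
  obtains D where "0 \<le> D" "\<And>k. \<bar>d (unit_index k)\<bar> \<le> D / (real k + 1) ^ 4"
proof -
  let ?F = "\<lambda>\<alpha>. mfact \<alpha> * (d \<alpha>)\<^sup>2 * twoN \<alpha> ^ (2 * 4)"
  have sm: "?F summable_on MI" using assms unfolding hida_test_def by blast
  have tw: "0 \<le> twoN \<alpha>" for \<alpha> unfolding twoN_def by (intro prod_nonneg) auto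
  have nn: "0 \<le> ?F \<alpha>" for \<alpha>
    by (intro mult_nonneg_nonneg less_imp_le[OF mfact_pos]) (auto simp: tw)
  show thesis
  proof (rule that[of "sqrt (infsum ?F MI)"])
    show "0 \<le> sqrt (infsum ?F MI)" by (intro real_sqrt_ge_zero infsum_nonneg nn)
    fix k
    have "(\<Sum>\<alpha>\<in>{unit_index k}. ?F \<alpha>) \<le> infsum ?F MI"
      by (rule finite_sum_le_infsum[OF sm]) (use unit_index_in_MI nn in auto)
    then have "(d (unit_index k))\<^sup>2 * (2 * real k + 2) ^ 8 \<le> infsum ?F MI"
      by (simp add: mfact_unit_index twoN_unit_index)
    then have "(d (unit_index k) * (2 * real k + 2) ^ 4)\<^sup>2 \<le> infsum ?F MI"
      by (simp add: power_mult_distrib flip: power_mult)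
    then have "\<bar>d (unit_index k) * (2 * real k + 2) ^ 4\<bar> \<le> sqrt (infsum ?F MI)"
      by (intro real_le_rsqrt) (simp only: power2_abs)
    then have "\<bar>d (unit_index k)\<bar> * (2 * real k + 2) ^ 4 \<le> sqrt (infsum ?F MI)"
      by (simp only: abs_mult) simp
    moreover have "\<bar>d (unit_index k)\<bar> * (real k + 1) ^ 4 \<le> \<bar>d (unit_index k)\<bar> * (2 * real k + 2) ^ 4"
      by (intro mult_left_mono power_mono) auto
    ultimately have "\<bar>d (unit_index k)\<bar> * (real k + 1) ^ 4 \<le> sqrt (infsum ?F MI)" by linarith
    then show "\<bar>d (unit_index k)\<bar> \<le> sqrt (infsum ?F MI) / (real k + 1) ^ 4"
      by (simp add: le_divide_eq)
  qed
qed

lemma hida_pair_first_chaos: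
  assumes "summable (\<lambda>k. \<bar>a k * d (unit_index k)\<bar>)"
  shows "hida_pair (first_chaos a) d = (\<Sum>k. a k * d (unit_index k))"
proof -
  have "hida_pair (first_chaos a) d = infsum (\<lambda>k. a k * d (unit_index k)) UNIV"
    unfolding hida_pair_def
    by (subst infsum_MI_first) (auto simp: first_chaos_eq_0 first_chaos_unit_index mfact_unit_index)
  also have "\<dots> = (\<Sum>k. a k * d (unit_index k))"
    using norm_summable_imp_has_sum[of "\<lambda>k. a k * d (unit_index k)"] assms summable_rabs_cancel[OF assms]
    by (simp add: infsumI summable_sums)
  finally show ?thesis .
qed

text \<open>Pairing with this test function reads off one chaos coefficient. Such test functions
  separate Hida distributions, which makes the Pettis integral unique.\<close>

definition index_delta :: "multi_index \<Rightarrow> hida" where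
  "index_delta \<beta> = (\<lambda>\<alpha>. if \<alpha> = \<beta> then 1 else 0)"

lemma hida_test_index_delta:
  assumes "\<beta> \<in> MI" shows "hida_test (index_delta \<beta>)"
  unfolding hida_test_def
proof (intro conjI allI impI)
  fix p :: nat
  have "(\<lambda>\<alpha>. mfact \<alpha> * (index_delta \<beta> \<alpha>)\<^sup>2 * twoN \<alpha> ^ (2 * p)) summable_on MI \<longleftrightarrow>
      (\<lambda>\<alpha>. mfact \<alpha> * (index_delta \<beta> \<alpha>)\<^sup>2 * twoN \<alpha> ^ (2 * p)) summable_on {\<beta>}"
    using assms by (intro summable_on_cong_neutral) (auto simp: index_delta_def)
  then show "(\<lambda>\<alpha>. mfact \<alpha> * (index_delta \<beta> \<alpha>)\<^sup>2 * twoN \<alpha> ^ (2 * p)) summable_on MI" by simp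
qed (use assms in \<open>auto simp: index_delta_def\<close>)

lemma hida_pair_index_delta:
  assumes "\<beta> \<in> MI" shows "hida_pair c (index_delta \<beta>) = mfact \<beta> * c \<beta>"
proof -
  have "hida_pair c (index_delta \<beta>) = infsum (\<lambda>\<alpha>. mfact \<alpha> * c \<alpha> * index_delta \<beta> \<alpha>) {\<beta>}"
    unfolding hida_pair_def using assms by (intro infsum_cong_neutral) (auto simp: index_delta_def)
  then show ?thesis by (simp add: index_delta_def)
qed

section \<open>Pettis integrals in the first chaos\<close>

lemma pettis_has_integral_unique:
  assumes "pettis_has_integral \<Phi> \<Psi> A" "pettis_has_integral \<Phi> \<Psi>' A"
  shows "\<Psi> = \<Psi>'"
proof
  fix \<beta> show "\<Psi> \<beta> = \<Psi>' \<beta>"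
  proof (cases "\<beta> \<in> MI")
    case True
    then have "hida_pair \<Psi> (index_delta \<beta>) = hida_pair \<Psi>' (index_delta \<beta>)"
      using assms hida_test_index_delta[OF True] unfolding pettis_has_integral_def by metis
    then show ?thesis using True mfact_pos[of \<beta>] by (simp add: hida_pair_index_delta)
  next
    case False
    then show ?thesis using assms unfolding pettis_has_integral_def hida_dist_def by auto
  qed
qed

lemma pettis_integral_eq: "pettis_has_integral \<Phi> \<Psi> A \<Longrightarrow> pettis_integral \<Phi> A = \<Psi>"
  unfolding pettis_integral_def by (rule the_equality) (auto dest: pettis_has_integral_unique)

lemma pettis_has_integral_first_chaos:
  fixes W :: "nat \<Rightarrow> real \<Rightarrow> real"
  assumes meas: "\<And>k. W k \<in> borel_measurable borel"
    and bound: "\<And>k s. s \<in> A \<Longrightarrow> \<bar>W k s\<bar> \<le> C * (real k + 1)\<^sup>2" and C: "0 \<le> C"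
    and A: "A \<in> sets borel" and f: "set_integrable lborel A f" and fm: "f \<in> borel_measurable borel"
  shows "pettis_has_integral (\<lambda>s. first_chaos (\<lambda>k. indicator A s * f s * W k s))
    (first_chaos (\<lambda>k. LINT s:A|lborel. f s * W k s)) UNIV"
proof -
  note [measurable] = meas A fm
  \<comment> \<open>Absorbing the indicator into \<open>g\<close> turns integrals over
    \<open>A\<close> into integrals over the line, where the Pettis integral is taken.\<close>
  define g where "g s = indicator A s * f s" for s
  have gi: "integrable lborel g" using f by (simp add: set_integrable_def g_def[abs_def])
  have [measurable]: "g \<in> borel_measurable borel" unfolding g_def[abs_def] by measurable
  have le: "\<bar>g s * W k s\<bar> \<le> C * (real k + 1)\<^sup>2 * \<bar>g s\<bar>" for s k
  proof (cases "s \<in> A")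
    case True
    then show ?thesis using mult_right_mono[OF bound[OF True, of k], of "\<bar>g s\<bar>"] by (simp add: abs_mult mult_ac)
  qed (simp add: g_def)
  have gW: "integrable lborel (\<lambda>s. g s * W k s)" for k
    by (rule Bochner_Integration.integrable_bound[OF integrable_mult_right[OF integrable_abs[OF gi], of "C * (real k + 1)\<^sup>2"]])
      (use le C in \<open>auto simp: abs_mult\<close>)
  have gWle: "(LINT s|lborel. \<bar>g s * W k s\<bar>) \<le> C * (real k + 1)\<^sup>2 * (LINT s|lborel. \<bar>g s\<bar>)" for k
  proof -
    have "(LINT s|lborel. \<bar>g s * W k s\<bar>) \<le> (LINT s|lborel. C * (real k + 1)\<^sup>2 * \<bar>g s\<bar>)"
      using gi gW le by (intro integral_mono) (auto simp del: abs_mult)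
    then show ?thesis by simp
  qed
  define b where "b k = (LINT s|lborel. g s * W k s)" for k
  have b_eq: "(\<lambda>k. LINT s:A|lborel. f s * W k s) = b"
    by (simp add: b_def g_def set_lebesgue_integral_def mult.assoc fun_eq_iff)
  have b_le: "\<bar>b k\<bar> \<le> (LINT s|lborel. \<bar>g s\<bar>) * C * (real k + 1)\<^sup>2" for k
  proof -
    have "\<bar>b k\<bar> \<le> C * (real k + 1)\<^sup>2 * (LINT s|lborel. \<bar>g s\<bar>)"
      unfolding b_def by (rule order_trans[OF integral_abs_bound gWle])
    then show ?thesis by (simp add: mult_ac)
  qed
  show ?thesis unfolding pettis_has_integral_def b_eq g_def[symmetric]
  proof (intro conjI ballI allI impI)
    show "hida_dist (first_chaos (\<lambda>k. g s * W k s))" for s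
      by (rule hida_dist_first_chaos[where C = "C * \<bar>g s\<bar>"]) (use le in \<open>simp add: mult_ac\<close>)
    show "hida_dist (first_chaos b)" using b_le by (rule hida_dist_first_chaos)
  next
    fix \<phi> :: hida assume "hida_test \<phi>"
    then obtain D where D: "0 \<le> D" "\<And>k. \<bar>\<phi> (unit_index k)\<bar> \<le> D / (real k + 1) ^ 4"
      using hida_test_decay by blast
    have sq: "E * (real k + 1)\<^sup>2 * \<bar>\<phi> (unit_index k)\<bar> \<le> E * D * (1 / (real k + 1)\<^sup>2)" if "0 \<le> E" for E k
    proof -
      have "E * (real k + 1)\<^sup>2 * \<bar>\<phi> (unit_index k)\<bar> \<le> E * (real k + 1)\<^sup>2 * (D / (real k + 1) ^ 4)"
        using that by (intro mult_left_mono D) auto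
      also have "\<dots> = E * D * (1 / (real k + 1)\<^sup>2)"
        by (simp add: divide_simps flip: power_add)
      finally show ?thesis .
    qed
    \<comment> \<open>Applied three times: to the integrand at fixed s, to the integrated
      coefficients, and to the integrals of absolute values. The first and the third are what the
      interchange of sum and integral requires.\<close>
    have sumE: "summable (\<lambda>k. \<bar>x k * \<phi> (unit_index k)\<bar>)"
      if "0 \<le> E" "\<And>k. \<bar>x k\<bar> \<le> E * (real k + 1)\<^sup>2" for x E
    proof (rule summable_comparison_test_ev[OF _ summable_mult[OF summable_inverse_Suc_squares, of "E * D"]],
        rule always_eventually, rule allI)
      fix k
      have "\<bar>x k * \<phi> (unit_index k)\<bar> \<le> E * (real k + 1)\<^sup>2 * \<bar>\<phi> (unit_index k)\<bar>"
        unfolding abs_mult by (intro mult_right_mono that) auto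
      with sq[OF that(1), of k] show "norm \<bar>x k * \<phi> (unit_index k)\<bar> \<le> E * D * (1 / (real k + 1)\<^sup>2)" by simp
    qed
    have G: "0 \<le> (LINT s|lborel. \<bar>g s\<bar>)" by (intro integral_nonneg_AE) auto
    have s1: "summable (\<lambda>k. \<bar>g s * W k s * \<phi> (unit_index k)\<bar>)" for s
      by (rule sumE[of "C * \<bar>g s\<bar>"]) (use C le in \<open>auto simp: mult_ac\<close>)
    have s2: "summable (\<lambda>k. \<bar>b k * \<phi> (unit_index k)\<bar>)"
      by (rule sumE[OF _ b_le]) (use C G in auto)
    have s3: "summable (\<lambda>k. LINT s|lborel. \<bar>g s * W k s * \<phi> (unit_index k)\<bar>)"
    proof -
      have "\<bar>LINT s|lborel. \<bar>g s * W k s\<bar>\<bar> \<le> (LINT s|lborel. \<bar>g s\<bar>) * C * (real k + 1)\<^sup>2" for k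
        using gWle[of k] by (simp add: mult_ac)
      then have "summable (\<lambda>k. \<bar>(LINT s|lborel. \<bar>g s * W k s\<bar>) * \<phi> (unit_index k)\<bar>)"
        using C G by (intro sumE[of "(LINT s|lborel. \<bar>g s\<bar>) * C"]) auto
      then show ?thesis by (simp add: abs_mult)
    qed
    have p1: "hida_pair (first_chaos (\<lambda>k. g s * W k s)) \<phi> = (\<Sum>k. g s * W k s * \<phi> (unit_index k))" for s
      using s1 by (rule hida_pair_first_chaos)
    have int: "integrable lborel (\<lambda>s. g s * W k s * \<phi> (unit_index k))" for k
      using gW by simp
    show "set_integrable lborel UNIV (\<lambda>s. hida_pair (first_chaos (\<lambda>k. g s * W k s)) \<phi>)"
      unfolding p1 set_integrable_def
      using integrable_suminf[OF int] s1 s3 by simp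
    have "(LINT s|lborel. (\<Sum>k. g s * W k s * \<phi> (unit_index k))) = (\<Sum>k. LINT s|lborel. g s * W k s * \<phi> (unit_index k))"
      using s1 s3 by (intro integral_suminf int) auto
    also have "\<dots> = hida_pair (first_chaos b) \<phi>"
      using hida_pair_first_chaos[OF s2] by (simp add: b_def[abs_def])
    finally show "(LINT s:UNIV|lborel. hida_pair (first_chaos (\<lambda>k. g s * W k s)) \<phi>) = hida_pair (first_chaos b) \<phi>"
      unfolding p1 by (simp add: set_lebesgue_integral_def)
  qed
qed

section \<open>Gaussian moments\<close>

lemma hermite_prob_x: "x * hermite_prob n x = hermite_prob (Suc n) x + real n * hermite_prob (n - 1) x"
  by (cases n) auto

lemma continuous_hermite_prob: "continuous_on UNIV (hermite_prob n)"
  by (induction n rule: induct_nat_012) (auto intro!: continuous_intros)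

lemma measurable_hermite_prob[measurable]: "hermite_prob n \<in> borel_measurable borel"
  using continuous_hermite_prob by (rule borel_measurable_continuous_onI)

lemma rapid_hermite_prob_mult: "rapid v \<Longrightarrow> rapid (\<lambda>x. hermite_prob n x * v x)"
proof (induction n rule: less_induct)
  case (less n)
  consider "n = 0" | "n = Suc 0" | m where "n = Suc (Suc m)"
    by (cases n; cases "n - 1") auto
  then show ?case
  proof cases
    case 1 then show ?thesis using less.prems by simp
  next
    case 2 then show ?thesis using rapid_x[OF less.prems] by simp
  next
    case 3
    have "rapid (\<lambda>x. x * (hermite_prob (Suc m) x * v x) - real (Suc m) * (hermite_prob m x * v x))"
      using less.IH[of m] less.IH[of "Suc m"] less.prems 3 by (intro rapid_diff rapid_cmult rapid_x) auto
    then show ?thesis unfolding 3 by (simp add: algebra_simps)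
  qed
qed

lemma rapid_std_normal_density: "rapid std_normal_density"
  using rapid_cmult[OF rapid_gauss, of "1 / sqrt (2 * pi)"]
  by (simp add: std_normal_density_def[abs_def])

lemma rapid_std_normal_poly:
  "rapid (\<lambda>x. std_normal_density x * hermite_prob n x)"
  "rapid (\<lambda>x. std_normal_density x * (x * hermite_prob n x))"
  "rapid (\<lambda>x. std_normal_density x * (hermite_prob n x)\<^sup>2)"
  using rapid_hermite_prob_mult[OF rapid_std_normal_density, of n]
    rapid_x[OF rapid_hermite_prob_mult[OF rapid_std_normal_density, of n]]
    rapid_hermite_prob_mult[OF rapid_hermite_prob_mult[OF rapid_std_normal_density, of n], of n]
  by (simp_all add: power2_eq_square mult_ac)

text \<open>Rodrigues' formula in recursive form. It exhibits the density times a Hermite polynomial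
  of positive degree as a derivative, so its integral vanishes.\<close>

lemma std_normal_hermite_prob_has_derivative:
  "((\<lambda>x. std_normal_density x * hermite_prob n x) has_real_derivative
    - (std_normal_density x * hermite_prob (Suc n) x)) (at x)"
proof (induction n rule: induct_nat_012)
  have d: "(std_normal_density has_real_derivative - (x * std_normal_density x)) (at x)"
  proof -
    have "((\<lambda>x. exp (- (x\<^sup>2) / 2)) has_real_derivative exp (- (x\<^sup>2) / 2) * (- x)) (at x)"
      by (auto intro!: derivative_eq_intros)
    from DERIV_cmult[OF this, of "1 / sqrt (2 * pi)"] show ?thesis
      by (simp add: std_normal_density_def[abs_def] mult_ac)
  qed
  note d[derivative_intros]
  case 0
  show ?case using d by (simp add: mult.commute)
  case 1
  show ?case by (auto intro!: derivative_eq_intros d simp: algebra_simps)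
next
  case (ge2 n)
  note ge2[derivative_intros]
  have "((\<lambda>x. x * (std_normal_density x * hermite_prob (Suc n) x) - real (Suc n) * (std_normal_density x * hermite_prob n x))
      has_real_derivative (std_normal_density x * hermite_prob (Suc n) x - x * (std_normal_density x * hermite_prob (Suc (Suc n)) x))
      - real (Suc n) * (- (std_normal_density x * hermite_prob (Suc n) x))) (at x)"
    by (rule derivative_eq_intros ge2 refl | simp)+
  moreover have "(\<lambda>x. std_normal_density x * hermite_prob (Suc (Suc n)) x) =
      (\<lambda>x. x * (std_normal_density x * hermite_prob (Suc n) x) - real (Suc n) * (std_normal_density x * hermite_prob n x))"
    by (auto simp: algebra_simps)
  ultimately show ?case by (simp add: algebra_simps)
qed

lemma std_normal_hermite_prob_mean:
  "(LINT x|lborel. std_normal_density x * hermite_prob n x) = (if n = 0 then 1 else 0)"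
proof (cases n)
  case 0 then show ?thesis by simp
next
  case (Suc m)
  have "(LINT x|lborel. - (std_normal_density x * hermite_prob (Suc m) x)) = 0"
  proof (rule integral_derivative_eq_0)
    show "((\<lambda>x. std_normal_density x * hermite_prob m x) has_vector_derivative
        - (std_normal_density x * hermite_prob (Suc m) x)) (at x)" for x
      using std_normal_hermite_prob_has_derivative
      by (simp only: has_real_derivative_iff_has_vector_derivative)
    show "continuous_on UNIV (\<lambda>x. - (std_normal_density x * hermite_prob (Suc m) x))"
      unfolding std_normal_density_def[abs_def] by (intro continuous_intros continuous_hermite_prob) auto
    show "integrable lborel (\<lambda>x. - (std_normal_density x * hermite_prob (Suc m) x))"
      using rapid_integrable[OF rapid_std_normal_poly(1)] by simp
  qed (intro rapid_tendsto_0 rapid_std_normal_poly)+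
  then show ?thesis by (simp add: Suc)
qed

lemma std_normal_hermite_prob_x_mean:
  "(LINT x|lborel. std_normal_density x * (x * hermite_prob n x)) = (if n = 1 then 1 else 0)"
proof -
  have "(LINT x|lborel. std_normal_density x * (x * hermite_prob n x))
     = (LINT x|lborel. std_normal_density x * hermite_prob (Suc n) x + real n * (std_normal_density x * hermite_prob (n - 1) x))"
    unfolding hermite_prob_x by (simp add: algebra_simps)
  also have "\<dots> = (if n = 1 then 1 else 0)"
    using rapid_integrable[OF rapid_std_normal_poly(1)]
    by (subst Bochner_Integration.integral_add) (auto simp: std_normal_hermite_prob_mean)
  finally show ?thesis .
qed

text \<open>The power x^k is carried along because the recurrence lowers the index at the price of
  one more factor x.\<close>

lemma hermite_prob_exp_bound: "\<exists>C c. 0 \<le> C \<and> 0 \<le> c \<and> (\<forall>x. \<bar>x ^ k * hermite_prob n x\<bar> \<le> C * exp (c * \<bar>x\<bar>))"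
proof (induction n arbitrary: k rule: less_induct)
  case (less n)
  have base: "\<exists>C c. 0 \<le> C \<and> 0 \<le> c \<and> (\<forall>x::real. \<bar>x ^ j\<bar> \<le> C * exp (c * \<bar>x\<bar>))" for j
    using power_le_fact_exp[of "\<bar>_\<bar>" j] by (intro exI[of _ "fact j"] exI[of _ 1]) (auto simp: power_abs)
  consider "n = 0" | "n = Suc 0" | m where "n = Suc (Suc m)"
    by (cases n; cases "n - 1") auto
  then show ?case
  proof cases
    case 1 then show ?thesis using base[of k] by simp
  next
    case 2 then show ?thesis using base[of "Suc k"] by (simp add: mult.commute)
  next
    case 3
    obtain C1 c1 where 1: "0 \<le> C1" "0 \<le> c1" "\<And>x. \<bar>x ^ Suc k * hermite_prob (Suc m) x\<bar> \<le> C1 * exp (c1 * \<bar>x\<bar>)"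
      using less[of "Suc m" "Suc k"] 3 by auto
    obtain C2 c2 where 2: "0 \<le> C2" "0 \<le> c2" "\<And>x. \<bar>x ^ k * hermite_prob m x\<bar> \<le> C2 * exp (c2 * \<bar>x\<bar>)"
      using less[of m k] 3 by auto
    have "\<bar>x ^ k * hermite_prob n x\<bar> \<le> (C1 + real (Suc m) * C2) * exp ((c1 + c2) * \<bar>x\<bar>)" for x
    proof -
      have "x ^ k * hermite_prob n x = x ^ Suc k * hermite_prob (Suc m) x - real (Suc m) * (x ^ k * hermite_prob m x)"
        unfolding 3 by (simp add: algebra_simps)
      then have "\<bar>x ^ k * hermite_prob n x\<bar> \<le> \<bar>x ^ Suc k * hermite_prob (Suc m) x\<bar> + real (Suc m) * \<bar>x ^ k * hermite_prob m x\<bar>"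
        by (metis abs_triangle_ineq4 abs_mult abs_of_nat)
      also have "\<dots> \<le> C1 * exp (c1 * \<bar>x\<bar>) + real (Suc m) * (C2 * exp (c2 * \<bar>x\<bar>))"
        by (intro add_mono mult_left_mono 1 2) auto
      also have "\<dots> \<le> C1 * exp ((c1 + c2) * \<bar>x\<bar>) + real (Suc m) * (C2 * exp ((c1 + c2) * \<bar>x\<bar>))"
        using 1 2 by (intro add_mono mult_left_mono) (auto intro!: mult_right_mono)
      finally show ?thesis by (simp add: algebra_simps)
    qed
    moreover have "0 \<le> C1 + real (Suc m) * C2" "0 \<le> c1 + c2" using 1 2 by auto
    ultimately show ?thesis by blast
  qed
qed

text \<open>A function with exponential moments against \<open>X\<close> is determined on \<open>\<sigma>(X)\<close> by its moments:
  the Fourier transforms of the laws of \<open>X\<close> under the positive and negative parts of \<open>W\<close> coincide.\<close>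

lemma zero_moments_imp_zero_integral:
  fixes W X :: "'a \<Rightarrow> real"
  assumes [measurable]: "W \<in> borel_measurable M" "X \<in> borel_measurable M"
    and expint: "\<And>c. integrable M (\<lambda>w. W w * exp (c * \<bar>X w\<bar>))"
    and mom: "\<And>n. (LINT w|M. W w * X w ^ n) = 0"
    and B[measurable]: "B \<in> sets borel"
  shows "(LINT w|M. W w * indicator B (X w)) = 0"
proof -
  have Wint: "integrable M W" using expint[of 0] by simp
  \<comment> \<open>The partial sums of the exponential series integrate to 0 by the vanishing
    moments, and they are dominated by |W| exp(|u| |X|).\<close>
  have ftrans: "(LINT w|M. complex_of_real (W w) * iexp (u * X w)) = 0" for u
  proof -
    define S where "S N w = complex_of_real (W w) * (\<Sum>n<N. (\<i> * complex_of_real (u * X w)) ^ n /\<^sub>R fact n)" for N w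
    have Xn: "integrable M (\<lambda>w. W w * X w ^ n)" for n
    proof (rule Bochner_Integration.integrable_bound[OF integrable_mult_right[OF expint[of 1], of "fact n"]])
      show "AE w in M. norm (W w * X w ^ n) \<le> norm (fact n * (W w * exp (1 * \<bar>X w\<bar>)))"
      proof (rule AE_I2)
        fix w
        have "\<bar>W w\<bar> * \<bar>X w\<bar> ^ n \<le> \<bar>W w\<bar> * (fact n * exp \<bar>X w\<bar>)"
          by (intro mult_left_mono power_le_fact_exp) auto
        then show "norm (W w * X w ^ n) \<le> norm (fact n * (W w * exp (1 * \<bar>X w\<bar>)))"
          by (simp add: abs_mult power_abs mult_ac)
      qed
    qed measurable
    have S0: "(LINT w|M. S N w) = 0" for N
    proof -
      have "S N = (\<lambda>w. \<Sum>n<N. (\<i> * complex_of_real u) ^ n / fact n * complex_of_real (W w * X w ^ n))"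
        unfolding S_def by (auto simp: fun_eq_iff sum_distrib_left scaleR_conv_of_real power_mult_distrib field_simps intro!: sum.cong)
      then have "(LINT w|M. S N w) = (\<Sum>n<N. (\<i> * complex_of_real u) ^ n / fact n * complex_of_real (LINT w|M. W w * X w ^ n))"
        using Xn by (simp add: Bochner_Integration.integral_sum del: of_real_mult of_real_power)
      then show ?thesis by (simp add: mom)
    qed
    have "(\<lambda>N. LINT w|M. S N w) \<longlonglongrightarrow> (LINT w|M. complex_of_real (W w) * iexp (u * X w))"
    proof (rule integral_dominated_convergence[where w = "\<lambda>w. \<bar>W w * exp (\<bar>u\<bar> * \<bar>X w\<bar>)\<bar>"])
      show "integrable M (\<lambda>w. \<bar>W w * exp (\<bar>u\<bar> * \<bar>X w\<bar>)\<bar>)" using expint by (rule integrable_abs)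
      show "AE w in M. (\<lambda>N. S N w) \<longlonglongrightarrow> complex_of_real (W w) * iexp (u * X w)"
        unfolding S_def
        by (intro AE_I2 tendsto_mult_left exp_converges[unfolded sums_def])
      show "AE w in M. norm (S N w) \<le> \<bar>W w * exp (\<bar>u\<bar> * \<bar>X w\<bar>)\<bar>" for N
      proof (rule AE_I2)
        fix w
        let ?z = "\<i> * complex_of_real (u * X w)"
        have "norm (\<Sum>n<N. ?z ^ n /\<^sub>R fact n) \<le> (\<Sum>n<N. norm (?z ^ n /\<^sub>R fact n))"
          by (rule norm_sum)
        also have "\<dots> = (\<Sum>n<N. (\<bar>u\<bar> * \<bar>X w\<bar>) ^ n /\<^sub>R fact n)"
          by (simp add: norm_mult norm_power)
        also have "\<dots> \<le> exp (\<bar>u\<bar> * \<bar>X w\<bar>)"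
          unfolding exp_def by (intro sum_le_suminf summable_exp_generic) auto
        finally show "norm (S N w) \<le> \<bar>W w * exp (\<bar>u\<bar> * \<bar>X w\<bar>)\<bar>"
          unfolding S_def by (simp add: norm_mult abs_mult mult_left_mono)
      qed
    qed (auto simp: S_def[abs_def])
    then show ?thesis unfolding S0 using LIMSEQ_unique tendsto_const by blast
  qed
  \<comment> \<open>The moment of order 0 gives both parts of \<open>W\<close> the same mass
    \<open>m\<close>. If \<open>m = 0\<close>, then \<open>W\<close> vanishes almost everywhere;
    otherwise division by \<open>m\<close> produces probability laws.\<close>
  define p where "p w = max 0 (W w)" for w
  define q where "q w = max 0 (- W w)" for w
  have [measurable]: "p \<in> borel_measurable M" "q \<in> borel_measurable M" unfolding p_def[abs_def] q_def[abs_def] by measurable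
  have pq: "W w = p w - q w" "0 \<le> p w" "0 \<le> q w" "\<bar>p w\<bar> \<le> \<bar>W w\<bar>" "\<bar>q w\<bar> \<le> \<bar>W w\<bar>" for w
    by (auto simp: p_def q_def)
  have pi: "integrable M p"
    by (rule Bochner_Integration.integrable_bound[OF Wint]) (auto simp: p_def)
  have qi: "integrable M q"
    by (rule Bochner_Integration.integrable_bound[OF Wint]) (auto simp: q_def)
  define m where "m = (LINT w|M. p w)"
  have mq: "(LINT w|M. q w) = m"
    using mom[of 0] pi qi by (simp add: pq(1) m_def)
  have m0: "0 \<le> m" unfolding m_def by (intro integral_nonneg_AE) (simp add: pq)
  show ?thesis
  proof (cases "m = 0")
    case True
    have "AE w in M. p w = 0" "AE w in M. q w = 0"
      using integral_nonneg_eq_0_iff_AE[OF pi] integral_nonneg_eq_0_iff_AE[OF qi] True mq pq by (auto simp: m_def)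
    then have "AE w in M. W w * indicator B (X w) = 0"
      by eventually_elim (simp add: pq(1))
    then show ?thesis by (rule integral_eq_zero_AE)
  next
    case False
    then have m: "0 < m" using m0 by simp
    define \<mu> where "\<mu> r = distr (density M (\<lambda>w. ennreal (r w / m))) borel X" for r :: "'a \<Rightarrow> real"
    have rd: "real_distribution (\<mu> r)" and int_\<mu>: "\<And>g::real \<Rightarrow> complex. g \<in> borel_measurable borel \<Longrightarrow> (LINT x|\<mu> r. g x) = (LINT w|M. (r w / m) *\<^sub>R g (X w))"
      if r[measurable]: "r \<in> borel_measurable M" and r0: "\<And>w. 0 \<le> r w" and ri: "integrable M r" "(LINT w|M. r w) = m" for r
    proof -
      have "prob_space (density M (\<lambda>w. ennreal (r w / m)))"
      proof (rule prob_spaceI)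
        have "emeasure (density M (\<lambda>w. ennreal (r w / m))) (space M) = (\<integral>\<^sup>+ w. ennreal (r w / m) \<partial>M)"
          by (subst emeasure_density) (auto intro!: nn_integral_cong)
        also have "\<dots> = ennreal (LINT w|M. r w / m)"
          using ri r0 m by (intro nn_integral_eq_integral) auto
        also have "\<dots> = 1" using ri m by simp
        finally show "emeasure (density M (\<lambda>w. ennreal (r w / m))) (space (density M (\<lambda>w. ennreal (r w / m)))) = 1" by simp
      qed
      then have "prob_space (\<mu> r)" unfolding \<mu>_def by (rule prob_space.prob_space_distr) simp
      then show "real_distribution (\<mu> r)"
        by (simp add: real_distribution_def real_distribution_axioms_def \<mu>_def)
      show "(LINT x|\<mu> r. g x) = (LINT w|M. (r w / m) *\<^sub>R g (X w))" if [measurable]: "g \<in> borel_measurable borel" for g :: "real \<Rightarrow> complex"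
        unfolding \<mu>_def using r0 m by (subst integral_distr) (auto intro!: integral_density)
    qed
    note P = rd[OF _ pq(2) pi m_def[symmetric]] int_\<mu>[OF _ pq(2) pi m_def[symmetric]]
    note Q = rd[OF _ pq(3) qi mq] int_\<mu>[OF _ pq(3) qi mq]
    have intc: "integrable M (\<lambda>w. (r w / m) *\<^sub>R g (X w))"
      if "integrable M r" and [measurable]: "r \<in> borel_measurable M" "g \<in> borel_measurable borel" and "\<And>x. norm (g x) \<le> 1"
      for r and g :: "real \<Rightarrow> complex"
      using m that(4) by (intro Bochner_Integration.integrable_bound[OF integrable_divide[OF that(1), of m]])
        (auto intro!: divide_right_mono mult_left_le)
    \<comment> \<open>Used with g = e^{iux} to identify the two laws, and then with the indicator of
      \<open>B\<close> to read off the claim.\<close>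
    have diff: "(LINT x|\<mu> p. g x) - (LINT x|\<mu> q. g x) = (LINT w|M. complex_of_real (W w) * g (X w)) / m"
      if [measurable]: "g \<in> borel_measurable borel" and "\<And>x. norm (g x) \<le> 1" for g
    proof -
      have "(LINT x|\<mu> p. g x) - (LINT x|\<mu> q. g x) = (LINT w|M. (p w / m) *\<^sub>R g (X w) - (q w / m) *\<^sub>R g (X w))"
        using that pi qi by (simp add: P Q intc)
      also have "\<dots> = (LINT w|M. complex_of_real (W w) * g (X w) / m)"
        by (intro Bochner_Integration.integral_cong refl) (simp add: pq(1) scaleR_conv_of_real diff_divide_distrib left_diff_distrib)
      finally show ?thesis by simp
    qed
    have "char (\<mu> p) = char (\<mu> q)"
    proof
      fix u
      have "char (\<mu> p) u - char (\<mu> q) u = (LINT w|M. complex_of_real (W w) * iexp (u * X w)) / m"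
        unfolding char_def by (rule diff) auto
      then have "char (\<mu> p) u - char (\<mu> q) u = 0" by (simp only: ftrans div_0)
      then show "char (\<mu> p) u = char (\<mu> q) u" by simp
    qed
    then have "\<mu> p = \<mu> q" using P(1) Q(1) by (intro Levy_uniqueness) auto
    moreover have "(LINT x|\<mu> p. complex_of_real (indicator B x)) - (LINT x|\<mu> q. complex_of_real (indicator B x))
        = (LINT w|M. complex_of_real (W w) * complex_of_real (indicator B (X w))) / m"
      by (rule diff) (auto simp: indicator_def)
    ultimately have "complex_of_real (LINT w|M. W w * indicator B (X w)) / complex_of_real m = 0"
      unfolding integral_complex_of_real[symmetric] of_real_mult by (simp only: diff_self)
    then show ?thesis using m by simp
  qed
qed

section \<open>Integrals of functions of the Gaussian coordinates\<close>

locale white_noise =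
  fixes M :: "'w measure" and \<xi> :: "nat \<Rightarrow> 'w \<Rightarrow> real"
  assumes white_noise: "white_noise_space M \<xi>"

sublocale white_noise \<subseteq> prob_space M
  using white_noise by (simp add: white_noise_space_def)

context white_noise
begin

lemma dist: "distributed M lborel (\<xi> k) std_normal_density"
  using white_noise by (simp add: white_noise_space_def)

lemma indep: "indep_vars (\<lambda>_. borel) \<xi> UNIV"
  using white_noise by (simp add: white_noise_space_def)

lemma measurable_xi[measurable]: "\<xi> k \<in> borel_measurable M"
  using dist[of k] by (simp add: distributed_def)

lemma integrable_xi:
  assumes "g \<in> borel_measurable borel" "integrable lborel (\<lambda>x. std_normal_density x * g x)"
  shows "integrable M (\<lambda>w. g (\<xi> k w))"
  using distributed_integrable[OF dist[of k], of g] assms by simp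

lemma integral_xi:
  assumes "g \<in> borel_measurable borel"
  shows "(LINT w|M. g (\<xi> k w)) = (LINT x|lborel. std_normal_density x * g x)"
  using distributed_integral[OF dist[of k], of g] assms by simp

lemma prod_xi:
  fixes g :: "nat \<Rightarrow> real \<Rightarrow> 'b::{real_normed_field, banach, second_countable_topology}"
  assumes "finite I" and g: "\<And>i. i \<in> I \<Longrightarrow> g i \<in> borel_measurable borel"
    and int: "\<And>i. i \<in> I \<Longrightarrow> integrable M (\<lambda>w. g i (\<xi> i w))"
  shows "integrable M (\<lambda>w. \<Prod>i\<in>I. g i (\<xi> i w))"
    "(LINT w|M. (\<Prod>i\<in>I. g i (\<xi> i w))) = (\<Prod>i\<in>I. LINT w|M. g i (\<xi> i w))"
proof -
  have "indep_vars (\<lambda>_. borel) (\<lambda>i w. g i (\<xi> i w)) I"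
    using indep_vars_compose2[OF indep_vars_subset[OF indep, of I], of g "\<lambda>_. borel"] g by simp
  from indep_vars_integrable[OF assms(1) this int] indep_vars_lebesgue_integral[OF assms(1) this int]
  show "integrable M (\<lambda>w. \<Prod>i\<in>I. g i (\<xi> i w))"
    "(LINT w|M. (\<Prod>i\<in>I. g i (\<xi> i w))) = (\<Prod>i\<in>I. LINT w|M. g i (\<xi> i w))" by auto
qed

lemma hermite_xi:
  "integrable M (\<lambda>w. hermite_prob n (\<xi> k w))" "integrable M (\<lambda>w. (hermite_prob n (\<xi> k w))\<^sup>2)"
  "integrable M (\<lambda>w. \<xi> k w * hermite_prob n (\<xi> k w))"
  "(LINT w|M. hermite_prob n (\<xi> k w)) = (if n = 0 then 1 else 0)"
  "(LINT w|M. \<xi> k w * hermite_prob n (\<xi> k w)) = (if n = 1 then 1 else 0)"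
proof -
  show "integrable M (\<lambda>w. hermite_prob n (\<xi> k w))" "integrable M (\<lambda>w. (hermite_prob n (\<xi> k w))\<^sup>2)"
    "integrable M (\<lambda>w. \<xi> k w * hermite_prob n (\<xi> k w))"
    using rapid_integrable[OF rapid_std_normal_poly(1)] rapid_integrable[OF rapid_std_normal_poly(2)]
      rapid_integrable[OF rapid_std_normal_poly(3)]
    by (auto intro!: integrable_xi[of "hermite_prob n"] integrable_xi[of "\<lambda>x. (hermite_prob n x)\<^sup>2"]
       integrable_xi[of "\<lambda>x. x * hermite_prob n x"])
  show "(LINT w|M. hermite_prob n (\<xi> k w)) = (if n = 0 then 1 else 0)"
    by (subst integral_xi) (simp_all only: std_normal_hermite_prob_mean measurable_hermite_prob)
  show "(LINT w|M. \<xi> k w * hermite_prob n (\<xi> k w)) = (if n = 1 then 1 else 0)"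
    using integral_xi[of "\<lambda>x. x * hermite_prob n x" k] by (simp add: std_normal_hermite_prob_x_mean)
qed

lemma wick_hermite_alt:
  assumes "{k. \<alpha> k \<noteq> 0} \<subseteq> I" "finite I"
  shows "wick_hermite \<xi> \<alpha> w = (\<Prod>k\<in>I. hermite_prob (\<alpha> k) (\<xi> k w))"
  unfolding wick_hermite_def by (rule prod.mono_neutral_left) (use assms in auto)

lemma wick_hermite_L2:
  assumes "\<alpha> \<in> MI"
  shows "wick_hermite \<xi> \<alpha> \<in> borel_measurable M" "integrable M (\<lambda>w. (wick_hermite \<xi> \<alpha> w)\<^sup>2)"
proof -
  show "wick_hermite \<xi> \<alpha> \<in> borel_measurable M" unfolding wick_hermite_def[abs_def] by measurable
  show "integrable M (\<lambda>w. (wick_hermite \<xi> \<alpha> w)\<^sup>2)"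
    unfolding wick_hermite_def prod_power_distrib
    by (rule prod_xi(1)[where g = "\<lambda>i x. (hermite_prob (\<alpha> i) x)\<^sup>2"]) (use assms hermite_xi(2) in \<open>auto simp: MI_def\<close>)
qed

lemma xi_eq_wick_hermite: "wick_hermite \<xi> (unit_index k) w = \<xi> k w"
  using wick_hermite_alt[of "unit_index k" "{k}" w] by (simp add: unit_index_def)

lemma xi_L2: "integrable M (\<lambda>w. (\<xi> k w)\<^sup>2)"
  using hermite_xi(3)[of k 1] by (simp add: power2_eq_square)

text \<open>Independence factorises the integral. The factor at k survives only in degree 1, every
  other factor only in degree 0.\<close>

lemma integral_xi_wick_hermite:
  assumes "\<alpha> \<in> MI"
  shows "(LINT w|M. \<xi> k w * wick_hermite \<xi> \<alpha> w) = (if \<alpha> = unit_index k then 1 else 0)"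
proof -
  \<comment> \<open>\<open>k\<close> is added since it may lie outside the support of
    \<alpha>.\<close>
  define I where "I = insert k {k. \<alpha> k \<noteq> 0}"
  have I: "finite I" "k \<in> I" "{k. \<alpha> k \<noteq> 0} \<subseteq> I" using assms by (auto simp: I_def MI_def)
  define g where "g i x = (if i = k then x * hermite_prob (\<alpha> i) x else hermite_prob (\<alpha> i) x)" for i and x :: real
  have gm: "g i \<in> borel_measurable borel" for i
    unfolding g_def[abs_def] by (cases "i = k") simp_all
  have int: "integrable M (\<lambda>w. g i (\<xi> i w))" for i
    unfolding g_def by (cases "i = k") (simp_all add: hermite_xi)
  have val: "(LINT w|M. g i (\<xi> i w)) = (if \<alpha> i = (if i = k then 1 else 0) then 1 else 0)" for i
    unfolding g_def by (cases "i = k") (simp_all add: hermite_xi)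
  have "\<xi> k w * wick_hermite \<xi> \<alpha> w = (\<Prod>i\<in>I. g i (\<xi> i w))" for w
  proof -
    have "(\<Prod>i\<in>I - {k}. g i (\<xi> i w)) = (\<Prod>i\<in>I - {k}. hermite_prob (\<alpha> i) (\<xi> i w))"
      by (rule prod.cong) (auto simp: g_def)
    then show ?thesis
      unfolding wick_hermite_alt[OF I(3,1)] prod.remove[OF I(1,2)] by (simp add: g_def)
  qed
  then have "(LINT w|M. \<xi> k w * wick_hermite \<xi> \<alpha> w) = (\<Prod>i\<in>I. LINT w|M. g i (\<xi> i w))"
    using prod_xi(2)[OF I(1) gm int] by simp
  also have "\<dots> = (\<Prod>i\<in>I. if \<alpha> i = (if i = k then 1 else 0) then 1 else 0)"
    by (rule prod.cong[OF refl]) (rule val)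
  also have "\<dots> = (if \<forall>i\<in>I. \<alpha> i = unit_index k i then 1 else 0)"
  proof (cases "\<forall>i\<in>I. \<alpha> i = unit_index k i")
    case True
    then have "(\<Prod>i\<in>I. if \<alpha> i = (if i = k then 1 else 0) then 1 else 0 :: real) = 1"
      by (intro prod.neutral) (auto simp: unit_index_def)
    then show ?thesis using True by simp
  next
    case False
    then have "(\<Prod>i\<in>I. if \<alpha> i = (if i = k then 1 else 0) then 1 else 0 :: real) = 0"
      using I(1) by (intro prod_zero) (auto simp: unit_index_def)
    then show ?thesis using False by simp
  qed
  also have "(\<forall>i\<in>I. \<alpha> i = unit_index k i) \<longleftrightarrow> \<alpha> = unit_index k"
    using I by (auto simp: I_def unit_index_def fun_eq_iff)
  finally show ?thesis .
qed

lemma xi_orthonormal: "(LINT w|M. \<xi> j w * \<xi> k w) = (if j = k then 1 else 0)"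
  using integral_xi_wick_hermite[OF unit_index_in_MI, of j k]
  by (auto simp: xi_eq_wick_hermite unit_index_inject)

text \<open>The exponential of c|x| is at most e^{cx} + e^{-cx}, and completing the square turns
  each of these times the density into a shifted normal density.\<close>

lemma exp_abs_xi:
  "integrable M (\<lambda>w. exp (c * \<bar>\<xi> k w\<bar>))"
proof -
  have e: "integrable M (\<lambda>w. exp (c * \<xi> k w))" for c
  proof (rule integrable_xi[of "\<lambda>x. exp (c * x)"])
    have "std_normal_density x * exp (c * x) = exp (c\<^sup>2 / 2) * normal_density c 1 x" for x
    proof -
      have "- (x\<^sup>2) / 2 + c * x = c\<^sup>2 / 2 + - ((x - c)\<^sup>2) / 2"
        by (simp add: power2_eq_square field_simps)
      then have "exp (- (x\<^sup>2) / 2) * exp (c * x) = exp (c\<^sup>2 / 2) * exp (- ((x - c)\<^sup>2) / 2)"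
        by (simp only: exp_add[symmetric])
      then show ?thesis by (simp add: std_normal_density_def normal_density_def)
    qed
    then show "integrable lborel (\<lambda>x. std_normal_density x * exp (c * x))"
      by (simp add: integrable_mult_right)
  qed simp
  have le: "exp (c * \<bar>x\<bar>) \<le> exp (c * x) + exp (- c * x)" for x
    by (cases "0 \<le> x") (auto simp: less_imp_le)
  show ?thesis
    by (rule Bochner_Integration.integrable_bound[OF Bochner_Integration.integrable_add[OF e[of c] e[of "-c"]]])
      (use le in \<open>auto simp: abs_of_pos add_pos_pos\<close>)
qed

end

section \<open>Completeness of the Wick--Hermite system\<close>

context white_noise
begin

text \<open>Hermite factors are replaced by indicators one coordinate at a time; \<open>m\<close> counts the
  coordinates already treated.\<close>

definition mixed_factor :: "(nat \<Rightarrow> real set) \<Rightarrow> (nat \<Rightarrow> nat) \<Rightarrow> nat \<Rightarrow> nat \<Rightarrow> real \<Rightarrow> real" where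
  "mixed_factor B \<alpha> m j x = (if j < m then indicator (B j) x else hermite_prob (\<alpha> j) x)"

lemma measurable_mixed_factor[measurable]:
  assumes "\<And>j. B j \<in> sets borel" shows "mixed_factor B \<alpha> m j \<in> borel_measurable borel"
  using assms unfolding mixed_factor_def[abs_def] by (cases "j < m") auto

lemma integrable_mixed_factor_square:
  assumes B[measurable]: "\<And>j. B j \<in> sets borel"
  shows "integrable M (\<lambda>w. (mixed_factor B \<alpha> m j (\<xi> j w))\<^sup>2)"
proof (cases "j < m")
  case True
  have "integrable M (\<lambda>w. (indicator (B j) (\<xi> j w) :: real)\<^sup>2)"
    by (rule integrable_const_bound[where B = 1]) (auto simp: indicator_def)
  then show ?thesis using True by (simp add: mixed_factor_def)
next
  case False
  then show ?thesis using hermite_xi(2)[of "\<alpha> j" j] by (simp add: mixed_factor_def)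
qed

text \<open>\<open>Y\<close> and the remaining product are both square integrable; the square of the
  latter factorises by independence because \<open>i\<close> is not in \<open>I\<close>.\<close>

lemma integrable_mixed_exp:
  assumes B[measurable]: "\<And>j. B j \<in> sets borel"
    and Y[measurable]: "Y \<in> borel_measurable M" and Y2: "integrable M (\<lambda>w. (Y w)\<^sup>2)"
    and I: "finite I" "i \<notin> I"
  shows "integrable M (\<lambda>w. Y w * (\<Prod>j\<in>I. mixed_factor B \<alpha> m j (\<xi> j w)) * exp (c * \<bar>\<xi> i w\<bar>))"
proof -
  define g where "g j x = (if j = i then exp (2 * c * \<bar>x\<bar>) else (mixed_factor B \<alpha> m j x)\<^sup>2)" for j and x :: real
  have gm: "g j \<in> borel_measurable borel" for j
    unfolding g_def[abs_def] by (cases "j = i") simp_all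
  have gi: "integrable M (\<lambda>w. g j (\<xi> j w))" for j
    unfolding g_def by (cases "j = i") (simp_all add: exp_abs_xi integrable_mixed_factor_square)
  let ?V = "\<lambda>w. (\<Prod>j\<in>I. mixed_factor B \<alpha> m j (\<xi> j w)) * exp (c * \<bar>\<xi> i w\<bar>)"
  have "(?V w)\<^sup>2 = (\<Prod>j\<in>insert i I. g j (\<xi> j w))" for w
  proof -
    have "(\<Prod>j\<in>I. g j (\<xi> j w)) = (\<Prod>j\<in>I. (mixed_factor B \<alpha> m j (\<xi> j w))\<^sup>2)"
      by (rule prod.cong) (use I in \<open>auto simp: g_def\<close>)
    then show ?thesis using I
      by (simp add: g_def power_mult_distrib prod_power_distrib mult.commute mult.assoc exp_double[symmetric])
  qed
  then have "integrable M (\<lambda>w. (?V w)\<^sup>2)"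
    using prod_xi(1)[of "insert i I" g] I gm gi by simp
  then have "integrable M (\<lambda>w. Y w * ?V w)"
    using Y2 by (intro integrable_mult_of_squares) measurable
  then show ?thesis by (simp add: mult.assoc)
qed

text \<open>The induction keeps \<alpha> arbitrary: passing from m to m + 1 uses the hypothesis for
  every degree a in coordinate m, that is for all \<open>\<alpha>(m := a)\<close>.\<close>

lemma zero_chaos_imp_zero_mixed:
  assumes B[measurable]: "\<And>j. B j \<in> sets borel"
    and Y[measurable]: "Y \<in> borel_measurable M" and Y2: "integrable M (\<lambda>w. (Y w)\<^sup>2)"
    and orth: "\<And>\<alpha>. \<alpha> \<in> MI \<Longrightarrow> (LINT w|M. Y w * wick_hermite \<xi> \<alpha> w) = 0"
  shows "(LINT w|M. Y w * (\<Prod>j<n. mixed_factor B \<alpha> m j (\<xi> j w))) = 0"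
proof (induction m arbitrary: \<alpha>)
  case 0
  define \<beta> where "\<beta> j = (if j < n then \<alpha> j else 0)" for j
  have sub: "{k. \<beta> k \<noteq> 0} \<subseteq> {..<n}" by (auto simp: \<beta>_def)
  then have "\<beta> \<in> MI" unfolding MI_def using finite_subset by blast
  moreover have "wick_hermite \<xi> \<beta> w = (\<Prod>j<n. mixed_factor B \<alpha> 0 j (\<xi> j w))" for w
    unfolding wick_hermite_alt[OF sub finite_lessThan] by (rule prod.cong) (auto simp: mixed_factor_def \<beta>_def)
  ultimately show ?case using orth[of \<beta>] by simp
next
  case (Suc m)
  show ?case
  proof (cases "m < n")
    case False
    have "(\<Prod>j<n. mixed_factor B \<alpha> (Suc m) j (\<xi> j w)) = (\<Prod>j<n. mixed_factor B \<alpha> m j (\<xi> j w))" for w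
      by (rule prod.cong) (use False in \<open>auto simp: mixed_factor_def\<close>)
    then show ?thesis using Suc by simp
  next
    case True
    let ?I = "{..<n} - {m}"
    \<comment> \<open>Everything except coordinate m. This is the function whose moments against
      \<open>\<xi> m\<close> are shown to vanish.\<close>
    define W where "W w = Y w * (\<Prod>j\<in>?I. mixed_factor B \<alpha> m j (\<xi> j w))" for w
    have [measurable]: "W \<in> borel_measurable M" unfolding W_def[abs_def] by measurable
    have expint: "integrable M (\<lambda>w. W w * exp (c * \<bar>\<xi> m w\<bar>))" for c
      unfolding W_def by (rule integrable_mixed_exp[OF B Y Y2]) auto
    have herm: "(LINT w|M. W w * hermite_prob a (\<xi> m w)) = 0" for a
    proof -
      have "W w * hermite_prob a (\<xi> m w) = Y w * (\<Prod>j<n. mixed_factor B (\<alpha>(m := a)) m j (\<xi> j w))" for w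
      proof -
        have "(\<Prod>j\<in>?I. mixed_factor B \<alpha> m j (\<xi> j w)) = (\<Prod>j\<in>?I. mixed_factor B (\<alpha>(m := a)) m j (\<xi> j w))"
          by (rule prod.cong) (auto simp: mixed_factor_def)
        then show ?thesis
          using prod.remove[of "{..<n}" m "\<lambda>j. mixed_factor B (\<alpha>(m := a)) m j (\<xi> j w)"] True
          by (simp add: W_def mixed_factor_def)
      qed
      then show ?thesis using Suc[of "\<alpha>(m := a)"] by (simp only:)
    qed
    have int: "integrable M (\<lambda>w. W w * (\<xi> m w ^ k * hermite_prob a (\<xi> m w)))" for k a
    proof -
      obtain C c where C: "0 \<le> C" "\<And>x. \<bar>x ^ k * hermite_prob a x\<bar> \<le> C * exp (c * \<bar>x\<bar>)"
        using hermite_prob_exp_bound[of k a] by auto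
      show ?thesis
      proof (rule Bochner_Integration.integrable_bound[OF integrable_mult_right[OF expint[of c], of C]])
        show "AE w in M. norm (W w * (\<xi> m w ^ k * hermite_prob a (\<xi> m w))) \<le> norm (C * (W w * exp (c * \<bar>\<xi> m w\<bar>)))"
        proof (rule AE_I2)
          fix w
          have "\<bar>W w\<bar> * \<bar>\<xi> m w ^ k * hermite_prob a (\<xi> m w)\<bar> \<le> \<bar>W w\<bar> * (C * exp (c * \<bar>\<xi> m w\<bar>))"
            by (intro mult_left_mono C) auto
          then show "norm (W w * (\<xi> m w ^ k * hermite_prob a (\<xi> m w))) \<le> norm (C * (W w * exp (c * \<bar>\<xi> m w\<bar>)))"
            using C(1) by (simp add: abs_mult mult_ac)
        qed
      qed measurable
    qed
    \<comment> \<open>Each power of \<open>\<xi> m\<close> is traded for neighbouring Hermite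
      degrees by \<open>hermite_prob_x\<close>; the case a = 0 gives the pure moments.\<close>
    have mom: "(LINT w|M. W w * (\<xi> m w ^ k * hermite_prob a (\<xi> m w))) = 0" for k a
    proof (induction k arbitrary: a)
      case 0 show ?case using herm by simp
    next
      case (Suc k)
      have "W w * (\<xi> m w ^ Suc k * hermite_prob a (\<xi> m w)) = W w * (\<xi> m w ^ k * hermite_prob (Suc a) (\<xi> m w))
         + real a * (W w * (\<xi> m w ^ k * hermite_prob (a - 1) (\<xi> m w)))" for w
      proof -
        have "W w * (\<xi> m w ^ Suc k * hermite_prob a (\<xi> m w)) = W w * (\<xi> m w ^ k * (\<xi> m w * hermite_prob a (\<xi> m w)))"
          by simp
        then show ?thesis unfolding hermite_prob_x by (simp add: distrib_left mult_ac)
      qed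
      then have "(LINT w|M. W w * (\<xi> m w ^ Suc k * hermite_prob a (\<xi> m w))) =
         (LINT w|M. W w * (\<xi> m w ^ k * hermite_prob (Suc a) (\<xi> m w)))
         + real a * (LINT w|M. W w * (\<xi> m w ^ k * hermite_prob (a - 1) (\<xi> m w)))"
        using int by simp
      then show ?case by (simp only: Suc)
    qed
    have "(LINT w|M. W w * indicator (B m) (\<xi> m w)) = 0"
      by (rule zero_moments_imp_zero_integral[OF _ _ expint]) (use mom[of _ 0] in auto)
    moreover have "W w * indicator (B m) (\<xi> m w) = Y w * (\<Prod>j<n. mixed_factor B \<alpha> (Suc m) j (\<xi> j w))" for w
    proof -
      have "(\<Prod>j\<in>?I. mixed_factor B \<alpha> m j (\<xi> j w)) = (\<Prod>j\<in>?I. mixed_factor B \<alpha> (Suc m) j (\<xi> j w))"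
        by (rule prod.cong) (auto simp: mixed_factor_def)
      then show ?thesis
        using prod.remove[of "{..<n}" m "\<lambda>j. mixed_factor B \<alpha> (Suc m) j (\<xi> j w)"] True
        by (simp add: W_def mixed_factor_def)
    qed
    ultimately show ?thesis by simp
  qed
qed

text \<open>Cylinder sets are stable under intersection and generate the sigma algebra, and the sets
  over which \<open>Y\<close> integrates to 0 form a Dynkin system.\<close>

lemma zero_chaos_imp_AE_zero:
  assumes Y[measurable]: "Y \<in> borel_measurable M" and Y2: "integrable M (\<lambda>w. (Y w)\<^sup>2)"
    and orth: "\<And>\<alpha>. \<alpha> \<in> MI \<Longrightarrow> (LINT w|M. Y w * wick_hermite \<xi> \<alpha> w) = 0"
  shows "AE w in M. Y w = 0"
proof -
  have Yi: "integrable M Y"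
    using integrable_mult_of_squares[OF Y, of "\<lambda>_. 1"] Y2 by simp
  define cyl where "cyl n B = {w \<in> space M. \<forall>j<n. \<xi> j w \<in> B j}" for n :: nat and B :: "nat \<Rightarrow> real set"
  define G where "G = {cyl n B | n B. \<forall>j. B j \<in> sets borel}"
  have G_sets: "G \<subseteq> sets M"
    unfolding G_def cyl_def by auto
  have "Int_stable G"
  proof (rule Int_stableI)
    fix a b assume "a \<in> G" "b \<in> G"
    then obtain n B n' B' where ab: "a = cyl n B" "b = cyl n' B'" "\<forall>j. B j \<in> sets borel" "\<forall>j. B' j \<in> sets borel"
      unfolding G_def by auto
    \<comment> \<open>Cylinders of different lengths are padded with \<open>UNIV\<close> before
      their bases are intersected.\<close>
    define C where "C j = (if j < n then B j else UNIV) \<inter> (if j < n' then B' j else UNIV)" for j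
    have "x \<in> C j \<longleftrightarrow> (j < n \<longrightarrow> x \<in> B j) \<and> (j < n' \<longrightarrow> x \<in> B' j)" for x j
      by (simp add: C_def)
    then have "a \<inter> b = cyl (max n n') C"
      unfolding ab(1,2) cyl_def less_max_iff_disj by blast
    moreover have "\<forall>j. C j \<in> sets borel" using ab(3,4) by (auto simp: C_def)
    ultimately show "a \<inter> b \<in> G" unfolding G_def by blast
  qed
  have gen: "sets M = sigma_sets (space M) G"
  proof
    have "sets M = sigma_sets (space M) (\<Union>k. {\<xi> k -` B \<inter> space M | B. B \<in> sets borel})"
      using white_noise unfolding white_noise_space_def by (elim conjE)
    also have "\<dots> \<subseteq> sigma_sets (space M) G"
    proof (rule sigma_sets_mono', safe)
      fix k and B :: "real set" assume B: "B \<in> sets borel"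
      have "\<xi> k -` B \<inter> space M = cyl (Suc k) (\<lambda>j. if j = k then B else UNIV)"
        unfolding cyl_def by auto
      then show "\<xi> k -` B \<inter> space M \<in> G"
        unfolding G_def using B by (intro CollectI exI conjI) auto
    qed
    finally show "sets M \<subseteq> sigma_sets (space M) G" .
    show "sigma_sets (space M) G \<subseteq> sets M" by (rule sets.sigma_sets_subset[OF G_sets])
  qed
  have cyl_zero: "(LINT w|M. Y w * indicator A w) = 0" if AG: "A \<in> G" for A
  proof -
    obtain n B where A: "A = cyl n B" and B: "\<And>j. B j \<in> sets borel" using AG unfolding G_def by blast
    \<comment> \<open>At \<open>m = n\<close> all Hermite factors have become indicators, and their
      product is the indicator of the cylinder.\<close>
    have "(\<Prod>j<n. mixed_factor B (\<lambda>_. 0) n j (\<xi> j w)) = indicator A w" if "w \<in> space M" for w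
    proof (cases "\<forall>j<n. \<xi> j w \<in> B j")
      case True
      then have "(\<Prod>j<n. mixed_factor B (\<lambda>_. 0) n j (\<xi> j w)) = 1"
        by (intro prod.neutral) (auto simp: mixed_factor_def)
      then show ?thesis using True that by (simp add: A cyl_def)
    next
      case False
      then obtain j where "j \<in> {..<n}" "mixed_factor B (\<lambda>_. 0) n j (\<xi> j w) = 0"
        by (auto simp: mixed_factor_def)
      then have "(\<Prod>j<n. mixed_factor B (\<lambda>_. 0) n j (\<xi> j w)) = 0"
        by (intro prod_zero) auto
      then show ?thesis using False by (simp add: A cyl_def)
    qed
    then have "(LINT w|M. Y w * indicator A w) = (LINT w|M. Y w * (\<Prod>j<n. mixed_factor B (\<lambda>_. 0) n j (\<xi> j w)))"
      by (intro Bochner_Integration.integral_cong) auto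
    then show ?thesis using zero_chaos_imp_zero_mixed[OF B Y Y2 orth] by simp
  qed
  \<comment> \<open>The whole space is the cylinder without constraints; complements in the Dynkin
    argument need its integral to be 0.\<close>
  have total: "(LINT w|M. Y w) = 0"
  proof -
    have "space M \<in> G" unfolding G_def cyl_def by (intro CollectI exI[of _ 0] exI[of _ "\<lambda>_. UNIV"]) auto
    from cyl_zero[OF this] show ?thesis by (simp cong: Bochner_Integration.integral_cong)
  qed
  have Yind: "integrable M (\<lambda>w. Y w * indicator A w)" if "A \<in> sets M" for A
    using integrable_real_mult_indicator[OF that Yi] by simp
  have PG: "G \<subseteq> Pow (space M)" using G_sets sets.sets_into_space by auto
  have all: "(LINT w|M. Y w * indicator A w) = 0" if "A \<in> sets M" for A
    using \<open>Int_stable G\<close> PG that[unfolded gen]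
  proof (induction rule: sigma_sets_induct_disjoint)
    case (basic A) then show ?case by (rule cyl_zero)
  next
    case empty show ?case by simp
  next
    case (compl A)
    then have "A \<in> sets M" unfolding gen by simp
    have "(LINT w|M. Y w * indicator (space M - A) w) = (LINT w|M. Y w - Y w * indicator A w)"
      by (intro Bochner_Integration.integral_cong) (auto simp: indicator_def)
    then show ?case using compl Yi Yind[OF \<open>A \<in> sets M\<close>] total by simp
  next
    case (union A)
    then have A: "\<And>i. A i \<in> sets M" unfolding gen by auto
    have "(\<lambda>n. LINT w|M. Y w * indicator (\<Union>i<n. A i) w) \<longlonglongrightarrow> (LINT w|M. Y w * indicator (\<Union>i. A i) w)"
    proof (rule integral_dominated_convergence[where w = "\<lambda>w. \<bar>Y w\<bar>"])
      show "AE w in M. (\<lambda>n. Y w * indicator (\<Union>i<n. A i) w) \<longlonglongrightarrow> Y w * indicator (\<Union>i. A i) w"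
        by (intro AE_I2 tendsto_mult_left LIMSEQ_indicator_UN)
    qed (use A Yi in \<open>auto simp: indicator_def\<close>)
    moreover have "(LINT w|M. Y w * indicator (\<Union>i<n. A i) w) = 0" for n
    proof -
      have "Y w * indicator (\<Union>i<n. A i) w = (\<Sum>i<n. Y w * indicator (A i) w)" for w
        using union(1) by (subst indicator_UN_disjoint) (auto simp: sum_distrib_left intro: disjoint_family_on_mono)
      then show ?thesis
        by (simp only:) (subst Bochner_Integration.integral_sum, use Yind[OF A] union(3) in auto)
    qed
    ultimately have "(\<lambda>n::nat. 0) \<longlonglongrightarrow> (LINT w|M. Y w * indicator (\<Union>i. A i) w)"
      by (simp only:)
    then show ?case by (simp only: LIMSEQ_const_iff)
  qed
  \<comment> \<open>On each of these two sets \<open>Y\<close> has constant sign, so a vanishing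
    integral forces it to vanish there almost everywhere.\<close>
  define P where "P = {w \<in> space M. 0 < Y w}"
  define N where "N = {w \<in> space M. Y w < 0}"
  have PN: "P \<in> sets M" "N \<in> sets M" unfolding P_def N_def by measurable
  have "AE w in M. Y w * indicator P w = 0"
    using all[OF PN(1)] integral_nonneg_eq_0_iff_AE[OF Yind[OF PN(1)]] by (auto simp: P_def indicator_def)
  moreover have "AE w in M. - (Y w * indicator N w) = 0"
    using all[OF PN(2)] integral_nonneg_eq_0_iff_AE[of M "\<lambda>w. - (Y w * indicator N w)"] Yind[OF PN(2)]
    by (auto simp: N_def indicator_def)
  ultimately show ?thesis
    by (rule AE_mp[OF _ AE_mp]) (intro AE_I2, auto simp: P_def N_def indicator_def split: if_splits)
qed

end

section \<open>Gaussian random variables in the first chaos\<close>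

text \<open>A weak form of the Cauchy-Schwarz inequality: the right-hand side tends to 0 with the
  norm of \<open>U\<close> while \<open>Z\<close> stays fixed, as the limit arguments
  require.\<close>

lemma abs_integral_mult_le:
  fixes U Z :: "'a \<Rightarrow> real"
  assumes U[measurable]: "U \<in> borel_measurable M" "integrable M (\<lambda>x. (U x)\<^sup>2)"
    and Z[measurable]: "Z \<in> borel_measurable M" "integrable M (\<lambda>x. (Z x)\<^sup>2)"
  shows "(LINT x|M. \<bar>U x * Z x\<bar>) \<le> sqrt (LINT x|M. (U x)\<^sup>2) * (1 + (LINT x|M. (Z x)\<^sup>2))"
proof -
  define A where "A = (LINT x|M. (U x)\<^sup>2)"
  have A0: "0 \<le> A" unfolding A_def by (intro integral_nonneg_AE) auto
  have UZ: "integrable M (\<lambda>x. U x * Z x)" using U Z by (intro integrable_mult_of_squares)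
  show ?thesis
  proof (cases "A = 0")
    case True
    then have "AE x in M. (U x)\<^sup>2 = 0"
      using integral_nonneg_eq_0_iff_AE[OF U(2)] by (simp add: A_def)
    then have "AE x in M. \<bar>U x * Z x\<bar> = 0" by eventually_elim simp
    then have "(LINT x|M. \<bar>U x * Z x\<bar>) = 0" by (rule integral_eq_zero_AE)
    then show ?thesis using True by (simp add: A_def)
  next
    case False
    \<comment> \<open>Scaling \<open>U\<close> by its norm a balances the two squares, since A / a =
      a.\<close>
    define a where "a = sqrt A"
    have a: "0 < a" "a * a = A" using A0 False by (auto simp: a_def)
    have le: "\<bar>U x * Z x\<bar> \<le> (U x)\<^sup>2 / a + a * (Z x)\<^sup>2" for x
    proof -
      have "\<bar>U x / a\<bar> * \<bar>Z x\<bar> \<le> (U x / a)\<^sup>2 + (Z x)\<^sup>2" by (rule abs_mult_le_squares)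
      then have "a * (\<bar>U x / a\<bar> * \<bar>Z x\<bar>) \<le> a * ((U x / a)\<^sup>2 + (Z x)\<^sup>2)"
        using a by (intro mult_left_mono) auto
      moreover have "a * (\<bar>U x / a\<bar> * \<bar>Z x\<bar>) = \<bar>U x * Z x\<bar>"
        using a(1) by (simp add: abs_mult)
      moreover have "a * ((U x / a)\<^sup>2 + (Z x)\<^sup>2) = (U x)\<^sup>2 / a + a * (Z x)\<^sup>2"
        using a(1) by (simp add: power2_eq_square field_simps)
      ultimately show ?thesis by simp
    qed
    have "(LINT x|M. \<bar>U x * Z x\<bar>) \<le> (LINT x|M. (U x)\<^sup>2 / a + a * (Z x)\<^sup>2)"
      using U(2) Z(2) UZ le by (intro integral_mono integrable_abs) auto
    also have "\<dots> = A / a + a * (LINT x|M. (Z x)\<^sup>2)"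
      using U(2) Z(2) by (simp add: A_def)
    also have "A / a = a" using a by (simp add: a(2)[symmetric])
    finally show ?thesis unfolding A_def[symmetric] a_def[symmetric] by (simp add: distrib_left)
  qed
qed

lemma norm_iexp_diff_le: "norm (iexp x - iexp y) \<le> \<bar>x - y\<bar>"
proof -
  have "iexp x - iexp y = iexp y * (iexp (x - y) - 1)"
    by (simp add: right_diff_distrib flip: exp_add)
  then have "norm (iexp x - iexp y) = norm (iexp (x - y) - 1)"
    by (simp add: norm_mult)
  also have "\<dots> \<le> \<bar>x - y\<bar>"
    using iexp_approx1[of "x - y" 0] by simp
  finally show ?thesis .
qed

lemma square_add_le: "(x + y)\<^sup>2 \<le> 2 * x\<^sup>2 + 2 * (y::real)\<^sup>2"
  using sum_squares_bound[of x y] by (simp add: power2_sum)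

lemma integrable_square_add:
  fixes U V :: "'a \<Rightarrow> real"
  assumes [measurable]: "U \<in> borel_measurable M" "V \<in> borel_measurable M"
    and "integrable M (\<lambda>x. (U x)\<^sup>2)" "integrable M (\<lambda>x. (V x)\<^sup>2)"
  shows "integrable M (\<lambda>x. (U x + V x)\<^sup>2)"
  by (rule Bochner_Integration.integrable_bound[where f = "\<lambda>x. 2 * (U x)\<^sup>2 + 2 * (V x)\<^sup>2"])
    (use assms square_add_le in auto)

context white_noise
begin

definition xi_sum :: "(nat \<Rightarrow> real) \<Rightarrow> nat \<Rightarrow> 'w \<Rightarrow> real" where
  "xi_sum b m w = (\<Sum>k<m. b k * \<xi> k w)"

abbreviation L2_err :: "('w \<Rightarrow> real) \<Rightarrow> (nat \<Rightarrow> real) \<Rightarrow> nat \<Rightarrow> real" where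
  "L2_err Y b m \<equiv> LINT w|M. (Y w - xi_sum b m w)\<^sup>2"

lemma measurable_xi_sum[measurable]: "xi_sum b m \<in> borel_measurable M"
  unfolding xi_sum_def[abs_def] by measurable

lemma xi_finite_sum:
  assumes "finite K"
  shows "integrable M (\<lambda>w. (\<Sum>k\<in>K. b k * \<xi> k w)\<^sup>2)"
    "(LINT w|M. (\<Sum>k\<in>K. b k * \<xi> k w)\<^sup>2) = (\<Sum>k\<in>K. (b k)\<^sup>2)"
proof -
  have eq: "(\<Sum>k\<in>K. b k * \<xi> k w)\<^sup>2 = (\<Sum>j\<in>K. \<Sum>k\<in>K. b j * b k * (\<xi> j w * \<xi> k w))" for w
    by (simp add: power2_eq_square sum_product mult_ac)
  have i: "integrable M (\<lambda>w. \<xi> j w * \<xi> k w)" for j k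
    by (intro integrable_mult_of_squares xi_L2) auto
  show "integrable M (\<lambda>w. (\<Sum>k\<in>K. b k * \<xi> k w)\<^sup>2)"
    unfolding eq using i by simp
  have "(LINT w|M. (\<Sum>k\<in>K. b k * \<xi> k w)\<^sup>2) = (\<Sum>j\<in>K. \<Sum>k\<in>K. b j * b k * (if j = k then 1 else 0))"
    unfolding eq using i by (simp add: xi_orthonormal)
  also have "\<dots> = (\<Sum>k\<in>K. (b k)\<^sup>2)"
    using assms by (intro sum.cong refl) (simp add: if_distrib power2_eq_square cong: if_cong)
  finally show "(LINT w|M. (\<Sum>k\<in>K. b k * \<xi> k w)\<^sup>2) = (\<Sum>k\<in>K. (b k)\<^sup>2)" .
qed

lemma xi_sum_L2: "integrable M (\<lambda>w. (xi_sum b m w)\<^sup>2)"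
  unfolding xi_sum_def by (rule xi_finite_sum) simp

lemma xi_sum_diff:
  "integrable M (\<lambda>w. (xi_sum b n w - xi_sum b m w)\<^sup>2)"
  "(LINT w|M. (xi_sum b n w - xi_sum b m w)\<^sup>2) = (\<Sum>k\<in>{min m n..<max m n}. (b k)\<^sup>2)"
proof -
  have main: "(xi_sum b n w - xi_sum b m w)\<^sup>2 = (\<Sum>k\<in>{min m n..<max m n}. b k * \<xi> k w)\<^sup>2" for w
  proof -
    have "xi_sum b n w - xi_sum b m w = (\<Sum>k\<in>{m..<n}. b k * \<xi> k w)" if "m \<le> n" for m n
      using sum_diff[of "{..<n}" "{..<m}" "\<lambda>k. b k * \<xi> k w"] that
      by (simp add: xi_sum_def lessThan_minus_lessThan)
    from this[of m n] this[of n m] show ?thesis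
      by (cases "m \<le> n") (auto simp: min_def max_def power2_commute)
  qed
  show "integrable M (\<lambda>w. (xi_sum b n w - xi_sum b m w)\<^sup>2)"
    "(LINT w|M. (xi_sum b n w - xi_sum b m w)\<^sup>2) = (\<Sum>k\<in>{min m n..<max m n}. (b k)\<^sup>2)"
    unfolding main using xi_finite_sum by auto
qed

definition first_chaos_rv :: "('w \<Rightarrow> real) \<Rightarrow> (nat \<Rightarrow> real) \<Rightarrow> bool" where
  "first_chaos_rv Y b \<longleftrightarrow> L2_rv M Y \<and> (\<lambda>m. L2_err Y b m) \<longlonglongrightarrow> 0"

lemma L2_rv_diff_xi_sum:
  assumes "L2_rv M Y"
  shows "(\<lambda>w. Y w - xi_sum b m w) \<in> borel_measurable M" "integrable M (\<lambda>w. (Y w - xi_sum b m w)\<^sup>2)"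
proof -
  have [measurable]: "Y \<in> borel_measurable M" using assms by (simp add: L2_rv_def)
  show "(\<lambda>w. Y w - xi_sum b m w) \<in> borel_measurable M" by measurable
  show "integrable M (\<lambda>w. (Y w - xi_sum b m w)\<^sup>2)"
    using integrable_square_add[of Y M "\<lambda>w. - xi_sum b m w"] assms xi_sum_L2 by (simp add: L2_rv_def)
qed

text \<open>Convergence in L^2 passes to the inner product with a fixed \<open>Z\<close>. With
  \<open>Z\<close> a Wick-Hermite product this computes all chaos coefficients of
  \<open>Y\<close>.\<close>

lemma first_chaos_rv_expectation:
  assumes Y: "first_chaos_rv Y b" and Z[measurable]: "Z \<in> borel_measurable M" and Z2: "integrable M (\<lambda>w. (Z w)\<^sup>2)"
  shows "(\<lambda>m. \<Sum>k<m. b k * (LINT w|M. \<xi> k w * Z w)) \<longlonglongrightarrow> (LINT w|M. Y w * Z w)"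
proof -
  have L2: "L2_rv M Y" and lim: "(\<lambda>m. L2_err Y b m) \<longlonglongrightarrow> 0"
    using Y by (auto simp: first_chaos_rv_def)
  have [measurable]: "Y \<in> borel_measurable M" using L2 by (simp add: L2_rv_def)
  have xz: "integrable M (\<lambda>w. \<xi> k w * Z w)" for k
    using Z2 xi_L2 by (intro integrable_mult_of_squares) auto
  have yz: "integrable M (\<lambda>w. Y w * Z w)"
    using Z2 L2 by (intro integrable_mult_of_squares) (auto simp: L2_rv_def)
  have S: "xi_sum b m w * Z w = (\<Sum>k<m. b k * (\<xi> k w * Z w))" for m w
    unfolding xi_sum_def sum_distrib_right by (simp add: mult_ac)
  have ES: "(LINT w|M. xi_sum b m w * Z w) = (\<Sum>k<m. b k * (LINT w|M. \<xi> k w * Z w))" for m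
    unfolding S using xz by simp
  have Sz: "integrable M (\<lambda>w. xi_sum b m w * Z w)" for m
    unfolding S using xz by simp
  have "norm ((\<Sum>k<m. b k * (LINT w|M. \<xi> k w * Z w)) - (LINT w|M. Y w * Z w))
     \<le> sqrt (L2_err Y b m) * (1 + (LINT w|M. (Z w)\<^sup>2))" for m
  proof -
    have "(LINT w|M. Y w * Z w) - (\<Sum>k<m. b k * (LINT w|M. \<xi> k w * Z w)) = (LINT w|M. (Y w - xi_sum b m w) * Z w)"
      unfolding ES[symmetric] using yz Sz by (simp add: left_diff_distrib)
    moreover have "norm (x - y) = \<bar>y - x\<bar>" for x y :: real by (simp add: abs_minus_commute)
    ultimately have "norm ((\<Sum>k<m. b k * (LINT w|M. \<xi> k w * Z w)) - (LINT w|M. Y w * Z w)) = \<bar>LINT w|M. (Y w - xi_sum b m w) * Z w\<bar>"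
      by (simp only:)
    also have "\<dots> \<le> (LINT w|M. \<bar>(Y w - xi_sum b m w) * Z w\<bar>)" by (rule integral_abs_bound)
    also have "\<dots> \<le> sqrt (L2_err Y b m) * (1 + (LINT w|M. (Z w)\<^sup>2))"
      by (rule abs_integral_mult_le[OF L2_rv_diff_xi_sum[OF L2] Z Z2])
    finally show ?thesis .
  qed
  moreover have "(\<lambda>m. sqrt (L2_err Y b m) * (1 + (LINT w|M. (Z w)\<^sup>2))) \<longlonglongrightarrow> 0"
    using tendsto_mult_left_zero[OF tendsto_real_sqrt[OF lim, unfolded real_sqrt_zero]] .
  ultimately have "(\<lambda>m. (\<Sum>k<m. b k * (LINT w|M. \<xi> k w * Z w)) - (LINT w|M. Y w * Z w)) \<longlonglongrightarrow> 0"
    by (rule Lim_null_comparison[OF always_eventually[OF allI]])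
  then show ?thesis by (rule LIM_zero_cancel)
qed

lemma first_chaos_rv_chaos_of:
  assumes "first_chaos_rv Y b" shows "chaos_of M \<xi> Y = first_chaos b"
proof -
  have lim: "(\<lambda>m. \<Sum>k<m. b k * (if \<alpha> = unit_index k then 1 else 0)) \<longlonglongrightarrow> (LINT w|M. Y w * wick_hermite \<xi> \<alpha> w)"
    if "\<alpha> \<in> MI" for \<alpha>
    using first_chaos_rv_expectation[OF assms wick_hermite_L2[OF that]] integral_xi_wick_hermite[OF that] by simp
  show ?thesis
  proof (rule first_chaos_eqI)
    fix j
    have "eventually (\<lambda>m. (\<Sum>k<m. b k * (if unit_index j = unit_index k then 1 else 0)) = b j) sequentially"
      using eventually_gt_at_top[of j]
      by eventually_elim (simp add: unit_index_inject if_distrib cong: if_cong)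
    then have "(\<lambda>m. \<Sum>k<m. b k * (if unit_index j = unit_index k then 1 else 0)) \<longlonglongrightarrow> b j"
      by (rule tendsto_eventually)
    with lim[OF unit_index_in_MI, of j] have "(LINT w|M. Y w * wick_hermite \<xi> (unit_index j) w) = b j"
      by (rule LIMSEQ_unique)
    then show "chaos_of M \<xi> Y (unit_index j) = b j"
      by (simp add: chaos_of_def unit_index_in_MI mfact_unit_index)
  next
    fix \<alpha> assume a: "\<alpha> \<notin> range unit_index"
    have "(LINT w|M. Y w * wick_hermite \<xi> \<alpha> w) = 0" if "\<alpha> \<in> MI"
    proof (rule LIMSEQ_unique[OF lim[OF that]])
      have "(\<Sum>k<m. b k * (if \<alpha> = unit_index k then 1 else 0)) = 0" for m
        using a by (intro sum.neutral) auto
      then show "(\<lambda>m. \<Sum>k<m. b k * (if \<alpha> = unit_index k then 1 else 0)) \<longlonglongrightarrow> 0" by simp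
    qed
    then show "chaos_of M \<xi> Y \<alpha> = 0" by (simp add: chaos_of_def)
  qed
qed

lemma chaos_of_first_chaos_summable:
  assumes "L2_rv M Y" "chaos_of M \<xi> Y = first_chaos b"
  shows "summable (\<lambda>k. (b k)\<^sup>2)"
proof -
  have "(LINT w|M. Y w * \<xi> k w) = b k" for k
    using fun_cong[OF assms(2), of "unit_index k"]
    by (simp add: chaos_of_def unit_index_in_MI mfact_unit_index first_chaos_unit_index xi_eq_wick_hermite)
  moreover have "(\<Sum>k<n. (LINT w|M. Y w * \<xi> k w)\<^sup>2) \<le> (LINT w|M. (Y w)\<^sup>2)" for n
    by (rule bessel_inequality) (use assms(1) xi_L2 xi_orthonormal in \<open>auto simp: L2_rv_def\<close>)
  ultimately have "(\<Sum>k<n. (b k)\<^sup>2) \<le> (LINT w|M. (Y w)\<^sup>2)" for n by simp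
  then show ?thesis by (intro summableI_nonneg_bounded) auto
qed

lemma first_chaos_rv_add:
  assumes "first_chaos_rv Y b" "first_chaos_rv Z c"
  shows "first_chaos_rv (\<lambda>w. Y w + Z w) (\<lambda>k. b k + c k)"
proof -
  have L: "L2_rv M Y" "L2_rv M Z" using assms by (auto simp: first_chaos_rv_def)
  have [measurable]: "Y \<in> borel_measurable M" "Z \<in> borel_measurable M" using L by (auto simp: L2_rv_def)
  have L': "L2_rv M (\<lambda>w. Y w + Z w)"
    using L integrable_square_add[of Y M Z] by (simp add: L2_rv_def)
  have le: "(LINT w|M. (Y w + Z w - xi_sum (\<lambda>k. b k + c k) m w)\<^sup>2)
     \<le> 2 * (L2_err Y b m) + 2 * (L2_err Z c m)" for m
  proof -
    have "(Y w + Z w - xi_sum (\<lambda>k. b k + c k) m w)\<^sup>2 \<le> 2 * (Y w - xi_sum b m w)\<^sup>2 + 2 * (Z w - xi_sum c m w)\<^sup>2" for w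
      using square_add_le[of "Y w - xi_sum b m w" "Z w - xi_sum c m w"]
      by (simp add: xi_sum_def distrib_right sum.distrib algebra_simps)
    then have "(LINT w|M. (Y w + Z w - xi_sum (\<lambda>k. b k + c k) m w)\<^sup>2)
       \<le> (LINT w|M. 2 * (Y w - xi_sum b m w)\<^sup>2 + 2 * (Z w - xi_sum c m w)\<^sup>2)"
      using L2_rv_diff_xi_sum(2)[OF L'] L2_rv_diff_xi_sum(2)[OF L(1)] L2_rv_diff_xi_sum(2)[OF L(2)]
      by (intro integral_mono) auto
    then show ?thesis using L2_rv_diff_xi_sum(2)[OF L(1)] L2_rv_diff_xi_sum(2)[OF L(2)] by simp
  qed
  have "(\<lambda>m. 2 * (L2_err Y b m) + 2 * (L2_err Z c m)) \<longlonglongrightarrow> 2 * 0 + 2 * 0"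
    using assms by (intro tendsto_intros) (auto simp: first_chaos_rv_def)
  then have lim: "(\<lambda>m. 2 * (L2_err Y b m) + 2 * (L2_err Z c m)) \<longlonglongrightarrow> 0"
    by (simp only: mult_zero_right add_0)
  have "0 \<le> (LINT w|M. (Y w + Z w - xi_sum (\<lambda>k. b k + c k) m w)\<^sup>2)" for m
    by (intro integral_nonneg_AE) auto
  then have "norm (LINT w|M. (Y w + Z w - xi_sum (\<lambda>k. b k + c k) m w)\<^sup>2)
       \<le> 2 * (L2_err Y b m) + 2 * (L2_err Z c m)" for m
    using le[of m] by (simp only: real_norm_def abs_of_nonneg)
  then have "(\<lambda>m. LINT w|M. (Y w + Z w - xi_sum (\<lambda>k. b k + c k) m w)\<^sup>2) \<longlonglongrightarrow> 0"
    by (rule Lim_null_comparison[OF always_eventually[OF allI] lim])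
  then show ?thesis using L' by (simp add: first_chaos_rv_def)
qed

lemma first_chaos_rv_scale:
  assumes "first_chaos_rv Y b"
  shows "first_chaos_rv (\<lambda>w. r * Y w) (\<lambda>k. r * b k)"
proof -
  have "(r * Y w - xi_sum (\<lambda>k. r * b k) m w)\<^sup>2 = r\<^sup>2 * (Y w - xi_sum b m w)\<^sup>2" for m w
  proof -
    have "r * Y w - xi_sum (\<lambda>k. r * b k) m w = r * (Y w - xi_sum b m w)"
      by (simp add: xi_sum_def right_diff_distrib sum_distrib_left mult_ac)
    then show ?thesis by (simp add: power_mult_distrib)
  qed
  moreover have "(\<lambda>m. r\<^sup>2 * L2_err Y b m) \<longlonglongrightarrow> r\<^sup>2 * 0"
    using assms by (intro tendsto_intros) (auto simp: first_chaos_rv_def)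
  moreover have [measurable]: "Y \<in> borel_measurable M" using assms by (simp add: first_chaos_rv_def L2_rv_def)
  moreover have "(\<lambda>w. r * Y w) \<in> borel_measurable M" by measurable
  ultimately show ?thesis using assms by (simp add: first_chaos_rv_def L2_rv_def power_mult_distrib)
qed

lemma first_chaos_rv_sum:
  assumes "finite S" "\<And>t. t \<in> S \<Longrightarrow> first_chaos_rv (X t) (a t)"
  shows "first_chaos_rv (\<lambda>w. \<Sum>t\<in>S. c t * X t w) (\<lambda>k. \<Sum>t\<in>S. c t * a t k)"
  using assms
proof (induction S rule: finite_induct)
  case empty
  then show ?case by (simp add: first_chaos_rv_def L2_rv_def xi_sum_def)
next
  case (insert t S)
  then show ?case using first_chaos_rv_add[OF first_chaos_rv_scale] by simp
qed

lemma expectation_iexp_xi: "(LINT w|M. iexp (c * \<xi> k w)) = exp (- (c\<^sup>2) / 2)"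
proof -
  have "distr M borel (\<xi> k) = distr M lborel (\<xi> k)" by (rule distr_cong) auto
  also have "\<dots> = std_normal_distribution" using dist[of k] by (simp add: distributed_def)
  finally have "char (distr M borel (\<xi> k)) c = exp (- (c\<^sup>2) / 2)"
    by (simp add: char_std_normal_distribution)
  then show ?thesis unfolding char_def by (subst (asm) integral_distr) auto
qed

text \<open>For partial sums the function factorises by independence. In the limit, z -> e^{iuz} is
  |u|-Lipschitz, and the L^1 error is at most twice the L^2 norm of the error, the 2 being 1 plus
  the total mass.\<close>

lemma first_chaos_rv_char:
  assumes Y: "first_chaos_rv Y b"
  shows "(LINT w|M. iexp (u * Y w)) = exp (- (u\<^sup>2 * (\<Sum>k. (b k)\<^sup>2)) / 2)"
proof (rule LIMSEQ_unique)
  have L2: "L2_rv M Y" and lim: "(\<lambda>m. L2_err Y b m) \<longlonglongrightarrow> 0"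
    using Y by (auto simp: first_chaos_rv_def)
  have [measurable]: "Y \<in> borel_measurable M" using L2 by (simp add: L2_rv_def)
  have summ: "summable (\<lambda>k. (b k)\<^sup>2)"
    using chaos_of_first_chaos_summable[OF L2 first_chaos_rv_chaos_of[OF Y]] .
  have S: "(LINT w|M. iexp (u * xi_sum b m w)) = exp (- (u\<^sup>2 * (\<Sum>k<m. (b k)\<^sup>2)) / 2)" for m
  proof -
    have int: "integrable M (\<lambda>w. iexp (u * b k * \<xi> k w))" for k
      by (rule integrable_const_bound[where B = 1]) auto
    have "iexp (u * xi_sum b m w) = (\<Prod>k<m. iexp (u * b k * \<xi> k w))" for w
      by (simp add: xi_sum_def sum_distrib_left mult_ac flip: exp_sum)
    then have "(LINT w|M. iexp (u * xi_sum b m w)) = (\<Prod>k<m. LINT w|M. iexp (u * b k * \<xi> k w))"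
      using prod_xi(2)[of "{..<m}" "\<lambda>k x. iexp (u * b k * x)"] int by simp
    also have "\<dots> = (\<Prod>k<m. complex_of_real (exp (- ((u * b k)\<^sup>2) / 2)))"
      unfolding expectation_iexp_xi ..
    also have "\<dots> = complex_of_real (exp (\<Sum>k<m. - ((u * b k)\<^sup>2) / 2))"
      by (simp only: exp_sum[OF finite_lessThan] of_real_prod)
    also have "(\<Sum>k<m. - ((u * b k)\<^sup>2) / 2) = - (u\<^sup>2 * (\<Sum>k<m. (b k)\<^sup>2)) / 2"
      by (simp add: power_mult_distrib sum_distrib_left sum_negf sum_divide_distrib)
    finally show ?thesis by simp
  qed
  have "(\<lambda>m. complex_of_real (exp (- (u\<^sup>2 * (\<Sum>k<m. (b k)\<^sup>2)) / 2))) \<longlonglongrightarrow> complex_of_real (exp (- (u\<^sup>2 * (\<Sum>k. (b k)\<^sup>2)) / 2))"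
    using summable_LIMSEQ[OF summ] by (intro tendsto_intros) auto
  then show "(\<lambda>m. LINT w|M. iexp (u * xi_sum b m w)) \<longlonglongrightarrow> exp (- (u\<^sup>2 * (\<Sum>k. (b k)\<^sup>2)) / 2)"
    unfolding S by simp
  have ii: "integrable M (\<lambda>w. iexp (u * Z w))" if [measurable]: "Z \<in> borel_measurable M" for Z
    by (rule integrable_const_bound[where B = 1]) auto
  have "norm ((LINT w|M. iexp (u * xi_sum b m w)) - (LINT w|M. iexp (u * Y w)))
     \<le> \<bar>u\<bar> * (sqrt (L2_err Y b m) * 2)" for m
  proof -
    have d: "integrable M (\<lambda>w. \<bar>Y w - xi_sum b m w\<bar>)"
      using integrable_mult_of_squares[OF L2_rv_diff_xi_sum(1)[OF L2], of "\<lambda>_. 1" b m] L2_rv_diff_xi_sum(2)[OF L2, of b m]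
      by simp
    have "norm ((LINT w|M. iexp (u * xi_sum b m w)) - (LINT w|M. iexp (u * Y w)))
        = norm (LINT w|M. iexp (u * xi_sum b m w) - iexp (u * Y w))"
      by (subst Bochner_Integration.integral_diff[OF ii ii]) auto
    also have "\<dots> \<le> (LINT w|M. \<bar>u\<bar> * \<bar>Y w - xi_sum b m w\<bar>)"
    proof (rule order_trans[OF integral_norm_bound integral_mono])
      show "integrable M (\<lambda>w. norm (iexp (u * xi_sum b m w) - iexp (u * Y w)))"
        by (rule integrable_norm, rule Bochner_Integration.integrable_diff; rule ii; measurable)
      show "integrable M (\<lambda>w. \<bar>u\<bar> * \<bar>Y w - xi_sum b m w\<bar>)" using d by simp
      fix w
      have "norm (iexp (u * xi_sum b m w) - iexp (u * Y w)) \<le> \<bar>u * xi_sum b m w - u * Y w\<bar>"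
        by (rule norm_iexp_diff_le)
      also have "\<dots> = \<bar>u\<bar> * \<bar>Y w - xi_sum b m w\<bar>"
        by (simp only: right_diff_distrib[symmetric] abs_mult abs_minus_commute)
      finally show "norm (iexp (u * xi_sum b m w) - iexp (u * Y w)) \<le> \<bar>u\<bar> * \<bar>Y w - xi_sum b m w\<bar>" .
    qed
    also have "\<dots> = \<bar>u\<bar> * (LINT w|M. \<bar>(Y w - xi_sum b m w) * 1\<bar>)" by simp
    also have "\<dots> \<le> \<bar>u\<bar> * (sqrt (L2_err Y b m) * (1 + (LINT w|M. 1\<^sup>2)))"
      by (intro mult_left_mono abs_integral_mult_le L2_rv_diff_xi_sum L2) auto
    finally show ?thesis by (simp add: prob_space)
  qed
  moreover have "(\<lambda>m. \<bar>u\<bar> * (sqrt (L2_err Y b m) * 2)) \<longlonglongrightarrow> \<bar>u\<bar> * (sqrt 0 * 2)"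
    by (intro tendsto_intros lim)
  then have "(\<lambda>m. \<bar>u\<bar> * (sqrt (L2_err Y b m) * 2)) \<longlonglongrightarrow> 0"
    by (simp only: real_sqrt_zero mult_zero_left mult_zero_right)
  ultimately have "(\<lambda>m. (LINT w|M. iexp (u * xi_sum b m w)) - (LINT w|M. iexp (u * Y w))) \<longlonglongrightarrow> 0"
    by (rule Lim_null_comparison[OF always_eventually[OF allI]])
  then show "(\<lambda>m. LINT w|M. iexp (u * xi_sum b m w)) \<longlonglongrightarrow> (LINT w|M. iexp (u * Y w))"
    by (rule LIM_zero_cancel)
qed

lemma first_chaos_rv_centered_normal:
  assumes Y: "first_chaos_rv Y b"
  shows "centered_normal M Y (\<Sum>k. (b k)\<^sup>2)"
proof -
  define v where "v = (\<Sum>k. (b k)\<^sup>2)"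
  have L2: "L2_rv M Y" and lim: "(\<lambda>m. L2_err Y b m) \<longlonglongrightarrow> 0"
    using Y by (auto simp: first_chaos_rv_def)
  have [measurable]: "Y \<in> borel_measurable M" using L2 by (simp add: L2_rv_def)
  have summ: "summable (\<lambda>k. (b k)\<^sup>2)"
    using chaos_of_first_chaos_summable[OF L2 first_chaos_rv_chaos_of[OF Y]] .
  have v0: "0 \<le> v" unfolding v_def by (intro suminf_nonneg summ) auto
  show ?thesis
  proof (cases "v = 0")
    case True
    then have "b k = 0" for k
      using suminf_eq_zero_iff[OF summ] by (simp add: v_def)
    \<comment> \<open>With all coefficients zero the partial sums vanish, so the error is the
      constant second moment of \<open>Y\<close>.\<close>
    then have "(\<lambda>m::nat. LINT w|M. (Y w)\<^sup>2) \<longlonglongrightarrow> 0" using lim by (simp add: xi_sum_def)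
    then have "(LINT w|M. (Y w)\<^sup>2) = 0" by (simp add: LIMSEQ_const_iff)
    then have "AE w in M. (Y w)\<^sup>2 = 0"
      using L2 by (subst (asm) integral_nonneg_eq_0_iff_AE) (auto simp: L2_rv_def)
    then show ?thesis using True by (simp add: centered_normal_def v_def)
  next
    case False
    then have v: "0 < v" using v0 by simp
    \<comment> \<open>A scaled coordinate serves as reference normal variable of variance v; equal
      characteristic functions then identify the laws.\<close>
    let ?Z = "\<lambda>w. 0 + sqrt v * \<xi> 0 w"
    have Z: "distributed M lborel ?Z (normal_density 0 (sqrt v))"
      using normal_density_affine[OF dist[of 0], of "sqrt v" 0] v by simp
    have "distr M borel Y = distr M borel ?Z"
    proof (rule Levy_uniqueness)
      show "real_distribution (distr M borel Y)" "real_distribution (distr M borel ?Z)"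
        by (intro real_distribution_distr; measurable)+
      show "char (distr M borel Y) = char (distr M borel ?Z)"
      proof
        fix u
        have "char (distr M borel Y) u = (LINT w|M. iexp (u * Y w))"
          unfolding char_def by (subst integral_distr) auto
        also have "\<dots> = exp (- (u\<^sup>2 * v) / 2)"
          using first_chaos_rv_char[OF Y] by (simp add: v_def)
        also have "\<dots> = (LINT w|M. iexp (u * sqrt v * \<xi> 0 w))"
          unfolding expectation_iexp_xi using v by (simp add: power_mult_distrib)
        also have "\<dots> = char (distr M borel ?Z) u"
          unfolding char_def by (subst integral_distr) (auto simp: mult.assoc)
        finally show "char (distr M borel Y) u = char (distr M borel ?Z) u" .
      qed
    qed
    moreover have "distr M lborel W = distr M borel W" for W :: "'w \<Rightarrow> real"
      by (rule distr_cong) auto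
    ultimately have "distributed M lborel Y (normal_density 0 (sqrt v))"
      using Z by (simp add: distributed_def)
    then show ?thesis using v by (simp add: centered_normal_def v_def)
  qed
qed

end

section \<open>Existence and uniqueness of the Gaussian series\<close>

lemma AE_summable_of_summable_integrals:
  fixes D :: "nat \<Rightarrow> 'a \<Rightarrow> real"
  assumes int: "\<And>j. integrable M (D j)" and s: "summable (\<lambda>j. LINT x|M. \<bar>D j x\<bar>)"
  shows "AE x in M. summable (\<lambda>j. D j x)"
proof -
  have [measurable]: "D j \<in> borel_measurable M" for j using int by auto
  have "(\<integral>\<^sup>+ x. (\<Sum>j. ennreal \<bar>D j x\<bar>) \<partial>M) = (\<Sum>j. \<integral>\<^sup>+ x. ennreal \<bar>D j x\<bar> \<partial>M)"
    by (rule nn_integral_suminf) measurable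
  also have "\<dots> = (\<Sum>j. ennreal (LINT x|M. \<bar>D j x\<bar>))"
    using int by (intro suminf_cong nn_integral_eq_integral) auto
  also have "\<dots> = ennreal (\<Sum>j. LINT x|M. \<bar>D j x\<bar>)"
    using s by (intro suminf_ennreal2) (auto intro!: integral_nonneg_AE)
  finally have "(\<integral>\<^sup>+ x. (\<Sum>j. ennreal \<bar>D j x\<bar>) \<partial>M) \<noteq> \<infinity>" by simp
  then have "AE x in M. (\<Sum>j. ennreal \<bar>D j x\<bar>) \<noteq> \<infinity>"
    by (intro nn_integral_PInf_AE) auto
  then show ?thesis
  proof eventually_elim
    case (elim x)
    then have "summable (\<lambda>j. \<bar>D j x\<bar>)"
      by (intro summable_suminf_not_top) auto
    then show ?case by (rule summable_rabs_cancel)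
  qed
qed

context white_noise
begin

text \<open>The Riesz-Fischer argument: a fast subsequence of partial sums converges almost
  everywhere, and Fatou's lemma shows that the full sequence converges to the same limit in L^2 at
  the rate of the tail \<open>R\<close>.\<close>

lemma first_chaos_rv_exists:
  assumes summ: "summable (\<lambda>k. (b k)\<^sup>2)"
  shows "\<exists>X. first_chaos_rv X b"
proof -
  define R where "R m = (\<Sum>k. (b (k + m))\<^sup>2)" for m
  have R0: "0 \<le> R m" for m
    unfolding R_def using summ by (intro suminf_nonneg summable_ignore_initial_segment[of "\<lambda>k. (b k)\<^sup>2"]) auto
  have Rlim: "R \<longlonglongrightarrow> 0"
    unfolding R_def[abs_def] using suminf_exist_split2[OF summ] .
  have tail: "(\<Sum>k\<in>{m..<n}. (b k)\<^sup>2) \<le> R m" for m n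
  proof -
    have "(\<Sum>k\<in>{m..<n}. (b k)\<^sup>2) = (\<Sum>k<n - m. (b (k + m))\<^sup>2)"
      by (rule sum.reindex_bij_witness[of _ "\<lambda>k. k + m" "\<lambda>k. k - m"]) auto
    also have "\<dots> \<le> R m"
      unfolding R_def using summ
      by (intro sum_le_suminf summable_ignore_initial_segment[of "\<lambda>k. (b k)\<^sup>2"]) auto
    finally show ?thesis .
  qed
  have diff: "(LINT w|M. (xi_sum b n w - xi_sum b m w)\<^sup>2) \<le> R n + R m" for n m
  proof -
    have "(\<Sum>k\<in>{min m n..<max m n}. (b k)\<^sup>2) \<le> R (min m n)" by (rule tail)
    also have "\<dots> \<le> R n + R m" using R0[of n] R0[of m] by (auto simp: min_def)
    finally show ?thesis by (simp add: xi_sum_diff)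
  qed
  \<comment> \<open>Tails below 4^-j make the L^2 norms of successive increments geometric of ratio
    1/2, hence their L^1 norms summable.\<close>
  have "\<exists>n. R n \<le> (1/4) ^ j" for j :: nat
  proof -
    have "eventually (\<lambda>n. R n < (1/4) ^ j) sequentially"
      using Rlim by (rule order_tendstoD) simp
    then show ?thesis by (auto simp: eventually_sequentially intro: less_imp_le)
  qed
  then obtain N where N: "\<And>j. R (N j) \<le> (1/4) ^ j" by metis
  define D where "D j w = xi_sum b (N (Suc j)) w - xi_sum b (N j) w" for j w
  have Dm[measurable]: "D j \<in> borel_measurable M" for j unfolding D_def[abs_def] by measurable
  have D2: "integrable M (\<lambda>w. (D j w)\<^sup>2)" for j unfolding D_def by (rule xi_sum_diff)
  have Di: "integrable M (D j)" for j
    using integrable_mult_of_squares[OF Dm, of "\<lambda>_. 1"] D2 by simp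
  have D1: "(LINT w|M. \<bar>D j w\<bar>) \<le> 4 * (1/2) ^ j" for j
  proof -
    have "(LINT w|M. (D j w)\<^sup>2) \<le> R (N (Suc j)) + R (N j)" unfolding D_def by (rule diff)
    also have "\<dots> \<le> (1/4) ^ Suc j + (1/4) ^ j" by (intro add_mono N)
    also have "\<dots> \<le> 4 * (1/4) ^ j" by simp
    also have "\<dots> = (2 * (1/2) ^ j)\<^sup>2"
      by (simp add: power_mult_distrib power2_eq_square flip: power_mult_distrib)
    finally have "sqrt (LINT w|M. (D j w)\<^sup>2) \<le> 2 * (1/2) ^ j"
      by (intro real_le_lsqrt) (auto intro!: integral_nonneg_AE)
    moreover have "(LINT w|M. \<bar>D j w * 1\<bar>) \<le> sqrt (LINT w|M. (D j w)\<^sup>2) * (1 + (LINT w|M. 1\<^sup>2))"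
      by (rule abs_integral_mult_le[OF Dm D2]) auto
    ultimately show ?thesis by (simp add: prob_space)
  qed
  have "summable (\<lambda>j. LINT w|M. \<bar>D j w\<bar>)"
  proof (rule summable_comparison_test_ev[OF always_eventually[OF allI]])
    show "norm (LINT w|M. \<bar>D j w\<bar>) \<le> 4 * (1/2) ^ j" for j
      using D1[of j] by (simp add: integral_nonneg_AE)
    show "summable (\<lambda>j. 4 * (1/2::real) ^ j)" by (intro summable_mult summable_geometric) simp
  qed
  then have "AE w in M. summable (\<lambda>j. D j w)"
    by (rule AE_summable_of_summable_integrals[OF Di])
  then have conv: "AE w in M. convergent (\<lambda>j. xi_sum b (N j) w)"
  proof eventually_elim
    case (elim w)
    have "(\<lambda>j. xi_sum b (N 0) w + (\<Sum>i<j. D i w)) \<longlonglongrightarrow> xi_sum b (N 0) w + (\<Sum>i. D i w)"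
      by (intro tendsto_intros summable_LIMSEQ elim)
    moreover have "xi_sum b (N 0) w + (\<Sum>i<j. D i w) = xi_sum b (N j) w" for j
      unfolding D_def by (subst sum_lessThan_telescope) simp
    ultimately show ?case unfolding convergent_def by auto
  qed
  \<comment> \<open>\<open>lim\<close> gives a measurable function everywhere; its value matters
    only where the subsequence converges.\<close>
  define X where "X w = lim (\<lambda>j. xi_sum b (N j) w)" for w
  have X[measurable]: "X \<in> borel_measurable M" unfolding X_def[abs_def] by measurable
  have XS: "(\<integral>\<^sup>+ w. ennreal ((X w - xi_sum b m w)\<^sup>2) \<partial>M) \<le> ennreal (R m)" for m
  proof -
    have "(\<integral>\<^sup>+ w. ennreal ((X w - xi_sum b m w)\<^sup>2) \<partial>M)
       = (\<integral>\<^sup>+ w. liminf (\<lambda>j. ennreal ((xi_sum b (N j) w - xi_sum b m w)\<^sup>2)) \<partial>M)"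
    proof (rule nn_integral_cong_AE, use conv in eventually_elim)
      fix w assume "convergent (\<lambda>j. xi_sum b (N j) w)"
      then have "(\<lambda>j. xi_sum b (N j) w) \<longlonglongrightarrow> X w" unfolding X_def by (simp add: convergent_LIMSEQ_iff)
      then have "(\<lambda>j. ennreal ((xi_sum b (N j) w - xi_sum b m w)\<^sup>2)) \<longlonglongrightarrow> ennreal ((X w - xi_sum b m w)\<^sup>2)"
        by (intro tendsto_intros)
      then show "ennreal ((X w - xi_sum b m w)\<^sup>2) = liminf (\<lambda>j. ennreal ((xi_sum b (N j) w - xi_sum b m w)\<^sup>2))"
        by (intro lim_imp_Liminf[symmetric]) auto
    qed
    also have "\<dots> \<le> liminf (\<lambda>j. \<integral>\<^sup>+ w. ennreal ((xi_sum b (N j) w - xi_sum b m w)\<^sup>2) \<partial>M)"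
      by (rule nn_integral_liminf) measurable
    also have "\<dots> \<le> liminf (\<lambda>j. ennreal ((1/4) ^ j + R m))"
    proof (rule Liminf_mono, rule always_eventually, rule allI)
      fix j
      have "(\<integral>\<^sup>+ w. ennreal ((xi_sum b (N j) w - xi_sum b m w)\<^sup>2) \<partial>M)
          = ennreal (LINT w|M. (xi_sum b (N j) w - xi_sum b m w)\<^sup>2)"
        by (rule nn_integral_eq_integral[OF xi_sum_diff(1)]) auto
      also have "\<dots> \<le> ennreal ((1/4) ^ j + R m)"
        using diff[of "N j" m] N[of j] by (intro ennreal_leI) simp
      finally show "(\<integral>\<^sup>+ w. ennreal ((xi_sum b (N j) w - xi_sum b m w)\<^sup>2) \<partial>M) \<le> ennreal ((1/4) ^ j + R m)" .
    qed
    also have "\<dots> = ennreal (R m)"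
    proof (rule lim_imp_Liminf)
      have "(\<lambda>j. (1/4::real) ^ j + R m) \<longlonglongrightarrow> 0 + R m"
        by (intro tendsto_intros LIMSEQ_power_zero) auto
      then have "(\<lambda>j. ennreal ((1/4) ^ j + R m)) \<longlonglongrightarrow> ennreal (0 + R m)" by (rule tendsto_ennrealI)
      then show "(\<lambda>j. ennreal ((1/4) ^ j + R m)) \<longlonglongrightarrow> ennreal (R m)" by simp
    qed simp
    finally show ?thesis .
  qed
  have XSi: "integrable M (\<lambda>w. (X w - xi_sum b m w)\<^sup>2)" for m
    by (rule integrableI_bounded) (use XS[of m] in \<open>auto simp: ennreal_power[symmetric] intro: le_less_trans\<close>)
  have XSle: "(L2_err X b m) \<le> R m" for m
    using XS[of m] R0[of m] by (subst (asm) nn_integral_eq_integral[OF XSi]) auto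
  have "L2_rv M X"
    using XSi[of 0] by (simp add: L2_rv_def xi_sum_def)
  moreover have "(\<lambda>m. L2_err X b m) \<longlonglongrightarrow> 0"
  proof (rule Lim_null_comparison[OF always_eventually[OF allI] Rlim])
    have "0 \<le> (L2_err X b m)" for m
      by (intro integral_nonneg_AE) auto
    then show "norm (L2_err X b m) \<le> R m" for m
      using XSle[of m] by (simp only: real_norm_def abs_of_nonneg)
  qed
  ultimately show ?thesis unfolding first_chaos_rv_def by blast
qed

text \<open>By completeness of the Wick--Hermite system an \<open>L\<^sup>2\<close> variable with first-order chaos
  coefficients is almost surely the Gaussian series.\<close>

lemma chaos_of_first_chaos_imp_rv:
  assumes L2: "L2_rv M X" and ch: "chaos_of M \<xi> X = first_chaos b"
  shows "first_chaos_rv X b"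
proof -
  obtain X' where X': "first_chaos_rv X' b"
    using first_chaos_rv_exists[OF chaos_of_first_chaos_summable[OF assms]] by blast
  then have L2': "L2_rv M X'" by (simp add: first_chaos_rv_def)
  have [measurable]: "X \<in> borel_measurable M" "X' \<in> borel_measurable M" using L2 L2' by (auto simp: L2_rv_def)
  have "AE w in M. X w - X' w = 0"
  proof (rule zero_chaos_imp_AE_zero)
    show "integrable M (\<lambda>w. (X w - X' w)\<^sup>2)"
      using integrable_square_add[of X M "\<lambda>w. - X' w"] L2 L2' by (simp add: L2_rv_def)
    fix \<alpha> assume a: "\<alpha> \<in> MI"
    have "chaos_of M \<xi> X \<alpha> = chaos_of M \<xi> X' \<alpha>"
      using ch first_chaos_rv_chaos_of[OF X'] by simp
    then have "(LINT w|M. X w * wick_hermite \<xi> \<alpha> w) = (LINT w|M. X' w * wick_hermite \<xi> \<alpha> w)"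
      using a mfact_pos[of \<alpha>] by (simp add: chaos_of_def)
    moreover have "integrable M (\<lambda>w. X w * wick_hermite \<xi> \<alpha> w)" "integrable M (\<lambda>w. X' w * wick_hermite \<xi> \<alpha> w)"
      using L2 L2' wick_hermite_L2[OF a] by (auto intro!: integrable_mult_of_squares simp: L2_rv_def)
    ultimately show "(LINT w|M. (X w - X' w) * wick_hermite \<xi> \<alpha> w) = 0"
      by (simp add: left_diff_distrib)
  qed measurable
  then have "(L2_err X b m) = (L2_err X' b m)" for m
    by (intro integral_cong_AE) (auto elim: eventually_mono)
  then show ?thesis using X' L2 by (simp add: first_chaos_rv_def)
qed

text \<open>Finite linear combinations of first-chaos variables are again such variables, so joint
  normality reduces to the law of a single one.\<close>

lemma first_chaos_rv_gaussian_represented: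
  assumes "\<And>t. t \<in> T \<Longrightarrow> first_chaos_rv (X t) (a t)" "\<And>t. t \<in> T \<Longrightarrow> Z t = first_chaos (a t)"
  shows "gaussian_represented M \<xi> X Z T"
proof -
  have "centered_gaussian_process M X T"
    unfolding centered_gaussian_process_def
  proof (intro allI impI)
    fix S and c :: "real \<Rightarrow> real" assume S: "finite S \<and> S \<subseteq> T"
    then have "first_chaos_rv (\<lambda>w. \<Sum>t\<in>S. c t * X t w) (\<lambda>k. \<Sum>t\<in>S. c t * a t k)"
      using assms(1) by (intro first_chaos_rv_sum) auto
    then have cn: "centered_normal M (\<lambda>w. \<Sum>t\<in>S. c t * X t w) (\<Sum>k. (\<Sum>t\<in>S. c t * a t k)\<^sup>2)"
      by (rule first_chaos_rv_centered_normal)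
    then have "0 \<le> (\<Sum>k. (\<Sum>t\<in>S. c t * a t k)\<^sup>2)" by (auto simp: centered_normal_def)
    with cn show "\<exists>v\<ge>0. centered_normal M (\<lambda>w. \<Sum>t\<in>S. c t * X t w) v" by blast
  qed
  then show ?thesis
    using assms first_chaos_rv_chaos_of unfolding gaussian_represented_def
    by (auto simp: first_chaos_rv_def)
qed

lemma is_gaussian_hida_process_first_chaos_iff:
  assumes Z: "\<And>t. t \<in> T \<Longrightarrow> Z t = first_chaos (a t)"
  shows "is_gaussian_hida_process M \<xi> Z T \<longleftrightarrow> (\<forall>t\<in>T. summable (\<lambda>k. (a t k)\<^sup>2))"
proof
  assume "is_gaussian_hida_process M \<xi> Z T"
  then show "\<forall>t\<in>T. summable (\<lambda>k. (a t k)\<^sup>2)"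
    using Z chaos_of_first_chaos_summable
    unfolding is_gaussian_hida_process_def gaussian_represented_def by metis
next
  assume "\<forall>t\<in>T. summable (\<lambda>k. (a t k)\<^sup>2)"
  \<comment> \<open>The variables are chosen separately for each time; they are jointly Gaussian
    because all are series in the same coordinates.\<close>
  then have "\<forall>t\<in>T. \<exists>X. first_chaos_rv X (a t)" using first_chaos_rv_exists by blast
  then obtain X where "\<forall>t\<in>T. first_chaos_rv (X t) (a t)" by metis
  then show "is_gaussian_hida_process M \<xi> Z T"
    unfolding is_gaussian_hida_process_def using first_chaos_rv_gaussian_represented[of T X a Z] Z by blast
qed

lemma gaussian_represented_centered_normal:
  assumes "gaussian_represented M \<xi> X Z T" "t \<in> T" "Z t = first_chaos b"
  shows "centered_normal M (X t) (\<Sum>k. (b k)\<^sup>2)"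
  using assms by (intro first_chaos_rv_centered_normal chaos_of_first_chaos_imp_rv) (auto simp: gaussian_represented_def)

end

section \<open>Integrals of deterministic functions\<close>

text \<open>With x_k the integral of v_k, the sum X of the x_k^2 is the integral of the sum of the
  x_k v_k(s). A weighted inequality between products and squares gives X <= X/2 + t^2 C/2, and the
  term X/2 is absorbed.\<close>

lemma sum_square_integral_le:
  fixes v :: "nat \<Rightarrow> real \<Rightarrow> real"
  assumes v: "\<And>k. continuous_on {0..t} (v k)" and t: "0 \<le> t"
    and le: "\<And>s. s \<in> {0..t} \<Longrightarrow> (\<Sum>k<n. (v k s)\<^sup>2) \<le> C"
  shows "(\<Sum>k<n. (LINT s:{0..t}|lborel. v k s)\<^sup>2) \<le> t\<^sup>2 * C"
proof (cases "t = 0")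
  case True
  have "(LINT s:{0..t}|lborel. v k s) = 0" for k
    using interval_integral_Icc[of 0 0 "v k"] by (simp add: True)
  then show ?thesis using True by simp
next
  case False
  then have t: "0 < t" using t by simp
  define x where "x k = (LINT s:{0..t}|lborel. v k s)" for k
  define X where "X = (\<Sum>k<n. (x k)\<^sup>2)"
  have vi: "set_integrable lborel {0..t} (v k)" for k
    using v by (rule borel_integrable_atLeastAtMost')
  have "X = (LINT s:{0..t}|lborel. (\<Sum>k<n. x k * v k s))"
  proof -
    have i: "integrable lborel (\<lambda>s. indicator {0..t} s * v k s)" for k
      using vi by (simp add: set_integrable_def)
    have "indicator {0..t} s *\<^sub>R (\<Sum>k<n. x k * v k s) = (\<Sum>k<n. x k * (indicator {0..t} s * v k s))" for s
      by (simp add: sum_distrib_left mult_ac)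
    then have "(LINT s:{0..t}|lborel. (\<Sum>k<n. x k * v k s)) = (\<Sum>k<n. x k * (LINT s|lborel. indicator {0..t} s * v k s))"
      unfolding set_lebesgue_integral_def using i by simp
    also have "\<dots> = X"
      by (simp add: X_def x_def set_lebesgue_integral_def power2_eq_square)
    finally show ?thesis by simp
  qed
  also have "\<dots> \<le> (LINT s:{0..t}|lborel. X / (2 * t) + t * C / 2)"
  proof (rule set_integral_mono)
    show "set_integrable lborel {0..t} (\<lambda>s. \<Sum>k<n. x k * v k s)"
      by (intro borel_integrable_atLeastAtMost' continuous_intros v)
    show "set_integrable lborel {0..t} (\<lambda>s. X / (2 * t) + t * C / 2)"
      by (intro borel_integrable_atLeastAtMost' continuous_intros)
    fix s assume s: "s \<in> {0..t}"
    \<comment> \<open>The weights 1/(2t) and t/2 are chosen so that integration over [0,t] returns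
      exactly X/2.\<close>
    have "x k * v k s \<le> (x k)\<^sup>2 / (2 * t) + t / 2 * (v k s)\<^sup>2" for k
    proof -
      have "0 \<le> (x k - t * v k s)\<^sup>2 / (2 * t)" using t by simp
      also have "(x k - t * v k s)\<^sup>2 / (2 * t) = (x k)\<^sup>2 / (2 * t) + t / 2 * (v k s)\<^sup>2 - x k * v k s"
        using t by (simp add: power2_eq_square field_simps)
      finally show ?thesis by simp
    qed
    then have "(\<Sum>k<n. x k * v k s) \<le> (\<Sum>k<n. (x k)\<^sup>2 / (2 * t) + t / 2 * (v k s)\<^sup>2)"
      by (intro sum_mono)
    also have "\<dots> = X / (2 * t) + t / 2 * (\<Sum>k<n. (v k s)\<^sup>2)"
      by (simp add: X_def sum.distrib sum_divide_distrib sum_distrib_left)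
    also have "\<dots> \<le> X / (2 * t) + t / 2 * C"
      using t le[OF s] by (intro add_mono mult_left_mono) auto
    finally show "(\<Sum>k<n. x k * v k s) \<le> X / (2 * t) + t * C / 2" by simp
  qed
  also have "\<dots> = t * (X / (2 * t) + t * C / 2)"
    using t by (simp add: set_lebesgue_integral_def)
  also have "\<dots> = X / 2 + t\<^sup>2 * C / 2"
    using t by (simp add: power2_eq_square field_simps)
  finally show ?thesis unfolding X_def[symmetric] x_def[symmetric] by simp
qed

section \<open>Integrating deterministic functions against the noise\<close>

context
  fixes h h' :: "real \<Rightarrow> real"
  assumes range: "\<And>t. 0 < h t \<and> h t < 1"
    and der: "\<And>s. (h has_real_derivative h' s) (at s)" and cont': "continuous_on UNIV h'"
begin

lemma wick_ito_pettis:
  assumes f: "f \<in> borel_measurable borel" "set_integrable lborel {0..t} f" and t: "0 \<le> t"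
  shows "pettis_has_integral (wick_ito_integrand f h t)
    (first_chaos (\<lambda>k. LBINT s=ereal 0..ereal t. f s * mf_coeff h k s)) UNIV"
proof -
  obtain C where C: "0 \<le> C" "\<And>k s. \<bar>s\<bar> \<le> t \<Longrightarrow> \<bar>mf_coeff h k s\<bar> \<le> C * (real k + 1)\<^sup>2"
    using mf_coeff_bound[OF range der cont'] by blast
  have "pettis_has_integral (\<lambda>s. first_chaos (\<lambda>k. indicator {0..t} s * f s * mf_coeff h k s))
    (first_chaos (\<lambda>k. LINT s:{0..t}|lborel. f s * mf_coeff h k s)) UNIV"
    by (rule pettis_has_integral_first_chaos[where C = C])
      (use f C borel_measurable_continuous_onI[OF continuous_mf_coeff[OF range der cont']] in auto)
  moreover have "wick_ito_integrand f h t = (\<lambda>s. first_chaos (\<lambda>k. indicator {0..t} s * f s * mf_coeff h k s))"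
    unfolding wick_ito_integrand_def mf_white_noise_def mf_coeff_def[symmetric] wick_const_first_chaos ..
  ultimately show ?thesis
    using t by (simp add: interval_integral_Icc)
qed

lemma wick_ito_coeff_summable:
  assumes fder: "\<And>s. (f has_real_derivative f' s) (at s)" and f': "continuous_on UNIV f'" and t: "0 \<le> t"
  shows "summable (\<lambda>k. (LBINT s=ereal 0..ereal t. f s * mf_coeff h k s)\<^sup>2)"
proof -
  define G where "G k s = g_fun (hermite_fun k) s (h s)" for k s
  have Gder: "(G k has_real_derivative mf_coeff h k s) (at s)" for k s
    unfolding G_def[abs_def] by (rule g_fun_curve_has_derivative[OF range der cont'])
  \<comment> \<open>\<open>g_fun\<close> at time 0 is an integral over a degenerate interval, so
    integration by parts has no boundary term there.\<close>
  have G0: "G k 0 = 0" for k by (simp add: G_def g_fun_def)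
  have contf: "continuous_on S f" "continuous_on S f'" for S
    using fder f' by (auto intro: continuous_at_imp_continuous_on DERIV_isCont continuous_on_subset)
  have contG: "continuous_on S (G k)" "continuous_on S (mf_coeff h k)" for S k
    using Gder continuous_mf_coeff[OF range der cont', of k]
    by (auto intro: continuous_at_imp_continuous_on DERIV_isCont continuous_on_subset)
  have parts: "(LBINT s=ereal 0..ereal t. f s * mf_coeff h k s) = f t * G k t - (LINT s:{0..t}|lborel. f' s * G k s)" for k
  proof -
    have "(LBINT s=ereal 0..ereal t. f' s * G k s + f s * mf_coeff h k s) = f t * G k t - f 0 * G k 0"
    proof (rule interval_integral_FTC_finite)
      show "((\<lambda>s. f s * G k s) has_vector_derivative f' s * G k s + f s * mf_coeff h k s) (at s within S)" for s S
        using DERIV_mult[OF fder[of s] Gder[of k s]]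
        by (simp add: has_real_derivative_iff_has_vector_derivative has_vector_derivative_at_within mult.commute add.commute)
    qed (intro continuous_intros contf contG)
    moreover have "(LINT s:{0..t}|lborel. f' s * G k s + f s * mf_coeff h k s)
       = (LINT s:{0..t}|lborel. f' s * G k s) + (LINT s:{0..t}|lborel. f s * mf_coeff h k s)"
      by (intro set_integral_add borel_integrable_atLeastAtMost' continuous_intros contf contG)
    ultimately show ?thesis using t by (simp add: interval_integral_Icc G0)
  qed
  obtain B where B: "0 \<le> B" "\<And>n s. \<bar>s\<bar> \<le> t \<Longrightarrow> (\<Sum>k<n. (G k s)\<^sup>2) \<le> B"
    unfolding G_def using sum_g_fun_curve_square_bound[OF range der cont'] by blast
  have "bounded (f' ` {0..t})"
    by (intro compact_imp_bounded compact_continuous_image contf) auto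
  then obtain L where "\<forall>s\<in>{0..t}. \<bar>f' s\<bar> \<le> L"
    unfolding bounded_iff by auto
  then have L: "\<And>s. s \<in> {0..t} \<Longrightarrow> \<bar>f' s\<bar> \<le> L" by blast
  have "(\<Sum>k<n. (LBINT s=ereal 0..ereal t. f s * mf_coeff h k s)\<^sup>2) \<le> 2 * ((f t)\<^sup>2 * B) + 2 * (t\<^sup>2 * (L\<^sup>2 * B))" for n
  proof -
    have "(\<Sum>k<n. (LBINT s=ereal 0..ereal t. f s * mf_coeff h k s)\<^sup>2)
      \<le> (\<Sum>k<n. 2 * (f t * G k t)\<^sup>2 + 2 * (LINT s:{0..t}|lborel. f' s * G k s)\<^sup>2)"
    proof (rule sum_mono)
      fix k
      show "(LBINT s=ereal 0..ereal t. f s * mf_coeff h k s)\<^sup>2 \<le> 2 * (f t * G k t)\<^sup>2 + 2 * (LINT s:{0..t}|lborel. f' s * G k s)\<^sup>2"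
        unfolding parts using square_add_le[of "f t * G k t" "- (LINT s:{0..t}|lborel. f' s * G k s)"] by simp
    qed
    also have "\<dots> = 2 * ((f t)\<^sup>2 * (\<Sum>k<n. (G k t)\<^sup>2)) + 2 * (\<Sum>k<n. (LINT s:{0..t}|lborel. f' s * G k s)\<^sup>2)"
      by (simp add: sum.distrib sum_distrib_left power_mult_distrib)
    also have "\<dots> \<le> 2 * ((f t)\<^sup>2 * B) + 2 * (t\<^sup>2 * (L\<^sup>2 * B))"
    proof (intro add_mono mult_left_mono B sum_square_integral_le t continuous_intros contf contG)
      fix s assume s: "s \<in> {0..t}"
      have "(\<Sum>k<n. (f' s * G k s)\<^sup>2) = (f' s)\<^sup>2 * (\<Sum>k<n. (G k s)\<^sup>2)"
        by (simp add: power_mult_distrib sum_distrib_left)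
      also have "\<dots> \<le> L\<^sup>2 * B"
        using power_mono[OF L[OF s] abs_ge_zero, of 2] B s
        by (intro mult_mono sum_nonneg) auto
      finally show "(\<Sum>k<n. (f' s * G k s)\<^sup>2) \<le> L\<^sup>2 * B" .
    qed (use t in auto)
    finally show ?thesis .
  qed
  then show ?thesis by (intro summableI_nonneg_bounded) auto
qed

end

theorem mainTheorem15:
  fixes M :: "'w measure" and \<xi> :: "nat \<Rightarrow> 'w \<Rightarrow> real"
    and h f :: "real \<Rightarrow> real"
  assumes wn: "white_noise_space M \<xi>"
    and h_range: "\<forall>t. 0 < h t \<and> h t < 1"
    and h_C1: "h C1_differentiable_on UNIV"
    and h_bdd: "bounded (range (deriv h))"
    and f_meas: "f \<in> borel_measurable lborel"
    and f_loc: "\<forall>a b. set_integrable lborel {a..b} f"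
  shows
    "(\<forall>t\<ge>0. pettis_has_integral (wick_ito_integrand f h t)
        (first_chaos (\<lambda>k. LBINT s=ereal 0..ereal t.
            f s * deriv (\<lambda>u. g_fun (hermite_fun k) u (h u)) s)) UNIV)
   \<and> (is_gaussian_hida_process M \<xi> (wick_ito_det f h) {0..} \<longleftrightarrow>
        (\<forall>t\<ge>0. summable (\<lambda>k. (LBINT s=ereal 0..ereal t.
            f s * deriv (\<lambda>u. g_fun (hermite_fun k) u (h u)) s)\<^sup>2)))
   \<and> (\<forall>X. gaussian_represented M \<xi> X (wick_ito_det f h) {0..} \<longrightarrow>
        (\<forall>t\<ge>0. centered_normal M (X t)
           (\<Sum>k. (LBINT s=ereal 0..ereal t.
              f s * deriv (\<lambda>u. g_fun (hermite_fun k) u (h u)) s)\<^sup>2)))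
   \<and> ((f C1_differentiable_on UNIV \<and> bounded (range (deriv f))) \<longrightarrow>
        is_gaussian_hida_process M \<xi> (wick_ito_det f h) {0..})"
proof -
  interpret white_noise M \<xi> using wn by unfold_locales
  obtain h' where h': "\<And>s. (h has_real_derivative h' s) (at s)" "continuous_on UNIV h'"
    using h_C1 unfolding C1_differentiable_on_def
    by (auto simp: has_real_derivative_iff_has_vector_derivative)
  have range: "\<And>t. 0 < h t \<and> h t < 1" using h_range by blast
  define a where "a t k = (LBINT s=ereal 0..ereal t. f s * mf_coeff h k s)" for t k
  have pettis: "pettis_has_integral (wick_ito_integrand f h t) (first_chaos (a t)) UNIV" if "0 \<le> t" for t
    unfolding a_def[abs_def] using f_meas f_loc that by (intro wick_ito_pettis[OF range h']) auto
  \<comment> \<open>Uniqueness of the Pettis integral identifies the definite description in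
    \<open>wick_ito_det\<close> with the coefficient formula.\<close>
  have Z: "wick_ito_det f h t = first_chaos (a t)" if "t \<in> {0..}" for t
    unfolding wick_ito_det_def using that by (intro pettis_integral_eq pettis) simp
  have gauss: "is_gaussian_hida_process M \<xi> (wick_ito_det f h) {0..} \<longleftrightarrow> (\<forall>t\<ge>0. summable (\<lambda>k. (a t k)\<^sup>2))"
    using is_gaussian_hida_process_first_chaos_iff[of "{0..}", OF Z] by auto
  have smooth: "is_gaussian_hida_process M \<xi> (wick_ito_det f h) {0..}" if fC1: "f C1_differentiable_on UNIV"
  proof -
    obtain f' where "\<And>s. (f has_real_derivative f' s) (at s)" "continuous_on UNIV f'"
      using fC1 unfolding C1_differentiable_on_def
      by (auto simp: has_real_derivative_iff_has_vector_derivative)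
    then show ?thesis
      unfolding gauss a_def by (intro allI impI wick_ito_coeff_summable[OF range h'])
  qed
  have normal: "centered_normal M (X t) (\<Sum>k. (a t k)\<^sup>2)"
    if "gaussian_represented M \<xi> X (wick_ito_det f h) {0..}" "0 \<le> t" for X t
    using that by (intro gaussian_represented_centered_normal[OF that(1) _ Z]) auto
  show ?thesis
    unfolding mf_coeff_def[symmetric] a_def[symmetric]
    by (intro conjI allI impI pettis gauss smooth normal) (assumption | erule conjunct1)+
qed

end
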